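(* Let $m,p\in\mathbb{N}_0$, let $a_i\in\mathbb{R}$, $\alpha_i>0$ with $a_i+\alpha_i>0$ for $i=1,\dots,p$, and let $b_j\in\mathbb{R}$, $\beta_j>0$ with $b_j+\beta_j>0$ for $j=1,\dots,m$. Put $a^*=\sum_{j=1}^m\beta_j-\sum_{i=1}^p\alpha_i$ and $\mu=\sum_{j=1}^mb_j-\sum_{i=1}^pa_i+(p-m)/2$, and assume that either $a^*>0$, or $a^*=0$ and $\mu<-1$. Assume also that $H^{m,0}_{p,m}\left[\,\cdot\,\Big|{(a_i,\alpha_i)_{1,p}\atop(b_j,\beta_j)_{1,m}}\right]$ is non-negative on $(0,\infty)$. Then the corresponding Fox-$H$ density $$\varrho(x)=\frac1KH^{m,0}_{p,m}\left[x\,\Big|{(a_i,\alpha_i)_{1,p}\atop(b_j,\beta_j)_{1,m}}\right],\quad x>0,\qquad K=\mathcal{H}^{m,0}_{p,m}(1)=\frac{\prod_{j=1}^m\Gamma(b_j+\beta_j)}{\prod_{i=1}^p\Gamma(a_i+\alpha_i)},$$ has finite moments of all orders, given by $$\int_0^\infty x^l\varrho(x)\,\mathrm{d}x=\frac1K(\mathcal{M}H^{m,0}_{p,m})(l+1),\quad l=0,1,\dots,$$ where $\mathcal{M}$ is the Mellin transform. Furthermore, if $\sum_{i=1}^p\alpha_i-\sum_{j=1}^m\beta_j>-1$, then its Laplace transform $\phi(s)=\int_0^\infty \mathrm{e}^{-sx}\varrho(x)\,\mathrm{d}x$ is given by $$\phi(s)=\frac1KH^{1,m}_{m,p+1}\left[s\,\Big|{(1-b_j-\beta_j,\beta_j)_{1,m}\atop(0,1),(1-a_i-\alpha_i,\alpha_i)_{1,p}}\right]=\frac1K\,{}_m\Psi_p\left[{(b_j+\beta_j,\beta_j)_{1,m}\atop(a_i+\alpha_i,\alpha_i)_{1,p}}\Big|-s\right],\quad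 s\ge0,$$ and it has an entire extension.
   Context: Fox-$H$ function: for integers $0\le m\le q$, $0\le n\le p$, parameters $a_i,b_j$ and $\alpha_i,\beta_j>0$, $$H^{m,n}_{p,q}\left[z\,\Big|{(a_i,\alpha_i)_{1,p}\atop(b_j,\beta_j)_{1,q}}\right]=\frac{1}{2\pi\mathrm{i}}\int_{\mathcal{L}}\mathcal{H}^{m,n}_{p,q}(s)z^{-s}\,\mathrm{d}s,\qquad \mathcal{H}^{m,n}_{p,q}(s)=\frac{\prod_{j=1}^{m}\Gamma(b_j+s\beta_j)\prod_{i=1}^{n}\Gamma(1-a_i-s\alpha_i)}{\prod_{i=n+1}^{p}\Gamma(a_i+s\alpha_i)\prod_{j=m+1}^{q}\Gamma(1-b_j-s\beta_j)},$$ with empty products $1$, empty sums $0$, $z^{-s}=\exp[-s(\mathrm{Log}|z|+\mathrm{i}\arg z)]$, and $\mathcal{L}=\mathcal{L}_{\mathrm{i}\gamma\infty}$ a contour from $\gamma-\mathrm{i}\infty$ to $\gamma+\mathrm{i}\infty$ ($\gamma\in\mathbb{R}$) separating the poles of $\Gamma(b_j+s\beta_j)$, $j\le m$ (left), from those of $\Gamma(1-a_i-s\alpha_i)$, $i\le n$ (right). The value at $s=0$ of a Fox-$H$ function giving a Laplace transform is understood as its limit as $s\to0^+$. Mellin transform: $(\mathcal{M}f)(s)=\int_0^\infty x^{s-1}f(x)\,\mathrm{d}x$. Generalized Wright function: ${}_m\Psi_p\left[{(A_i,\alpha_i)_{1,m}\atop(B_j,\beta_j)_{1,p}}\Big|z\right]=\sum_{k\ge0}\frac{\prod_{i=1}^m\Gamma(A_i+\alpha_ik)}{\prod_{j=1}^p\Gamma(B_j+\beta_jk)}\frac{z^k}{k!}$.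 A Fox-$H$ density is a probability density on $(0,\infty)$ which is a constant multiple of a Fox-$H$ function. *)

theory Defs
  imports "HOL-Complex_Analysis.Complex_Analysis"
begin

section \<open>The Fox H-function\<close>

text \<open>
  Parameter families are functions on \<^typ>\<open>nat\<close>, used at the indices \<open>1, \<dots>, p\<close> and \<open>1, \<dots>, q\<close>.
  At a pole of a Gamma factor in the denominator, \<^const>\<open>Gamma\<close> has the value \<open>0\<close> and so the
  kernel is \<open>0\<close>, which is the value of the reciprocal Gamma function there.
\<close>

definition Fox_H_kernel ::
  "nat \<Rightarrow> nat \<Rightarrow> nat \<Rightarrow> nat \<Rightarrow> (nat \<Rightarrow> complex) \<Rightarrow> (nat \<Rightarrow> real) \<Rightarrow> (nat \<Rightarrow> complex) \<Rightarrow> (nat \<Rightarrow> real)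
    \<Rightarrow> complex \<Rightarrow> complex"
where
  "Fox_H_kernel m n p q a \<alpha> b \<beta> s =
     ((\<Prod>j\<in>{1..m}. Gamma (b j + s * of_real (\<beta> j))) *
      (\<Prod>i\<in>{1..n}. Gamma (1 - a i - s * of_real (\<alpha> i)))) /
     ((\<Prod>i\<in>{n+1..p}. Gamma (a i + s * of_real (\<alpha> i))) *
      (\<Prod>j\<in>{m+1..q}. Gamma (1 - b j - s * of_real (\<beta> j))))"

definition Fox_H_left_poles :: "nat \<Rightarrow> (nat \<Rightarrow> complex) \<Rightarrow> (nat \<Rightarrow> real) \<Rightarrow> complex set" where
  "Fox_H_left_poles m b \<beta> =
     (\<Union>j\<in>{1..m}. {s. is_pole (\<lambda>w. Gamma (b j + w * of_real (\<beta> j))) s})"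

definition Fox_H_right_poles :: "nat \<Rightarrow> (nat \<Rightarrow> complex) \<Rightarrow> (nat \<Rightarrow> real) \<Rightarrow> complex set" where
  "Fox_H_right_poles n a \<alpha> =
     (\<Union>i\<in>{1..n}. {s. is_pole (\<lambda>w. Gamma (1 - a i - w * of_real (\<alpha> i))) s})"

text \<open>
  A contour from \<open>\<gamma> - \<i>\<infinity>\<close> to \<open>\<gamma> + \<i>\<infinity>\<close> is encoded by a piecewise smooth path \<open>g\<close> from
  \<open>\<gamma> - \<i>T\<close> to \<open>\<gamma> + \<i>T\<close>, completed by the two vertical rays on the line \<open>Re s = \<gamma>\<close>.
\<close>

definition MB_contour :: "real \<Rightarrow> real \<Rightarrow> (real \<Rightarrow> complex) \<Rightarrow> bool" where
  "MB_contour \<gamma> T g \<longleftrightarrow>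
     0 < T \<and> valid_path g \<and> pathstart g = Complex \<gamma> (- T) \<and> pathfinish g = Complex \<gamma> T"

definition MB_contour_image :: "real \<Rightarrow> real \<Rightarrow> (real \<Rightarrow> complex) \<Rightarrow> complex set" where
  "MB_contour_image \<gamma> T g = path_image g \<union> {s. Re s = \<gamma> \<and> T \<le> \<bar>Im s\<bar>}"

text \<open>
  The real parts on a contour are bounded, so its complement contains a left and a right half-plane.
  A point lies to the left (right) of the contour if it can be joined to the left (right) half-plane
  without meeting the contour.
\<close>

definition left_of_contour :: "complex set \<Rightarrow> complex set" where
  "left_of_contour C = {w. \<exists>x. (\<forall>s\<in>C. Re x < Re s) \<and> connected_component (- C) w x}"

definition right_of_contour :: "complex set \<Rightarrow> complex set" where
  "right_of_contour C = {w. \<exists>x. (\<forall>s\<in>C. Re s < Re x) \<and> connected_component (- C) w x}"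

definition separating_MB_contour ::
  "complex set \<Rightarrow> complex set \<Rightarrow> real \<Rightarrow> real \<Rightarrow> (real \<Rightarrow> complex) \<Rightarrow> bool"
where
  "separating_MB_contour P Q \<gamma> T g \<longleftrightarrow>
     MB_contour \<gamma> T g \<and>
     P \<subseteq> left_of_contour (MB_contour_image \<gamma> T g) \<and>
     Q \<subseteq> right_of_contour (MB_contour_image \<gamma> T g)"

text \<open>On the rays \<open>s = \<gamma> + \<i>t\<close>, whence the factors \<open>\<i>\<close>.\<close>

definition has_MB_integral ::
  "(complex \<Rightarrow> complex) \<Rightarrow> complex \<Rightarrow> real \<Rightarrow> real \<Rightarrow> (real \<Rightarrow> complex) \<Rightarrow> bool"
where
  "has_MB_integral f I \<gamma> T g \<longleftrightarrow>
     (\<exists>I1 I2 I3.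
        ((\<lambda>t. f (Complex \<gamma> t)) has_integral I1) {..- T} \<and>
        (f has_contour_integral I2) g \<and>
        ((\<lambda>t. f (Complex \<gamma> t)) has_integral I3) {T..} \<and>
        I = \<i> * I1 + I2 + \<i> * I3)"

definition has_Fox_H ::
  "nat \<Rightarrow> nat \<Rightarrow> nat \<Rightarrow> nat \<Rightarrow> (nat \<Rightarrow> complex) \<Rightarrow> (nat \<Rightarrow> real) \<Rightarrow> (nat \<Rightarrow> complex) \<Rightarrow> (nat \<Rightarrow> real)
    \<Rightarrow> complex \<Rightarrow> complex \<Rightarrow> bool"
where
  "has_Fox_H m n p q a \<alpha> b \<beta> z v \<longleftrightarrow>
     (\<exists>\<gamma> T g I.
        separating_MB_contour (Fox_H_left_poles m b \<beta>) (Fox_H_right_poles n a \<alpha>) \<gamma> T g \<and>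
        has_MB_integral
          (\<lambda>s. Fox_H_kernel m n p q a \<alpha> b \<beta> s *
               exp (- s * (of_real (ln (cmod z)) + \<i> * of_real (Arg z)))) I \<gamma> T g \<and>
        v = I / (2 * of_real pi * \<i>))"

text \<open>By Cauchy's theorem the value does not depend on the contour.\<close>

definition Fox_H ::
  "nat \<Rightarrow> nat \<Rightarrow> nat \<Rightarrow> nat \<Rightarrow> (nat \<Rightarrow> complex) \<Rightarrow> (nat \<Rightarrow> real) \<Rightarrow> (nat \<Rightarrow> complex) \<Rightarrow> (nat \<Rightarrow> real)
    \<Rightarrow> complex \<Rightarrow> complex"
where
  "Fox_H m n p q a \<alpha> b \<beta> z = (THE v. has_Fox_H m n p q a \<alpha> b \<beta> z v)"


section \<open>Generalized Wright function and Mellin transform\<close>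

definition Wright_term ::
  "nat \<Rightarrow> nat \<Rightarrow> (nat \<Rightarrow> complex) \<Rightarrow> (nat \<Rightarrow> real) \<Rightarrow> (nat \<Rightarrow> complex) \<Rightarrow> (nat \<Rightarrow> real)
    \<Rightarrow> complex \<Rightarrow> nat \<Rightarrow> complex"
where
  "Wright_term m p A \<alpha> B \<beta> z k =
     (\<Prod>i\<in>{1..m}. Gamma (A i + of_real (\<alpha> i) * of_nat k)) /
     (\<Prod>j\<in>{1..p}. Gamma (B j + of_real (\<beta> j) * of_nat k)) * z ^ k / fact k"

definition Wright_Psi ::
  "nat \<Rightarrow> nat \<Rightarrow> (nat \<Rightarrow> complex) \<Rightarrow> (nat \<Rightarrow> real) \<Rightarrow> (nat \<Rightarrow> complex) \<Rightarrow> (nat \<Rightarrow> real)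
    \<Rightarrow> complex \<Rightarrow> complex"
where
  "Wright_Psi m p A \<alpha> B \<beta> z = (\<Sum>k. Wright_term m p A \<alpha> B \<beta> z k)"

definition Mellin :: "(real \<Rightarrow> complex) \<Rightarrow> complex \<Rightarrow> complex" where
  "Mellin f s = (LBINT x:{0<..}. of_real x powr (s - 1) * f x)"

end

theory Submission
  imports Defs
begin

text \<open>
  Write \<open>h(s) = \<Prod>\<Gamma>(b\<^sub>j + \<beta>\<^sub>j s) / \<Prod>\<Gamma>(a\<^sub>i + \<alpha>\<^sub>i s)\<close> for the kernel of the Fox H-function in question. Its poles are
  real and all lie to the left of some \<open>\<sigma> < 1\<close>, because \<open>b\<^sub>j + \<beta>\<^sub>j > 0\<close>. By Stirling's formula for the
  modulus of Gamma, \<open>\<bar>h(x + \<i>t)\<bar>\<close> behaves on a vertical strip like \<open>\<bar>t\<bar>\<close> to the power \<open>\<mu> + a\<^sup>* x\<close> times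
  \<open>exp(- \<pi> a\<^sup>* \<bar>t\<bar> / 2)\<close>. The hypothesis on \<open>a\<^sup>*\<close> and \<open>\<mu>\<close> is exactly what makes this \<open>O(\<bar>t\<bar>\<^sup>-\<^sup>\<kappa>)\<close> with \<open>\<kappa> > 1\<close>
  (\<open>strip_decay_h\<close>), so that \<open>h\<close> is absolutely integrable on every vertical line to the right of the
  poles. Cauchy's theorem then identifies the value of \<open>H\<close> with \<open>(1 / 2\<pi>) \<integral> h(c + \<i>t) x\<^sup>-\<^sup>c\<^sup>-\<^sup>\<i>\<^sup>t dt\<close> for every
  \<open>c \<ge> \<sigma>\<close>, whatever separating contour one starts from (\<open>Fox_H_eq_vertical_line\<close>).

  Moments. Small \<open>c\<close> controls \<open>H(x)\<close> near \<open>0\<close> and large \<open>c\<close> controls it near \<open>\<infinity>\<close>, so all moments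
  exist. Integrating the line representation against \<open>x\<^sup>l\<close> over \<open>(0, 1)\<close> on a line
  \<open>c\<^sub>1 < l + 1\<close> and over \<open>(1, \<infinity>)\<close> on a line \<open>c\<^sub>2 > l + 1\<close> turns the moment into the Cauchy integral
  of \<open>h(s) / (s - (l + 1))\<close> around the strip between the two lines; hence it is \<open>h(l + 1)\<close>
  (\<open>H_real_moment\<close>). The case \<open>l = 0\<close> gives the normalization, as \<open>K = h(1)\<close>.

  Laplace transform. On a line with \<open>\<sigma> \<le> c < 1\<close>, Fubini's theorem and Euler's integral give
  \<open>\<integral> exp(- s x) H(x) dx = (1 / 2\<pi>) \<integral> h(u) \<Gamma>(1 - u) s\<^sup>u\<^sup>-\<^sup>1 dt\<close>, where \<open>u = c + \<i>t\<close>. The substitution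
  \<open>w = 1 - u\<close> makes this the line representation of the second Fox H-function, whose kernel is
  \<open>\<Gamma>(w) h(1 - w)\<close> (\<open>Laplace_H_real_eq_H_dual\<close>). Expanding the exponential instead gives the series with terms
  \<open>h(k + 1) (- s)\<^sup>k / k!\<close>, which is the Wright series. Logarithmic convexity of Gamma bounds
  \<open>h(k + 2) / h(k + 1)\<close> by a multiple of \<open>k\<close> to the power \<open>a\<^sup>*\<close>, so for \<open>a\<^sup>* < 1\<close> the radius of convergence is infinite; this
  justifies the expansion and gives the entire extension (\<open>Laplace_H_real_series\<close>).
\<close>

section \<open>The modulus of the Gamma function on vertical strips\<close>

text \<open>
  The argument of the Bohr-Mollerup theorem: a chord of a convex function is steeper than any chord to
  its left and flatter than any chord to its right. Comparing \<open>[x, x + r]\<close> with chords of length one,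
  whose slopes are known, therefore determines the increment over \<open>[x, x + r]\<close> up to a small error.
\<close>

lemma convex_on_unit_step_bounds:
  fixes f d :: "real \<Rightarrow> real"
  assumes f: "convex_on {0<..} f" and step: "\<And>t. t > 0 \<Longrightarrow> f (t + 1) = f t + d t"
    and "x > 1" "r \<ge> 0"
  shows "r * d (x - 1) \<le> f (x + r) - f x" and "f (x + r) - f x \<le> r * d (x + r)"
proof -
  have "r * d (x - 1) \<le> f (x + r) - f x \<and> f (x + r) - f x \<le> r * d (x + r)"
  proof (cases "r = 0")
    case False
    with \<open>r \<ge> 0\<close> have r: "r > 0" by simp
    have "(f (x-1) - f x) / (x-1-x) \<le> (f (x-1) - f (x+r)) / (x-1-(x+r))"
      by (rule convex_on_slope_le(1)[OF f]) (use assms r in auto)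
    also have "\<dots> \<le> (f x - f (x+r)) / (x - (x+r))"
      by (rule convex_on_slope_le(2)[OF f]) (use assms r in auto)
    finally have 1: "f x - f (x-1) \<le> (f (x+r) - f x) / r" using r by (simp add: field_simps)
    have "(f x - f (x+r)) / (x-(x+r)) \<le> (f x - f (x+r+1)) / (x-(x+r+1))"
      by (rule convex_on_slope_le(1)[OF f]) (use assms r in auto)
    also have "\<dots> \<le> (f (x+r) - f (x+r+1)) / (x+r-(x+r+1))"
      by (rule convex_on_slope_le(2)[OF f]) (use assms r in auto)
    finally have 2: "(f (x+r) - f x) / r \<le> f (x+r+1) - f (x+r)" using r by (simp add: field_simps)
    show ?thesis
      using 1 2 step[of "x-1"] step[of "x+r"] assms r by (simp add: field_simps)
  qed simp
  thus "r * d (x - 1) \<le> f (x + r) - f x" and "f (x + r) - f x \<le> r * d (x + r)" by auto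
qed

text \<open>
  The function is \<open>ln \<bar>1 + \<i>y/u\<bar>\<close>, the contribution of one factor of Euler's product to
  \<open>ln \<Gamma>(x) - ln \<bar>\<Gamma>(x + \<i>y)\<bar>\<close>.
\<close>

lemma convex_on_ln_norm_div:
  fixes y :: real
  shows "convex_on {0<..} (\<lambda>u. ln (u\<^sup>2 + y\<^sup>2) / 2 - ln u)"
proof (rule f''_ge0_imp_convex)
  fix u :: real assume "u \<in> {0<..}"
  hence u: "u > 0" by simp
  hence p: "u\<^sup>2 + y\<^sup>2 > 0" by (simp add: add_pos_nonneg)
  show "((\<lambda>u. ln (u\<^sup>2 + y\<^sup>2) / 2 - ln u) has_real_derivative (u / (u\<^sup>2 + y\<^sup>2) - 1 / u)) (at u)"
    using u p by (auto intro!: derivative_eq_intros simp: divide_simps) (simp add: algebra_simps)?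
  show "((\<lambda>u. u / (u\<^sup>2 + y\<^sup>2) - 1 / u) has_real_derivative
          ((y\<^sup>2 - u\<^sup>2) / (u\<^sup>2 + y\<^sup>2)\<^sup>2 + 1 / u\<^sup>2)) (at u)"
    using u p by (auto intro!: derivative_eq_intros simp: field_simps power2_eq_square)
  have "(u\<^sup>2 + y\<^sup>2)\<^sup>2 - (u\<^sup>2 - y\<^sup>2) * u\<^sup>2 = 3 * (u * y)\<^sup>2 + (y\<^sup>2)\<^sup>2"
    by (simp add: power2_eq_square algebra_simps)
  hence "(u\<^sup>2 - y\<^sup>2) * u\<^sup>2 \<le> (u\<^sup>2 + y\<^sup>2)\<^sup>2"
    by (smt (verit) zero_le_power2)
  thus "(y\<^sup>2 - u\<^sup>2) / (u\<^sup>2 + y\<^sup>2)\<^sup>2 + 1 / u\<^sup>2 \<ge> 0"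
    using u p by (simp add: field_simps)
qed simp

lemma convex_on_sum_fun:
  assumes "finite A" "convex S" "\<And>i. i \<in> A \<Longrightarrow> convex_on S (f i)"
  shows "convex_on S (\<lambda>x. \<Sum>i\<in>A. f i x)"
  using assms by (induction A rule: finite_induct) (auto intro: convex_on_add simp: convex_on_const)

lemma convex_on_LIMSEQ:
  fixes f :: "nat \<Rightarrow> real \<Rightarrow> real"
  assumes cvx: "\<And>n. convex_on S (f n)" and lim: "\<And>x. x \<in> S \<Longrightarrow> (\<lambda>n. f n x) \<longlonglongrightarrow> g x"
  shows "convex_on S g"
proof (rule convex_onI)
  show S: "convex S" using cvx[of 0] by (simp add: convex_on_def)
  fix t x y :: real assume *: "0 < t" "t < 1" "x \<in> S" "y \<in> S"
  let ?z = "(1 - t) *\<^sub>R x + t *\<^sub>R y"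
  have "?z \<in> S" using S * by (auto simp: convex_alt)
  hence "(\<lambda>n. f n ?z) \<longlonglongrightarrow> g ?z" by (rule lim)
  moreover have "(\<lambda>n. (1 - t) * f n x + t * f n y) \<longlonglongrightarrow> (1 - t) * g x + t * g y"
    by (intro tendsto_intros lim *)
  moreover have "f n ?z \<le> (1 - t) * f n x + t * f n y" for n
    using convex_onD[OF cvx[of n], of t x y] * by simp
  ultimately show "g ?z \<le> (1 - t) * g x + t * g y" by (intro LIMSEQ_le) auto
qed

lemma Complex_notin_nonpos_Ints: "x > 0 \<Longrightarrow> Complex x y \<notin> \<int>\<^sub>\<le>\<^sub>0"
  by (auto elim!: nonpos_Ints_cases simp: complex_eq_iff)

text \<open>
  In Euler's product for the quotient \<open>\<Gamma>(x) / \<bar>\<Gamma>(x + \<i>y)\<bar>\<close> the factorials and powers of \<open>n\<close> cancel, and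
  what remains is a product of factors \<open>\<bar>x + k + \<i>y\<bar> / (x + k)\<close>, each log-convex in \<open>x\<close>. This is the
  substitute for log-convexity of \<open>x \<mapsto> \<bar>\<Gamma>(x + \<i>y)\<bar>\<close>, which fails in general.
\<close>

lemma convex_on_ln_Gamma_quotient:
  "convex_on {0<..} (\<lambda>x. ln (Gamma x) - ln (cmod (Gamma (Complex x y))))"
proof (rule convex_on_LIMSEQ)
  let ?g = "\<lambda>u. ln (u\<^sup>2 + y\<^sup>2) / 2 - ln u :: real"
  fix n :: nat
  show "convex_on {0<..} (\<lambda>x. \<Sum>k\<in>{..n}. ?g (x + real k))"
  proof (rule convex_on_sum_fun)
    fix k
    show "convex_on {0<..} (\<lambda>x. ?g (x + real k))"
    proof (rule convex_onI)
      fix t u v :: real assume *: "0 < t" "t < 1" "u \<in> {0<..}" "v \<in> {0<..}"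
      have "?g ((1 - t) *\<^sub>R (u + k) + t *\<^sub>R (v + k)) \<le> (1 - t) * ?g (u + k) + t * ?g (v + k)"
        by (rule convex_onD[OF convex_on_ln_norm_div]) (use * in auto)
      moreover have "(1 - t) *\<^sub>R (u + k) + t *\<^sub>R (v + k) = (1 - t) *\<^sub>R u + t *\<^sub>R v + k"
        by (simp add: algebra_simps)
      ultimately show "?g ((1 - t) *\<^sub>R u + t *\<^sub>R v + real k) \<le> (1 - t) * ?g (u + real k) + t * ?g (v + real k)"
        by simp
    qed simp
  qed auto
next
  let ?g = "\<lambda>u. ln (u\<^sup>2 + y\<^sup>2) / 2 - ln u :: real"
  fix x :: real assume "x \<in> {0<..}"
  hence x: "x > 0" by simp
  let ?z = "Complex x y"
  have G: "Gamma x > 0" "cmod (Gamma ?z) > 0"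
    using x Complex_notin_nonpos_Ints[of x y] by (auto simp: Gamma_real_pos Gamma_eq_zero_iff)
  have "(\<lambda>n. ln (Gamma_series x n) - ln (cmod (Gamma_series ?z n))) \<longlonglongrightarrow>
          ln (Gamma x) - ln (cmod (Gamma ?z))"
    using G by (intro tendsto_intros) auto
  moreover have "ln (Gamma_series x n) - ln (cmod (Gamma_series ?z n)) = (\<Sum>k\<le>n. ?g (x + real k))"
    if "n > 0" for n
  proof -
    have nz: "cmod (?z + of_nat k) > 0" for k using x by (auto simp: complex_eq_iff)
    have pz: "pochhammer ?z (n+1) \<noteq> 0"
    proof
      assume "pochhammer ?z (n+1) = 0"
      then obtain k where "?z = - of_nat k" by (auto simp only: pochhammer_eq_0_iff)
      thus False using x by (simp add: complex_eq_iff)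
    qed
    have "ln (cmod (pochhammer ?z (n+1))) = (\<Sum>k\<le>n. ln (cmod (?z + of_nat k)))"
      unfolding pochhammer_prod prod_norm[symmetric]
      by (subst ln_prod) (use nz in \<open>auto simp: atMost_atLeast0 atLeastLessThanSuc_atLeastAtMost\<close>)
    also have "\<dots> = (\<Sum>k\<le>n. ln ((x + k)\<^sup>2 + y\<^sup>2) / 2)"
    proof (rule sum.cong[OF refl])
      fix k :: nat
      have "(x+k)\<^sup>2 + y\<^sup>2 > 0" using x by (simp add: add_pos_nonneg)
      thus "ln (cmod (?z + of_nat k)) = ln ((x + k)\<^sup>2 + y\<^sup>2) / 2"
        unfolding cmod_def by (subst ln_sqrt) auto
    qed
    finally have 1: "ln (cmod (pochhammer ?z (n+1))) = (\<Sum>k\<le>n. ln ((x + k)\<^sup>2 + y\<^sup>2) / 2)" .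
    have 2: "ln (pochhammer x (n+1)) = (\<Sum>k\<le>n. ln (x + real k))"
      unfolding pochhammer_prod
      by (subst ln_prod) (use x in \<open>auto simp: atMost_atLeast0 atLeastLessThanSuc_atLeastAtMost\<close>)
    have pos: "pochhammer x (n+1) > 0" using x by (simp add: pochhammer_pos)
    have "ln (cmod (Gamma_series ?z n)) = ln (fact n) + x * ln n - ln (cmod (pochhammer ?z (n+1)))"
      using pz unfolding Gamma_series_def norm_divide norm_mult
      by (subst ln_div) (auto simp: ln_mult norm_fact)
    moreover have "ln (Gamma_series x n) = ln (fact n) + x * ln n - ln (pochhammer x (n+1))"
      using pos unfolding Gamma_series_def 
      by (subst ln_div) (auto simp: ln_mult)
    ultimately show ?thesis unfolding 1 2 by (simp add: sum_subtractf)
  qed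
  ultimately show "(\<lambda>n. \<Sum>k\<le>n. ?g (x + real k)) \<longlonglongrightarrow> ln (Gamma x) - ln (cmod (Gamma ?z))"
    by (rule Lim_transform_eventually[OF _ eventually_mono[OF eventually_gt_at_top[of 0]]])
qed

lemma Gamma_plus1_Complex:
  "Complex x y \<notin> \<int>\<^sub>\<le>\<^sub>0 \<Longrightarrow> Gamma (Complex (x + 1) y) = Complex x y * Gamma (Complex x y)"
  using Gamma_plus1[of "Complex x y"] by (simp add: Complex_eq algebra_simps)

lemma ln_Gamma_real_shift_bounds:
  fixes x r :: real
  assumes "x > 1" "r \<ge> 0"
  shows "r * ln (x - 1) \<le> ln (Gamma (x + r)) - ln (Gamma x)"
    and "ln (Gamma (x + r)) - ln (Gamma x) \<le> r * ln (x + r)"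
proof -
  have cvx: "convex_on {0<..} (\<lambda>t. ln (Gamma t) :: real)"
    using log_convex_Gamma_real by (simp add: o_def)
  have step: "ln (Gamma (t + 1)) = ln (Gamma t) + ln t" if "t > 0" for t :: real
  proof -
    have "t \<notin> \<int>\<^sub>\<le>\<^sub>0" using that by (auto elim!: nonpos_Ints_cases)
    thus ?thesis using that Gamma_real_pos[OF that] by (simp add: Gamma_plus1 ln_mult less_imp_neq[THEN not_sym])
  qed
  show "r * ln (x - 1) \<le> ln (Gamma (x + r)) - ln (Gamma x)"
    and "ln (Gamma (x + r)) - ln (Gamma x) \<le> r * ln (x + r)"
    using convex_on_unit_step_bounds[OF cvx step assms] by auto
qed

lemma cosh_exp_bounds:
  fixes t :: real
  shows "exp \<bar>t\<bar> / 2 \<le> cosh t" "cosh t \<le> exp \<bar>t\<bar>"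
proof -
  have "exp (-t) \<le> exp \<bar>t\<bar>" "exp t \<le> exp \<bar>t\<bar>" by (simp_all only: exp_le_cancel_iff abs_ge_self abs_ge_minus_self)
  hence "exp t + exp (-t) \<le> 2 * exp \<bar>t\<bar>" by linarith
  thus "cosh t \<le> exp \<bar>t\<bar>" by (simp add: cosh_field_def)
  have "exp \<bar>t\<bar> \<le> exp t + exp (-t)" by (cases "t \<ge> 0") auto
  thus "exp \<bar>t\<bar> / 2 \<le> cosh t" by (simp add: cosh_def)
qed

text \<open>
  On the critical line \<open>1 - z\<close> is the conjugate of \<open>z\<close>, so the reflection formula yields the modulus
  in closed form. This anchors the asymptotics, exponential factor included.
\<close>

lemma norm_Gamma_half: "(cmod (Gamma (Complex (1/2) y)))\<^sup>2 = pi / cosh (pi * y)"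
proof -
  let ?z = "Complex (1/2) y"
  have "1 - ?z = cnj ?z" by (simp add: complex_eq_iff)
  hence "(cmod (Gamma ?z))\<^sup>2 = cmod (Gamma ?z * Gamma (1 - ?z))"
    by (simp add: norm_mult power2_eq_square flip: cnj_Gamma)
  also have "\<dots> = cmod (of_real pi / sin (of_real pi * ?z))" by (simp only: Gamma_reflection_complex)
  also have "sin (of_real pi * ?z) = of_real (cosh (pi * y))"
    by (auto simp: complex_eq_iff Re_sin Im_sin cosh_def field_simps)
  finally show ?thesis by (simp add: norm_divide)
qed

text \<open>
  The modulus predicted by Stirling's formula for \<open>\<Gamma>(x + \<i>y)\<close>, up to the factor \<open>\<surd>(2\<pi>)\<close>, as \<open>\<bar>y\<bar> \<rightarrow> \<infinity>\<close>.
\<close>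

definition Stirling_modulus :: "real \<Rightarrow> real \<Rightarrow> real" where
  "Stirling_modulus x y = \<bar>y\<bar> powr (x - 1/2) * exp (- pi * \<bar>y\<bar> / 2)"

lemma Stirling_modulus_pos: "y \<noteq> 0 \<Longrightarrow> Stirling_modulus x y > 0"
  by (simp add: Stirling_modulus_def)

lemma Stirling_modulus_plus1: "y \<noteq> 0 \<Longrightarrow> Stirling_modulus (x + 1) y = \<bar>y\<bar> * Stirling_modulus x y"
  using powr_add[of "\<bar>y\<bar>" 1 "x - 1/2"] by (simp add: Stirling_modulus_def algebra_simps)

definition Stirling_comparable :: "real \<Rightarrow> real \<Rightarrow> bool" where
  "Stirling_comparable u v \<longleftrightarrow> (\<exists>c>0. \<exists>C>0. \<forall>x\<in>{u..v}. \<forall>y. 1 \<le> \<bar>y\<bar> \<longrightarrow>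
     c * Stirling_modulus x y \<le> cmod (Gamma (Complex x y)) \<and>
     cmod (Gamma (Complex x y)) \<le> C * Stirling_modulus x y)"

lemma norm_Complex_bounds:
  assumes "\<bar>x\<bar> \<le> a" "1 \<le> \<bar>y\<bar>"
  shows "\<bar>y\<bar> \<le> cmod (Complex x y)" "cmod (Complex x y) \<le> (a + 1) * \<bar>y\<bar>"
proof -
  show "\<bar>y\<bar> \<le> cmod (Complex x y)" using abs_Im_le_cmod[of "Complex x y"] by simp
  have "cmod (Complex x y) \<le> \<bar>x\<bar> + \<bar>y\<bar>" using cmod_le[of "Complex x y"] by simp
  moreover have "\<bar>x\<bar> \<le> a * \<bar>y\<bar>" using assms mult_mono[of "\<bar>x\<bar>" a 1 "\<bar>y\<bar>"] by auto
  ultimately show "cmod (Complex x y) \<le> (a + 1) * \<bar>y\<bar>" by (simp add: algebra_simps)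
qed

text \<open>
  The strip has width one and starts at \<open>3/2\<close>, so that the lower comparison chord \<open>[1/2, 3/2]\<close> stays in
  the domain of convexity. Each unit chord has slope \<open>- ln \<bar>y\<bar> + O(1)\<close>, hence
  \<open>ln \<bar>\<Gamma>(3/2 + r + \<i>y)\<bar> = ln \<bar>\<Gamma>(3/2 + \<i>y)\<bar> + r ln \<bar>y\<bar> + O(1)\<close>, and the value at \<open>3/2\<close> comes from the
  one at \<open>1/2\<close> by the functional equation.
\<close>

lemma Stirling_comparable_base: "Stirling_comparable (3/2) (5/2)"
proof -
  have b: "exp (- ln 5) * Stirling_modulus x y \<le> cmod (Gamma (Complex x y)) \<and>
        cmod (Gamma (Complex x y)) \<le> (sqrt (2*pi) * (3/2) * 20) * Stirling_modulus x y"
    if x: "x \<in> {3/2..5/2}" and y: "1 \<le> \<bar>y\<bar>" for x y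
  proof -
    define r where "r = x - 3/2"
    have r: "0 \<le> r" "r \<le> 1" and xr: "x = 3/2 + r" using x by (auto simp: r_def)
    let ?L = "\<lambda>x. ln (cmod (Gamma (Complex x y)))"
    have Lpos: "cmod (Gamma (Complex x y)) > 0" if "x > 0" for x
      using Complex_notin_nonpos_Ints[OF that] by (auto simp: Gamma_eq_zero_iff)
    \<comment> \<open>\<open>d t\<close> is the slope of the convex function over the unit interval \<open>[t, t + 1]\<close>.\<close>
    define d where "d = (\<lambda>t. ln t - ln (cmod (Complex t y)))"
    have step: "ln (Gamma (t + 1)) - ?L (t + 1) = ln (Gamma t) - ?L t + d t" if "t > 0" for t
    proof -
      have t: "t \<notin> \<int>\<^sub>\<le>\<^sub>0" using that by (auto elim!: nonpos_Ints_cases)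
      have "Gamma t > 0" "Gamma t \<noteq> 0" using Gamma_real_pos[OF that] by auto
      moreover have "cmod (Complex t y) > 0" using that by (auto simp: complex_eq_iff)
      ultimately show ?thesis
        using that t Lpos[OF that] Complex_notin_nonpos_Ints[OF that, of y]
        by (simp add: Gamma_plus1 Gamma_plus1_Complex ln_mult norm_mult d_def)
    qed
    note D = convex_on_unit_step_bounds[OF convex_on_ln_Gamma_quotient step, of "3/2" r, simplified]
    note G = ln_Gamma_real_shift_bounds[of "3/2" r, simplified]
    have dl: "- ln 8 - ln \<bar>y\<bar> \<le> d (1/2)"
    proof -
      have "cmod (Complex (1/2) y) \<le> (1/2 + 1) * \<bar>y\<bar>" using y by (intro norm_Complex_bounds) auto
      also have "\<dots> \<le> 4 * \<bar>y\<bar>" by simp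
      finally have c: "cmod (Complex (1/2) y) \<le> 4 * \<bar>y\<bar>" .
      have "cmod (Complex (1/2) y) > 0" by (auto simp: complex_eq_iff)
      hence "ln (cmod (Complex (1/2) y)) \<le> ln (4 * \<bar>y\<bar>)" using c y by (subst ln_le_cancel_iff) auto
      also have "\<dots> = ln 4 + ln \<bar>y\<bar>" using y by (simp add: ln_mult)
      finally have "d (1/2) \<ge> ln (1/2) - ln 4 - ln \<bar>y\<bar>" by (simp add: d_def)
      moreover have "ln (1/2) - ln 4 = - ln (8::real)" 
      proof -
        have "ln (2 * 4 :: real) = ln 2 + ln 4" by (rule ln_mult_pos) auto
        hence "ln (8::real) = ln 2 + ln 4" by simp
        moreover have "ln (1/2) = - ln (2::real)" by (subst ln_div) auto
        ultimately show ?thesis by linarith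
      qed
      ultimately show ?thesis by linarith
    qed
    have du: "d (3/2 + r) \<le> ln (5/2) - ln \<bar>y\<bar>"
    proof -
      have "\<bar>y\<bar> \<le> cmod (Complex (3/2+r) y)" by (rule norm_Complex_bounds[OF order_refl y])
      hence "ln \<bar>y\<bar> \<le> ln (cmod (Complex (3/2+r) y))" using y by (subst ln_le_cancel_iff) auto
      moreover have "ln (3/2+r) \<le> ln (5/2)" using r by (subst ln_le_cancel_iff) auto
      ultimately show ?thesis by (simp add: d_def)
    qed
    have a1: "r * (- ln 8 - ln \<bar>y\<bar>) \<le> r * d (1/2)" and a2: "r * d (3/2+r) \<le> r * (ln (5/2) - ln \<bar>y\<bar>)"
      and a3: "r * ln (3/2 + r) \<le> r * ln (5/2)"
      using dl du r by (auto intro!: mult_left_mono)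
    have c1: "- ln 5 \<le> r * ln (1/2) - r * ln (5/2)"
    proof -
      have "r * ln (1/2) - r * ln (5/2) = - (r * ln (5::real))" by (simp add: ln_div algebra_simps)
      moreover have "r * ln 5 \<le> 1 * ln (5::real)" using r by (intro mult_right_mono) auto
      ultimately show ?thesis by simp
    qed
    have c2: "r * ln (5/2) + r * ln 8 \<le> ln 20"
    proof -
      have "ln (5/2) + ln 8 = ln ((5/2) * 8 :: real)" by (rule ln_mult_pos[symmetric]) auto
      hence "r * ln (5/2) + r * ln 8 = r * ln (20::real)"
        by (simp flip: distrib_left)
      moreover have "r * ln 20 \<le> 1 * ln (20::real)" using r by (intro mult_right_mono) auto
      ultimately show ?thesis by simp
    qed
    have lo: "?L x \<ge> ?L (3/2) + r * ln \<bar>y\<bar> - ln 5" and up: "?L x \<le> ?L (3/2) + r * ln \<bar>y\<bar> + ln 20"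
      using D G r a1 a2 a3 c1 c2 unfolding xr by (simp_all add: algebra_simps)
    have e3: "exp (?L (3/2) + r * ln \<bar>y\<bar>) = cmod (Gamma (Complex (3/2) y)) * \<bar>y\<bar> powr r"
      using Lpos[of "3/2"] y by (simp add: exp_add powr_def)
    have L: "cmod (Gamma (Complex x y)) = exp (?L x)" using Lpos[of x] x by simp
    have lo': "cmod (Gamma (Complex x y)) \<ge> cmod (Gamma (Complex (3/2) y)) * \<bar>y\<bar> powr r * exp (- ln 5)"
    proof -
      have "exp (?L (3/2) + r * ln \<bar>y\<bar> + - ln 5) \<le> exp (?L x)" using lo by (subst exp_le_cancel_iff) simp
      thus ?thesis by (simp only: exp_add[of _ "- ln 5"] e3 L[symmetric])
    qed
    have up': "cmod (Gamma (Complex x y)) \<le> cmod (Gamma (Complex (3/2) y)) * \<bar>y\<bar> powr r * 20"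
    proof -
      have "exp (?L x) \<le> exp (?L (3/2) + r * ln \<bar>y\<bar> + ln 20)"
        using up by (subst exp_le_cancel_iff)
      thus ?thesis by (simp only: exp_add[of _ "ln 20"] e3 L[symmetric]) simp
    qed
    have g32: "cmod (Gamma (Complex (3/2) y)) = cmod (Complex (1/2) y) * cmod (Gamma (Complex (1/2) y))"
      using Gamma_plus1_Complex[of "1/2" y] Complex_notin_nonpos_Ints[of "1/2" y] by (simp add: norm_mult)
    have E: "(exp (- pi * \<bar>y\<bar> / 2))\<^sup>2 = 1 / exp (pi * \<bar>y\<bar>)"
      by (simp add: power2_eq_square exp_minus inverse_eq_divide flip: exp_add)
    have half_lo: "exp (- pi * \<bar>y\<bar> / 2) \<le> cmod (Gamma (Complex (1/2) y))"
    proof (rule power2_le_imp_le)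
      have "1 / exp (pi * \<bar>y\<bar>) \<le> pi / cosh (pi * y)"
        using cosh_exp_bounds(2)[of "pi * y"] pi_gt3 by (intro frac_le) (auto simp: abs_mult cosh_real_pos)
      thus "(exp (- pi * \<bar>y\<bar> / 2))\<^sup>2 \<le> (cmod (Gamma (Complex (1/2) y)))\<^sup>2"
        unfolding E norm_Gamma_half .
    qed simp
    have half_up: "cmod (Gamma (Complex (1/2) y)) \<le> sqrt (2*pi) * exp (- pi * \<bar>y\<bar> / 2)"
    proof (rule power2_le_imp_le)
      have "pi / cosh (pi * y) \<le> pi / (exp (pi * \<bar>y\<bar>) / 2)"
        using cosh_exp_bounds(1)[of "pi * y"] by (intro frac_le) (auto simp: abs_mult)
      thus "(cmod (Gamma (Complex (1/2) y)))\<^sup>2 \<le> (sqrt (2*pi) * exp (- pi * \<bar>y\<bar> / 2))\<^sup>2"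
        unfolding norm_Gamma_half power_mult_distrib E by (simp add: field_simps)
    qed simp
    have pw: "Stirling_modulus x y = \<bar>y\<bar> * exp (- pi * \<bar>y\<bar> / 2) * \<bar>y\<bar> powr r"
      using y by (simp add: Stirling_modulus_def xr powr_add)
    have n12: "\<bar>y\<bar> \<le> cmod (Complex (1/2) y)" "cmod (Complex (1/2) y) \<le> (3/2) * \<bar>y\<bar>"
      using norm_Complex_bounds[of "1/2" "1/2" y] y by auto
    have "\<bar>y\<bar> * exp (- pi * \<bar>y\<bar> / 2) \<le> cmod (Gamma (Complex (3/2) y))"
      unfolding g32 by (intro mult_mono n12 half_lo) auto
    hence "\<bar>y\<bar> * exp (- pi * \<bar>y\<bar> / 2) * \<bar>y\<bar> powr r * exp (- ln 5) \<le> cmod (Gamma (Complex (3/2) y)) * \<bar>y\<bar> powr r * exp (- ln 5)"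
      by (intro mult_right_mono) auto
    moreover have "cmod (Gamma (Complex (3/2) y)) \<le> ((3/2) * \<bar>y\<bar>) * (sqrt (2*pi) * exp (- pi * \<bar>y\<bar> / 2))"
      unfolding g32 by (intro mult_mono n12 half_up) auto
    hence "cmod (Gamma (Complex (3/2) y)) * \<bar>y\<bar> powr r * 20 \<le> ((3/2) * \<bar>y\<bar>) * (sqrt (2*pi) * exp (- pi * \<bar>y\<bar> / 2)) * \<bar>y\<bar> powr r * 20"
      by (intro mult_right_mono) auto
    ultimately show ?thesis using lo' up' unfolding pw by (simp add: mult_ac)
  qed
  show ?thesis unfolding Stirling_comparable_def
    by (rule exI[of _ "exp (- ln 5)"], rule conjI, simp,
        rule exI[of _ "sqrt (2*pi) * (3/2) * 20"]) (use b in auto)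
qed

text \<open>
  The functional equation moves the estimate by one unit, because \<open>\<bar>x + \<i>y\<bar>\<close> is comparable to \<open>\<bar>y\<bar>\<close> for
  bounded \<open>x\<close>.
\<close>

lemma Stirling_comparable_extend:
  assumes S: "Stirling_comparable u v" and uv: "u + 1 \<le> v"
  shows "Stirling_comparable (u - 1) v" "Stirling_comparable u (v + 1)"
proof -
  obtain c C where c: "c > 0" "C > 0" and
    b: "\<And>x y. x \<in> {u..v} \<Longrightarrow> 1 \<le> \<bar>y\<bar> \<Longrightarrow> c * Stirling_modulus x y \<le> cmod (Gamma (Complex x y))"
       "\<And>x y. x \<in> {u..v} \<Longrightarrow> 1 \<le> \<bar>y\<bar> \<Longrightarrow> cmod (Gamma (Complex x y)) \<le> C * Stirling_modulus x y"
    using S unfolding Stirling_comparable_def by blast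
  define a where "a = \<bar>u\<bar> + \<bar>v\<bar> + 1"
  have a: "a + 1 \<ge> 1" by (simp add: a_def)
  have G: "cmod (Gamma (Complex (x + 1) y)) = cmod (Complex x y) * cmod (Gamma (Complex x y))"
    if "1 \<le> \<bar>y\<bar>" for x y
  proof -
    have "Complex x y \<notin> \<int>\<^sub>\<le>\<^sub>0" using that by (auto elim!: nonpos_Ints_cases simp: complex_eq_iff)
    thus ?thesis by (simp add: Gamma_plus1_Complex norm_mult)
  qed
  have up: "c * Stirling_modulus x y \<le> cmod (Gamma (Complex x y)) \<and>
        cmod (Gamma (Complex x y)) \<le> C * (a + 1) * Stirling_modulus x y"
    if x: "x \<in> {u+1..v+1}" and y: "1 \<le> \<bar>y\<bar>" for x y
  proof -
    have x1: "x - 1 \<in> {u..v}" using x by auto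
    have xa: "\<bar>x - 1\<bar> \<le> a" using x by (auto simp: a_def)
    note n = norm_Complex_bounds[OF xa y]
    have E: "cmod (Gamma (Complex x y)) = cmod (Complex (x-1) y) * cmod (Gamma (Complex (x-1) y))"
      using G[OF y, of "x-1"] by simp
    have M: "Stirling_modulus x y = \<bar>y\<bar> * Stirling_modulus (x-1) y"
      using Stirling_modulus_plus1[of y "x-1"] y by fastforce
    have p: "Stirling_modulus (x-1) y > 0" using y by (intro Stirling_modulus_pos) auto
    have "\<bar>y\<bar> * (c * Stirling_modulus (x-1) y) \<le> cmod (Gamma (Complex x y))"
      unfolding E using c p by (intro mult_mono n b x1 y) auto
    moreover have "cmod (Gamma (Complex x y)) \<le> ((a+1) * \<bar>y\<bar>) * (C * Stirling_modulus (x-1) y)"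
      unfolding E using c p a by (intro mult_mono n b x1 y) auto
    ultimately show ?thesis unfolding M by (simp add: mult_ac)
  qed
  have dn: "c / (a + 1) * Stirling_modulus x y \<le> cmod (Gamma (Complex x y)) \<and>
        cmod (Gamma (Complex x y)) \<le> C * Stirling_modulus x y"
    if x: "x \<in> {u-1..v-1}" and y: "1 \<le> \<bar>y\<bar>" for x y
  proof -
    have x1: "x + 1 \<in> {u..v}" using x by auto
    have xa: "\<bar>x\<bar> \<le> a" using x by (auto simp: a_def)
    note n = norm_Complex_bounds[OF xa y]
    have np: "cmod (Complex x y) > 0" using n y by linarith
    have E: "cmod (Gamma (Complex x y)) = cmod (Gamma (Complex (x+1) y)) / cmod (Complex x y)"
      using G[OF y, of x] np by simp
    have M: "Stirling_modulus x y = Stirling_modulus (x+1) y / \<bar>y\<bar>"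
      using Stirling_modulus_plus1[of y x] y by fastforce
    have p: "Stirling_modulus (x+1) y > 0" using y by (intro Stirling_modulus_pos) auto
    have "c * Stirling_modulus (x+1) y / ((a+1) * \<bar>y\<bar>) \<le> cmod (Gamma (Complex x y))"
      unfolding E using c p np by (intro frac_le n b x1 y) auto
    moreover have "cmod (Gamma (Complex x y)) \<le> C * Stirling_modulus (x+1) y / \<bar>y\<bar>"
      unfolding E using c p y by (intro frac_le n b x1 y) auto
    ultimately show ?thesis unfolding M by (simp add: mult_ac)
  qed
  have mid: "c / (a+1) * Stirling_modulus x y \<le> cmod (Gamma (Complex x y))"
    "cmod (Gamma (Complex x y)) \<le> C * (a+1) * Stirling_modulus x y"
    if x: "x \<in> {u..v}" and y: "1 \<le> \<bar>y\<bar>" for x y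
  proof -
    have p: "Stirling_modulus x y > 0" using y by (intro Stirling_modulus_pos) auto
    have "c / (a+1) \<le> c" "C \<le> C * (a+1)" using c a by (auto simp: field_simps)
    hence "c / (a+1) * Stirling_modulus x y \<le> c * Stirling_modulus x y"
      "C * Stirling_modulus x y \<le> C * (a+1) * Stirling_modulus x y"
      using p by (intro mult_right_mono; linarith)+
    thus "c / (a+1) * Stirling_modulus x y \<le> cmod (Gamma (Complex x y))"
     "cmod (Gamma (Complex x y)) \<le> C * (a+1) * Stirling_modulus x y" using b[OF x y] by linarith+
  qed
  have pos: "c / (a+1) > 0" "C * (a+1) > 0" using c a by auto
  show "Stirling_comparable (u - 1) v" unfolding Stirling_comparable_def
  proof (rule exI[of _ "c/(a+1)"], rule conjI[OF pos(1)], rule exI[of _ C], intro conjI c ballI allI impI)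
    fix x y :: real assume *: "x \<in> {u-1..v}" "1 \<le> \<bar>y\<bar>"
    consider "x \<in> {u..v}" | "x \<in> {u-1..v-1}" using * uv by fastforce
    thus "c/(a+1) * Stirling_modulus x y \<le> cmod (Gamma (Complex x y))"
      "cmod (Gamma (Complex x y)) \<le> C * Stirling_modulus x y"
      using mid b dn * by (cases; blast)+
  qed
  show "Stirling_comparable u (v + 1)" unfolding Stirling_comparable_def
  proof (rule exI[of _ c], rule conjI[OF c(1)], rule exI[of _ "C*(a+1)"], intro conjI pos ballI allI impI)
    fix x y :: real assume *: "x \<in> {u..v+1}" "1 \<le> \<bar>y\<bar>"
    consider "x \<in> {u..v}" | "x \<in> {u+1..v+1}" using * uv by fastforce
    thus "c * Stirling_modulus x y \<le> cmod (Gamma (Complex x y))"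
      "cmod (Gamma (Complex x y)) \<le> C*(a+1) * Stirling_modulus x y"
      using mid b up * by (cases; blast)+
  qed
qed

lemma Stirling_comparable: "Stirling_comparable u v"
proof -
  have 1: "Stirling_comparable (3/2) (5/2 + real n)" for n
  proof (induction n)
    case (Suc n)
    show ?case using Stirling_comparable_extend(2)[OF Suc.IH] by (simp add: algebra_simps)
  qed (simp add: Stirling_comparable_base)
  have 2: "Stirling_comparable (3/2 - real k) (5/2 + real n)" for k n
  proof (induction k)
    case (Suc k)
    show ?case using Stirling_comparable_extend(1)[OF Suc.IH] by (simp add: algebra_simps)
  qed (simp add: 1)
  obtain k where k: "real k \<ge> 3/2 - u" using real_arch_simple by blast
  obtain n where n: "real n \<ge> v - 5/2" using real_arch_simple by blast
  have "{u..v} \<subseteq> {3/2 - real k..5/2 + real n}" using k n by auto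
  thus ?thesis using 2[of k n] unfolding Stirling_comparable_def by (meson subset_iff)
qed

lemma Gamma_vertical_strip_bounds:
  obtains c C where "c > 0" "C > 0"
    "\<And>x y. x \<in> {u..v} \<Longrightarrow> 1 \<le> \<bar>y\<bar> \<Longrightarrow> c * Stirling_modulus x y \<le> cmod (Gamma (Complex x y))"
    "\<And>x y. x \<in> {u..v} \<Longrightarrow> 1 \<le> \<bar>y\<bar> \<Longrightarrow> cmod (Gamma (Complex x y)) \<le> C * Stirling_modulus x y"
  using Stirling_comparable[of u v] unfolding Stirling_comparable_def by blast

section \<open>Independence of Mellin-Barnes integrals of the contour\<close>

text \<open>
  Closes up a contour \<open>g\<close> from \<open>\<gamma> - \<i>T\<close> to \<open>\<gamma> + \<i>T\<close>: up the ray to height \<open>R\<close>, across to the line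
  \<open>Re s = c\<close>, down that line, and back to \<open>\<gamma> - \<i>T\<close>. Cauchy's theorem for the closed path compares the
  truncated contour with the line.
\<close>

definition return_path :: "real \<Rightarrow> real \<Rightarrow> real \<Rightarrow> real \<Rightarrow> real \<Rightarrow> complex" where
  "return_path \<gamma> T c R =
     linepath (Complex \<gamma> T) (Complex \<gamma> R) +++ linepath (Complex \<gamma> R) (Complex c R) +++
     linepath (Complex c R) (Complex c (-R)) +++ linepath (Complex c (-R)) (Complex \<gamma> (-R)) +++
     linepath (Complex \<gamma> (-R)) (Complex \<gamma> (-T))"

lemma return_path_simps [simp]:
  "valid_path (return_path \<gamma> T c R)"
  "pathstart (return_path \<gamma> T c R) = Complex \<gamma> T"
  "pathfinish (return_path \<gamma> T c R) = Complex \<gamma> (-T)"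
  by (auto simp: return_path_def)

lemma closed_segment_same_Re_subset:
  "closed_segment (Complex x u) (Complex x v) \<subseteq> {s. Re s = x \<and> Im s \<in> closed_segment u v}"
  by (subst closed_segment_same_Re) auto

lemma closed_segment_same_Im_subset:
  "closed_segment (Complex u y) (Complex v y) \<subseteq> {s. Im s = y \<and> Re s \<in> closed_segment u v}"
  by (subst closed_segment_same_Im) auto

lemma path_image_return_path:
  assumes "T \<le> R" "0 < T"
  shows "path_image (return_path \<gamma> T c R) \<subseteq>
           {s. Re s = \<gamma> \<and> T \<le> \<bar>Im s\<bar> \<and> \<bar>Im s\<bar> \<le> R \<or>
               \<bar>Im s\<bar> = \<bar>R\<bar> \<and> Re s \<in> closed_segment \<gamma> c \<or> Re s = c \<and> \<bar>Im s\<bar> \<le> \<bar>R\<bar>}"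
  (is "_ \<subseteq> ?S")
proof -
  have "closed_segment (Complex \<gamma> T) (Complex \<gamma> R) \<subseteq> ?S"
    by (rule order_trans[OF closed_segment_same_Re_subset])
       (use assms in \<open>auto simp: closed_segment_eq_real_ivl\<close>)
  moreover have "closed_segment (Complex \<gamma> R) (Complex c R) \<subseteq> ?S"
    by (rule order_trans[OF closed_segment_same_Im_subset]) auto
  moreover have "closed_segment (Complex c R) (Complex c (-R)) \<subseteq> ?S"
    by (rule order_trans[OF closed_segment_same_Re_subset])
       (auto simp: closed_segment_eq_real_ivl split: if_splits)
  moreover have "closed_segment (Complex c (-R)) (Complex \<gamma> (-R)) \<subseteq> ?S"
    by (rule order_trans[OF closed_segment_same_Im_subset]) (auto simp: closed_segment_commute)
  moreover have "closed_segment (Complex \<gamma> (-R)) (Complex \<gamma> (-T)) \<subseteq> ?S"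
    by (rule order_trans[OF closed_segment_same_Re_subset])
       (use assms in \<open>auto simp: closed_segment_eq_real_ivl\<close>)
  ultimately show ?thesis unfolding return_path_def
    by (simp only: path_image_join path_image_linepath pathstart_linepath pathfinish_linepath
        pathstart_join pathfinish_join Un_least)
qed

lemma has_contour_integral_inverse_right:
  assumes "valid_path q" "path_image q \<subseteq> - {s. s - p \<in> \<real>\<^sub>\<le>\<^sub>0}"
  shows "((\<lambda>w. 1 / (w - p)) has_contour_integral (Ln (pathfinish q - p) - Ln (pathstart q - p))) q"
proof (rule contour_integral_primitive[OF _ assms])
  fix w assume "w \<in> - {s. s - p \<in> \<real>\<^sub>\<le>\<^sub>0}"
  thus "((\<lambda>w. Ln (w - p)) has_field_derivative 1 / (w - p)) (at w within - {s. s - p \<in> \<real>\<^sub>\<le>\<^sub>0})"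
    by (auto intro!: derivative_eq_intros simp: field_simps)
qed

lemma has_contour_integral_inverse_left:
  assumes "valid_path q" "path_image q \<subseteq> - {s. p - s \<in> \<real>\<^sub>\<le>\<^sub>0}"
  shows "((\<lambda>w. 1 / (w - p)) has_contour_integral (Ln (p - pathfinish q) - Ln (p - pathstart q))) q"
proof (rule contour_integral_primitive[OF _ assms])
  fix w assume w: "w \<in> - {s. p - s \<in> \<real>\<^sub>\<le>\<^sub>0}"
  hence "p - w \<noteq> 0" by auto
  hence "- inverse (p - w) = 1 / (w - p)" by (simp add: divide_simps)
  moreover have "((\<lambda>w. Ln (p - w)) has_field_derivative - inverse (p - w)) (at w within - {s. p - s \<in> \<real>\<^sub>\<le>\<^sub>0})"
    using w by (auto intro!: derivative_eq_intros)
  ultimately show "((\<lambda>w. Ln (p - w)) has_field_derivative 1 / (w - p)) (at w within - {s. p - s \<in> \<real>\<^sub>\<le>\<^sub>0})"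
    by simp
qed

definition same_side :: "real \<Rightarrow> real \<Rightarrow> real \<Rightarrow> bool" where
  "same_side x c c' \<longleftrightarrow> x < c \<and> x < c' \<or> c < x \<and> c' < x"

text \<open>
  For a real point \<open>p\<close> on the left of both lines the whole return path avoids the half-line
  \<open>{s. s \<le> p}\<close>, where the principal logarithm of \<open>s - p\<close> is a primitive of \<open>1 / (s - p)\<close>. Hence its contribution to the
  winding number depends on the endpoints alone, not on \<open>c\<close> or \<open>R\<close>; for \<open>p\<close> on the right, \<open>p - s\<close> does the same.
\<close>

lemma winding_number_return_path_cong:
  assumes g: "valid_path g" "pathstart g = Complex \<gamma> (-T)" "pathfinish g = Complex \<gamma> T"
    and T: "0 < T" "T \<le> R" "T \<le> R'" and p: "Im p = 0" "p \<notin> path_image g"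
    and side: "same_side (Re p) c c'"
  shows "winding_number (g +++ return_path \<gamma> T c R) p = winding_number (g +++ return_path \<gamma> T c' R') p"
proof -
  let ?F = "\<lambda>w. 1 / (w - p)"
  have key: "p \<notin> path_image (return_path \<gamma> T c R) \<and> (?F has_contour_integral
      (if Re p < c then Ln (Complex \<gamma> (-T) - p) - Ln (Complex \<gamma> T - p)
       else Ln (p - Complex \<gamma> (-T)) - Ln (p - Complex \<gamma> T))) (return_path \<gamma> T c R)"
    if R: "T \<le> R" and c: "Re p \<noteq> c" for c R
  proof (cases "Re p < c")
    case True
    have im: "path_image (return_path \<gamma> T c R) \<subseteq> - {s. s - p \<in> \<real>\<^sub>\<le>\<^sub>0}"
      using path_image_return_path[OF R T(1), of \<gamma> c] T R True p
      by (fastforce simp: complex_nonpos_Reals_iff)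
    have "p \<in> {s. s - p \<in> \<real>\<^sub>\<le>\<^sub>0}" by simp
    with im show ?thesis
      using has_contour_integral_inverse_right[OF _ im] True by auto
  next
    case False
    hence c: "c < Re p" using c by simp
    have im: "path_image (return_path \<gamma> T c R) \<subseteq> - {s. p - s \<in> \<real>\<^sub>\<le>\<^sub>0}"
      using path_image_return_path[OF R T(1), of \<gamma> c] T R c p
      by (fastforce simp: complex_nonpos_Reals_iff)
    have "p \<in> {s. p - s \<in> \<real>\<^sub>\<le>\<^sub>0}" by simp
    with im show ?thesis
      using has_contour_integral_inverse_left[OF _ im] c by auto
  qed
  have w: "winding_number (g +++ return_path \<gamma> T c R) p = 1 / (2 * pi * \<i>) * (contour_integral g ?F +
      (if Re p < c then Ln (Complex \<gamma> (-T) - p) - Ln (Complex \<gamma> T - p)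
       else Ln (p - Complex \<gamma> (-T)) - Ln (p - Complex \<gamma> T)))"
    if R: "T \<le> R" and c: "Re p \<noteq> c" for c R
  proof -
    note k = key[OF R c]
    have "p \<notin> path_image (g +++ return_path \<gamma> T c R)" using k p g by (simp add: path_image_join)
    hence "winding_number (g +++ return_path \<gamma> T c R) p =
        1 / (2 * pi * \<i>) * contour_integral (g +++ return_path \<gamma> T c R) ?F"
      using g by (subst winding_number_valid_path) auto
    also have "contour_integral (g +++ return_path \<gamma> T c R) ?F =
        contour_integral g ?F + contour_integral (return_path \<gamma> T c R) ?F"
      using k g p by (intro contour_integral_join contour_integrable_inversediff) (auto simp: contour_integrable_on_def)
    finally show ?thesis using k contour_integral_unique by metis
  qed
  show ?thesis using w[OF T(2), of c] w[OF T(3), of c'] side by (auto simp: same_side_def)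
qed

lemma closed_MB_contour_image: "valid_path g \<Longrightarrow> closed (MB_contour_image \<gamma> T g)"
proof -
  assume g: "valid_path g"
  have "{s. Re s = \<gamma> \<and> T \<le> \<bar>Im s\<bar>} = {s. Re s = \<gamma>} \<inter> {s. T \<le> \<bar>Im s\<bar>}" by auto
  moreover have "closed \<dots>" 
    by (intro closed_Int closed_Collect_eq closed_Collect_le continuous_intros)
  ultimately show ?thesis unfolding MB_contour_image_def
    using g by (intro closed_Un closed_valid_path_image) auto
qed

text \<open>
  A path from \<open>p\<close> to \<open>x\<close> that avoids the contour is compact, so a sufficiently large loop avoids it as
  well; the winding number at \<open>p\<close> equals that at \<open>x\<close>, and \<open>x\<close> lies outside a half-plane that contains
  the loop. The line is placed at \<open>c = R\<close> or \<open>c = -R\<close>, on the side of the contour away from \<open>x\<close>.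
\<close>

lemma winding_number_return_path_eventually_0:
  assumes "MB_contour \<gamma> T g" and con: "connected_component (- MB_contour_image \<gamma> T g) p x"
  obtains B where "B \<ge> T" "\<And>R. R \<ge> B \<Longrightarrow> (\<forall>s\<in>MB_contour_image \<gamma> T g. Re x < Re s) \<Longrightarrow>
            winding_number (g +++ return_path \<gamma> T R R) p = 0"
     "\<And>R. R \<ge> B \<Longrightarrow> (\<forall>s\<in>MB_contour_image \<gamma> T g. Re s < Re x) \<Longrightarrow>
            winding_number (g +++ return_path \<gamma> T (-R) R) p = 0"
     "B > Re p" "-B < Re p"
proof -
  let ?C = "MB_contour_image \<gamma> T g"
  have g: "valid_path g" "pathstart g = Complex \<gamma> (-T)" "pathfinish g = Complex \<gamma> T" "T > 0"
    using assms by (auto simp: MB_contour_def)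
  have "open (- ?C)" using closed_MB_contour_image[OF g(1)] by (simp add: open_Compl)
  with con have "path_component (- ?C) p x" by (simp add: open_path_connected_component)
  then obtain q where q: "path q" "path_image q \<subseteq> - ?C" "pathstart q = p" "pathfinish q = x"
    unfolding path_component_def by blast
  have "bounded (path_image q)" using q by (simp add: bounded_path_image)
  then obtain B0 where B0: "\<And>s. s \<in> path_image q \<Longrightarrow> cmod s \<le> B0" unfolding bounded_iff by blast
  have pq: "p \<in> path_image q" "x \<in> path_image q" using q pathstart_in_path_image pathfinish_in_path_image by metis+
  define B where "B = max T (B0 + 1)"
  have gC: "path_image g \<subseteq> ?C" by (auto simp: MB_contour_image_def)
  have B: "\<bar>Re s\<bar> < B" "\<bar>Im s\<bar> < B" if "s \<in> path_image q" for s
    using B0[OF that] abs_Re_le_cmod[of s] abs_Im_le_cmod[of s] by (auto simp: B_def)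
  have W: "winding_number (g +++ return_path \<gamma> T c R) p = 0"
    if R: "R \<ge> B" "\<bar>c\<bar> = R" and S: "convex S" "x \<notin> S" "?C \<subseteq> S" "path_image (return_path \<gamma> T c R) \<subseteq> S" for R c S
  proof -
    have TR: "T \<le> R" using R by (simp add: B_def)
    have "path_image q \<inter> path_image (return_path \<gamma> T c R) = {}"
      using path_image_return_path[OF TR g(4), of \<gamma> c] q(2) R B g(4) unfolding MB_contour_image_def
      by fastforce
    hence "path_image q \<inter> path_image (g +++ return_path \<gamma> T c R) = {}"
      using q(2) gC g by (auto simp: path_image_join)
    hence "winding_number (g +++ return_path \<gamma> T c R) p = winding_number (g +++ return_path \<gamma> T c R) x"
      using g q pq by (intro winding_number_eq[where S = "path_image q"] connected_path_image)
         (auto intro: valid_path_imp_path)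
    also have "\<dots> = 0"
      using g S gC by (intro winding_number_zero_outside[where s = S]) (auto intro: valid_path_imp_path simp: path_image_join)
    finally show ?thesis .
  qed
  have Cg: "Complex \<gamma> T \<in> ?C" using g by (auto simp: MB_contour_image_def)
  show ?thesis
  proof (rule that)
    show "T \<le> B" by (simp add: B_def)
    show "Re p < B" "-B < Re p" using B[OF pq(1)] by auto
  next
    fix R assume R: "R \<ge> B" and x: "\<forall>s\<in>?C. Re x < Re s"
    hence TR: "T \<le> R" by (simp add: B_def)
    have x1: "Re x < \<gamma>" using x Cg by fastforce
    have x2: "Re x < R" using B[OF pq(2)] R by linarith
    have *: "Re x < a" if "a \<in> closed_segment \<gamma> R" for a
      using that x1 x2 by (auto simp: closed_segment_eq_real_ivl split: if_splits)
    show "winding_number (g +++ return_path \<gamma> T R R) p = 0"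
    proof (rule W[OF R, where S = "{s. Re x < Re s}"])
      show "\<bar>R\<bar> = R" using g TR by simp
      show "path_image (return_path \<gamma> T R R) \<subseteq> {s. Re x < Re s}"
        using path_image_return_path[OF TR g(4), of \<gamma> R] * x1 x2 by fastforce
    qed (use x in \<open>auto simp: convex_halfspace_Re_gt\<close>)
  next
    fix R assume R: "R \<ge> B" and x: "\<forall>s\<in>?C. Re s < Re x"
    hence TR: "T \<le> R" by (simp add: B_def)
    have x1: "Re x > \<gamma>" using x Cg by fastforce
    have x2: "Re x > -R" using B[OF pq(2)] R by linarith
    have *: "Re x > a" if "a \<in> closed_segment \<gamma> (-R)" for a
      using that x1 x2 by (auto simp: closed_segment_eq_real_ivl split: if_splits)
    show "winding_number (g +++ return_path \<gamma> T (-R) R) p = 0"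
    proof (rule W[OF R, where S = "{s. Re x > Re s}"])
      show "\<bar>-R\<bar> = R" using g TR by simp
      show "path_image (return_path \<gamma> T (-R) R) \<subseteq> {s. Re x > Re s}"
        using path_image_return_path[OF TR g(4), of \<gamma> "-R"] * x1 x2 by fastforce
    qed (use x in \<open>auto simp: convex_halfspace_Re_lt\<close>)
  qed
qed

text \<open>
  The bound beyond which the previous lemma applies depends on the pole, and there may be infinitely many
  poles. Since the winding number does not change when the loop is enlarged on the same side
  of the pole, it vanishes for every \<open>R \<ge> T\<close>, simultaneously for all poles.
\<close>

lemma separating_winding_number_0:
  assumes sep: "separating_MB_contour P Q \<gamma> T g"
    and P: "\<And>p. p \<in> P \<Longrightarrow> Im p = 0 \<and> Re p < c" and Q: "\<And>p. p \<in> Q \<Longrightarrow> Im p = 0 \<and> Re p > c"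
    and R: "T \<le> R" and p: "p \<in> P \<union> Q"
  shows "winding_number (g +++ return_path \<gamma> T c R) p = 0"
proof -
  let ?C = "MB_contour_image \<gamma> T g"
  have MB: "MB_contour \<gamma> T g" and g: "valid_path g" "pathstart g = Complex \<gamma> (-T)" "pathfinish g = Complex \<gamma> T" "T > 0"
    using sep by (auto simp: MB_contour_def separating_MB_contour_def)
  have gC: "path_image g \<subseteq> ?C" by (auto simp: MB_contour_image_def)
  show ?thesis
  proof (cases "p \<in> P")
    case True
    with sep obtain x where x: "\<forall>s\<in>?C. Re x < Re s" "connected_component (- ?C) p x"
      by (auto simp: separating_MB_contour_def left_of_contour_def)
    obtain B where B: "B \<ge> T" "winding_number (g +++ return_path \<gamma> T B B) p = 0" "B > Re p"
      using winding_number_return_path_eventually_0[OF MB x(2)] x(1) by (metis order_refl)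
    have pC: "p \<notin> path_image g" using connected_component_in[OF x(2)] gC by auto
    show ?thesis
      using winding_number_return_path_cong[OF g R B(1) _ pC, of c B] B P[OF True]
      by (simp add: same_side_def)
  next
    case False
    with p have "p \<in> Q" by simp
    with sep obtain x where x: "\<forall>s\<in>?C. Re s < Re x" "connected_component (- ?C) p x"
      by (auto simp: separating_MB_contour_def right_of_contour_def)
    obtain B where B: "B \<ge> T" "winding_number (g +++ return_path \<gamma> T (-B) B) p = 0" "-B < Re p"
      using winding_number_return_path_eventually_0[OF MB x(2)] x(1) by (metis order_refl)
    have pC: "p \<notin> path_image g" using connected_component_in[OF x(2)] gC by auto
    show ?thesis
      using winding_number_return_path_cong[OF g R B(1) _ pC, of c "-B"] B Q[OF \<open>p \<in> Q\<close>]
      by (simp add: same_side_def)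
  qed
qed

lemma separating_avoids_poles:
  assumes "separating_MB_contour P Q \<gamma> T g"
  shows "MB_contour_image \<gamma> T g \<inter> (P \<union> Q) = {}"
  using assms connected_component_in
  unfolding separating_MB_contour_def left_of_contour_def right_of_contour_def by fastforce

definition vanishes_on_strips :: "(complex \<Rightarrow> complex) \<Rightarrow> bool" where
  "vanishes_on_strips f \<longleftrightarrow> (\<forall>u v. \<forall>e>0. \<forall>\<^sub>F R in at_top. \<forall>x\<in>{u..v}.
      cmod (f (Complex x R)) \<le> e \<and> cmod (f (Complex x (-R))) \<le> e)"

lemma contour_integral_horizontal_tendsto_0:
  assumes f: "vanishes_on_strips f"
    and cont: "\<And>R. R > 0 \<Longrightarrow> continuous_on {s. Im s = R} f \<and> continuous_on {s. Im s = -R} f"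
  shows "((\<lambda>R. contour_integral (linepath (Complex u R) (Complex v R)) f) \<longlongrightarrow> 0) at_top"
    "((\<lambda>R. contour_integral (linepath (Complex u (-R)) (Complex v (-R))) f) \<longlongrightarrow> 0) at_top"
proof -
  have ev: "\<forall>\<^sub>F R in at_top. cmod (contour_integral (linepath (Complex u R) (Complex v R)) f) \<le> e \<and>
         cmod (contour_integral (linepath (Complex u (-R)) (Complex v (-R))) f) \<le> e" if e: "e > 0" for e
  proof -
    \<comment> \<open>The summand \<open>1\<close> only avoids division by zero for \<open>u = v\<close>.\<close>
    define d where "d = e / (\<bar>v - u\<bar> + 1)"
    have d: "d > 0" using e by (simp add: d_def add_nonneg_pos)
    have "\<forall>\<^sub>F R in at_top. \<forall>x\<in>{min u v..max u v}. cmod (f (Complex x R)) \<le> d \<and> cmod (f (Complex x (-R))) \<le> d"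
      using f d unfolding vanishes_on_strips_def by blast
    thus ?thesis using eventually_gt_at_top[of 0]
    proof eventually_elim
      case (elim R)
      have le: "cmod (contour_integral (linepath (Complex u y) (Complex v y)) f) \<le> e"
        if y: "y = R \<or> y = -R" for y
      proof -
        have "norm (contour_integral (linepath (Complex u y) (Complex v y)) f) \<le> d * norm (Complex v y - Complex u y)"
        proof (rule contour_integral_bound_linepath)
          have "continuous_on {s. Im s = y} f" using cont[of R] elim y by auto
          thus "f contour_integrable_on linepath (Complex u y) (Complex v y)"
            using closed_segment_same_Im_subset[of u y v]
            by (intro contour_integrable_continuous_linepath) (auto elim!: continuous_on_subset)
        next
          fix s assume "s \<in> closed_segment (Complex u y) (Complex v y)"
          hence s: "Im s = y" "Re s \<in> {min u v..max u v}" using closed_segment_same_Im_subset[of u y v]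
            by (auto simp: closed_segment_eq_real_ivl split: if_splits)
          hence "s = Complex (Re s) y" by (simp add: complex_eq_iff)
          thus "cmod (f s) \<le> d" using elim(1) s(2) y by metis
        qed (use d in simp)
        also have "Complex v y - Complex u y = of_real (v - u)" by (simp add: complex_eq_iff)
        also have "d * norm (of_real (v - u) :: complex) \<le> d * (\<bar>v - u\<bar> + 1)" 
          using d by (intro mult_left_mono) (unfold norm_of_real, auto)
        also have "\<dots> = e" by (simp add: d_def add_nonneg_pos)
        finally show ?thesis .
      qed
      show ?case using le by blast
    qed
  qed
  have "\<forall>\<^sub>F R in at_top. cmod (contour_integral (linepath (Complex u R) (Complex v R)) f) < e \<and>
         cmod (contour_integral (linepath (Complex u (-R)) (Complex v (-R))) f) < e" if e: "e > 0" for e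
    using ev[of "e/2"] e by (auto elim!: eventually_mono)
  thus "((\<lambda>R. contour_integral (linepath (Complex u R) (Complex v R)) f) \<longlongrightarrow> 0) at_top"
    "((\<lambda>R. contour_integral (linepath (Complex u (-R)) (Complex v (-R))) f) \<longlongrightarrow> 0) at_top"
    unfolding tendsto_iff by (auto simp: eventually_conj_iff)
qed

text \<open>
  The gauge integral over an unbounded set is by definition a limit over growing boxes. Symmetric
  intervals are such boxes, so this covers rays on which the integral converges only conditionally.
\<close>

lemma has_integral_symmetric_limit:
  fixes f :: "real \<Rightarrow> 'a::banach"
  assumes "(f has_integral I) S"
  shows "((\<lambda>R. integral (S \<inter> {-R..R}) f) \<longlongrightarrow> I) at_top"
  unfolding tendsto_iff
proof (intro allI impI)
  fix e :: real assume "e > 0"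
  with assms obtain B where B: "B > 0"
    "\<And>a b. ball 0 B \<subseteq> cbox a b \<Longrightarrow> norm (integral (cbox a b) (\<lambda>x. if x \<in> S then f x else 0) - I) < e"
    unfolding has_integral_alt'[of f] by blast
  show "\<forall>\<^sub>F R in at_top. dist (integral (S \<inter> {-R..R}) f) I < e"
    using eventually_ge_at_top[of B]
  proof eventually_elim
    case (elim R)
    have "ball 0 B \<subseteq> cbox (-R) R" using elim by (auto simp: dist_real_def)
    from B(2)[OF this] show ?case by (simp add: integral_restrict_Int dist_norm)
  qed
qed

text \<open>
  Independence of the contour. By Cauchy's theorem the integral over the closed path vanishes; as the height
  tends to infinity the horizontal segments disappear and the rays are exhausted.
\<close>

theorem MB_integral_vertical_line:
  assumes sep: "separating_MB_contour P Q \<gamma> T g"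
    and int: "has_MB_integral f I \<gamma> T g"
    and P: "\<And>p. p \<in> P \<Longrightarrow> Im p = 0 \<and> Re p < c" and Q: "\<And>p. p \<in> Q \<Longrightarrow> Im p = 0 \<and> Re p > c"
    and cl: "closed P" "closed Q"
    and hol: "f holomorphic_on - (P \<union> Q)" and van: "vanishes_on_strips f"
  shows "((\<lambda>R. \<i> * integral {-R..R} (\<lambda>t. f (Complex c t))) \<longlongrightarrow> I) at_top"
proof -
  have g: "valid_path g" "pathstart g = Complex \<gamma> (-T)" "pathfinish g = Complex \<gamma> T" "T > 0"
    using sep by (auto simp: MB_contour_def separating_MB_contour_def)
  obtain I1 I2 I3 where I: "((\<lambda>t. f (Complex \<gamma> t)) has_integral I1) {..- T}"
      "(f has_contour_integral I2) g" "((\<lambda>t. f (Complex \<gamma> t)) has_integral I3) {T..}"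
      "I = \<i> * I1 + I2 + \<i> * I3"
    using int unfolding has_MB_integral_def by blast
  have cont: "continuous_on (- (P \<union> Q)) f" using hol by (rule holomorphic_on_imp_continuous_on)
  have off: "s \<notin> P \<union> Q" if "Im s \<noteq> 0 \<or> Re s = c" for s using P Q that by force
  let ?h1 = "\<lambda>R. contour_integral (linepath (Complex \<gamma> R) (Complex c R)) f"
  let ?h2 = "\<lambda>R. contour_integral (linepath (Complex c (-R)) (Complex \<gamma> (-R))) f"
  have hcont: "continuous_on {s. Im s = R} f \<and> continuous_on {s. Im s = -R} f" if "R > 0" for R
  proof -
    have "{s. Im s = R} \<subseteq> - (P \<union> Q)" "{s. Im s = -R} \<subseteq> - (P \<union> Q)"
      using that by (auto dest: P Q)
    thus ?thesis using continuous_on_subset[OF cont] by blast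
  qed
  have h: "(?h1 \<longlongrightarrow> 0) at_top" "(?h2 \<longlongrightarrow> 0) at_top"
    using contour_integral_horizontal_tendsto_0[OF van hcont] by auto
  have i: "((\<lambda>R. integral ({..-T} \<inter> {-R..R}) (\<lambda>t. f (Complex \<gamma> t))) \<longlongrightarrow> I1) at_top"
     "((\<lambda>R. integral ({T..} \<inter> {-R..R}) (\<lambda>t. f (Complex \<gamma> t))) \<longlongrightarrow> I3) at_top"
    by (intro has_integral_symmetric_limit I)+
  have "((\<lambda>R. \<i> * integral ({..-T} \<inter> {-R..R}) (\<lambda>t. f (Complex \<gamma> t)) + I2 +
         \<i> * integral ({T..} \<inter> {-R..R}) (\<lambda>t. f (Complex \<gamma> t)) + ?h1 R + ?h2 R) \<longlongrightarrow>
         \<i> * I1 + I2 + \<i> * I3 + 0 + 0) at_top"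
    by (intro tendsto_intros h i)
  hence "((\<lambda>R. \<i> * integral ({..-T} \<inter> {-R..R}) (\<lambda>t. f (Complex \<gamma> t)) + I2 +
         \<i> * integral ({T..} \<inter> {-R..R}) (\<lambda>t. f (Complex \<gamma> t)) + ?h1 R + ?h2 R) \<longlongrightarrow> I) at_top"
    using I(4) by simp
  moreover have "\<forall>\<^sub>F R in at_top. \<i> * integral ({..-T} \<inter> {-R..R}) (\<lambda>t. f (Complex \<gamma> t)) + I2 +
         \<i> * integral ({T..} \<inter> {-R..R}) (\<lambda>t. f (Complex \<gamma> t)) + ?h1 R + ?h2 R =
         \<i> * integral {-R..R} (\<lambda>t. f (Complex c t))"
    using eventually_gt_at_top[of T]
  proof eventually_elim
    case (elim R)
    have TR: "T \<le> R" and Rp: "R > 0" using elim g(4) by auto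
    have im: "path_image (g +++ return_path \<gamma> T c R) \<subseteq> - (P \<union> Q)"
    proof -
      have "path_image g \<subseteq> - (P \<union> Q)"
        using separating_avoids_poles[OF sep] by (auto simp: MB_contour_image_def)
      moreover have "path_image (return_path \<gamma> T c R) \<subseteq> - (P \<union> Q)"
      proof
        fix s assume "s \<in> path_image (return_path \<gamma> T c R)"
        hence "Im s \<noteq> 0 \<or> Re s = c"
          using path_image_return_path[OF TR g(4), of \<gamma> c] Rp g(4) by auto
        thus "s \<in> - (P \<union> Q)" using off by blast
      qed
      ultimately show ?thesis using g by (auto simp: path_image_join)
    qed
    have "(f has_contour_integral 0) (g +++ return_path \<gamma> T c R)"
    proof (rule Cauchy_theorem_global[OF _ hol])
      show "open (- (P \<union> Q))" using cl by auto
      show "winding_number (g +++ return_path \<gamma> T c R) w = 0" if "w \<notin> - (P \<union> Q)" for w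
        using separating_winding_number_0[OF sep P Q TR, of w] that by auto
    qed (use g im in auto)
    moreover have seg: "f contour_integrable_on linepath a b" if "closed_segment a b \<subseteq> - (P \<union> Q)" for a b
      using that by (intro contour_integrable_continuous_linepath continuous_on_subset[OF cont])
    have S: "closed_segment (Complex \<gamma> T) (Complex \<gamma> R) \<subseteq> - (P \<union> Q)"
      "closed_segment (Complex \<gamma> R) (Complex c R) \<subseteq> - (P \<union> Q)"
      "closed_segment (Complex c R) (Complex c (-R)) \<subseteq> - (P \<union> Q)"
      "closed_segment (Complex c (-R)) (Complex \<gamma> (-R)) \<subseteq> - (P \<union> Q)"
      "closed_segment (Complex \<gamma> (-R)) (Complex \<gamma> (-T)) \<subseteq> - (P \<union> Q)"
      using im g unfolding return_path_def by (auto simp: path_image_join)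
    have "(f has_contour_integral (I2 + (contour_integral (linepath (Complex \<gamma> T) (Complex \<gamma> R)) f +
       (?h1 R + (contour_integral (linepath (Complex c R) (Complex c (-R))) f +
       (?h2 R + contour_integral (linepath (Complex \<gamma> (-R)) (Complex \<gamma> (-T))) f)))))) (g +++ return_path \<gamma> T c R)"
      unfolding return_path_def using g
      by (intro has_contour_integral_join has_contour_integral_integral seg S I) auto
    ultimately have "I2 + (contour_integral (linepath (Complex \<gamma> T) (Complex \<gamma> R)) f +
       (?h1 R + (contour_integral (linepath (Complex c R) (Complex c (-R))) f +
       (?h2 R + contour_integral (linepath (Complex \<gamma> (-R)) (Complex \<gamma> (-T))) f)))) = 0"
      using has_contour_integral_unique by blast
    moreover have "contour_integral (linepath (Complex \<gamma> T) (Complex \<gamma> R)) f = \<i> * integral {T..R} (\<lambda>t. f (Complex \<gamma> t))"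
      by (rule contour_integral_linepath_same_Re) (use elim in auto)
    moreover have "contour_integral (linepath (Complex \<gamma> (-R)) (Complex \<gamma> (-T))) f = \<i> * integral {-R..-T} (\<lambda>t. f (Complex \<gamma> t))"
      by (rule contour_integral_linepath_same_Re) (use elim in auto)
    moreover have "contour_integral (linepath (Complex c R) (Complex c (-R))) f = - (\<i> * integral {-R..R} (\<lambda>t. f (Complex c t)))"
      using contour_integral_linepath_same_Re[of "Complex c (-R)" c "Complex c R" "-R" R f] Rp
        contour_integral_reverse_linepath[OF continuous_on_subset[OF cont S(3)]] by simp
    moreover have "min (-T) R = -T" "max T (-R) = T" using TR g(4) by auto
    ultimately show ?case by (simp add: algebra_simps)
  qed
  ultimately show ?thesis by (rule Lim_transform_eventually)
qed

lemma separating_vertical_line: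
  assumes P: "\<And>p. p \<in> P \<Longrightarrow> Re p < c" and Q: "\<And>p. p \<in> Q \<Longrightarrow> Re p > c"
  shows "separating_MB_contour P Q c 1 (linepath (Complex c (-1)) (Complex c 1))"
proof -
  let ?C = "MB_contour_image c 1 (linepath (Complex c (-1)) (Complex c 1))"
  have C: "?C \<subseteq> {s. Re s = c}"
    using closed_segment_same_Re_subset[of c "-1" 1] by (auto simp: MB_contour_image_def)
  have "p \<in> left_of_contour ?C" if "p \<in> P" for p
    unfolding left_of_contour_def using P[OF that] C
    by (auto intro!: exI[of _ p] simp: connected_component_refl_eq subset_iff) fastforce?
  moreover have "p \<in> right_of_contour ?C" if "p \<in> Q" for p
    unfolding right_of_contour_def using Q[OF that] C
    by (auto intro!: exI[of _ p] simp: connected_component_refl_eq subset_iff) fastforce?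
  ultimately show ?thesis by (auto simp: separating_MB_contour_def MB_contour_def)
qed

theorem MB_integral_eq_vertical_line:
  assumes P: "\<And>p. p \<in> P \<Longrightarrow> Im p = 0 \<and> Re p < c" and Q: "\<And>p. p \<in> Q \<Longrightarrow> Im p = 0 \<and> Re p > c"
    and cl: "closed P" "closed Q"
    and hol: "f holomorphic_on - (P \<union> Q)" and van: "vanishes_on_strips f"
    and int: "integrable lborel (\<lambda>t. f (Complex c t))"
  shows "(\<exists>\<gamma> T g I. separating_MB_contour P Q \<gamma> T g \<and> has_MB_integral f I \<gamma> T g \<and> v = I / (2 * of_real pi * \<i>))
          \<longleftrightarrow> v = (LBINT t. f (Complex c t)) / (2 * of_real pi)" (is "?L v \<longleftrightarrow> ?R v")
proof -
  let ?F = "\<lambda>t. f (Complex c t)"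
  have lim: "((\<lambda>R. \<i> * integral {-R..R} ?F) \<longlongrightarrow> \<i> * (LBINT t. ?F t)) at_top"
    using has_integral_symmetric_limit[OF has_integral_integral_lborel[OF int]]
    by (intro tendsto_intros) simp
  have 1: "?R v" if ex: "?L v" for v
  proof -
    obtain \<gamma> T g I where *: "separating_MB_contour P Q \<gamma> T g" "has_MB_integral f I \<gamma> T g" "v = I / (2 * of_real pi * \<i>)"
      using ex by blast
    have "I = \<i> * (LBINT t. ?F t)"
      using MB_integral_vertical_line[OF *(1,2) P Q cl hol van] lim
      by (rule tendsto_unique[OF trivial_limit_at_top_linorder])
    thus ?thesis using * by simp
  qed
  have "\<exists>v. ?L v"
  proof -
    \<comment> \<open>Existence of one value suffices, since every value has been shown to be the line integral.\<close>
    have F: "?F integrable_on S" if "S \<in> sets borel" for S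
    proof -
      have "set_integrable lborel S ?F" unfolding set_integrable_def
        using int that by (intro integrable_mult_indicator) auto
      thus ?thesis by (rule set_borel_integral_eq_integral)
    qed
    have "f contour_integrable_on linepath (Complex c (-1)) (Complex c 1)"
      using closed_segment_same_Re_subset[of c "-1" 1] P Q
      by (intro contour_integrable_continuous_linepath continuous_on_subset[OF holomorphic_on_imp_continuous_on[OF hol]]) force
    then obtain I2 where "(f has_contour_integral I2) (linepath (Complex c (-1)) (Complex c 1))"
      by (auto simp: contour_integrable_on_def)
    moreover obtain I1 where "(?F has_integral I1) {..-1}" using F[of "{..-1}"] by (auto simp: integrable_on_def)
    moreover obtain I3 where "(?F has_integral I3) {1..}" using F[of "{1..}"] by (auto simp: integrable_on_def)
    ultimately have "has_MB_integral f (\<i> * I1 + I2 + \<i> * I3) c 1 (linepath (Complex c (-1)) (Complex c 1))"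
      unfolding has_MB_integral_def by blast
    moreover have "separating_MB_contour P Q c 1 (linepath (Complex c (-1)) (Complex c 1))"
      using P Q by (intro separating_vertical_line) auto
    ultimately show ?thesis by blast
  qed
  thus ?thesis using 1 by metis
qed

section \<open>Fox H-functions as integrals along vertical lines\<close>

text \<open>
  One notion of decay serves three purposes: for \<open>\<kappa> > 0\<close> the integrals over horizontal segments tend to
  zero, for \<open>\<kappa> > 1\<close> the function is integrable on vertical lines, and multiplication by
  \<open>exp(- s ln x)\<close>, which is bounded on vertical strips, preserves it.
\<close>

definition strip_decay :: "real \<Rightarrow> (complex \<Rightarrow> complex) \<Rightarrow> bool" where
  "strip_decay \<kappa> f \<longleftrightarrow> (\<forall>u v. \<exists>C T. 0 < C \<and> 0 < T \<and>
     (\<forall>x\<in>{u..v}. \<forall>t. T \<le> \<bar>t\<bar> \<longrightarrow> cmod (f (Complex x t)) \<le> C * \<bar>t\<bar> powr (-\<kappa>)))"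

lemma strip_decayE:
  assumes "strip_decay \<kappa> f"
  obtains C T where "0 < C" "0 < T" "\<And>x t. x \<in> {u..v} \<Longrightarrow> T \<le> \<bar>t\<bar> \<Longrightarrow> cmod (f (Complex x t)) \<le> C * \<bar>t\<bar> powr (-\<kappa>)"
  using assms unfolding strip_decay_def by meson

lemma strip_decay_mult_bounded:
  assumes f: "strip_decay \<kappa> f"
    and g: "\<And>u v. \<exists>D>0. \<exists>T>0. \<forall>x\<in>{u..v}. \<forall>t. T \<le> \<bar>t\<bar> \<longrightarrow> cmod (g (Complex x t)) \<le> D"
  shows "strip_decay \<kappa> (\<lambda>s. g s * f s)"
  unfolding strip_decay_def
proof (intro allI)
  fix u v
  obtain C T where C: "0 < C" "0 < T" "\<And>x t. x \<in> {u..v} \<Longrightarrow> T \<le> \<bar>t\<bar> \<Longrightarrow> cmod (f (Complex x t)) \<le> C * \<bar>t\<bar> powr (-\<kappa>)"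
    using strip_decayE[OF f] by metis
  obtain D T' where D: "0 < D" "0 < T'" "\<And>x t. x \<in> {u..v} \<Longrightarrow> T' \<le> \<bar>t\<bar> \<Longrightarrow> cmod (g (Complex x t)) \<le> D"
    using g by meson
  have "cmod (g (Complex x t) * f (Complex x t)) \<le> (D * C) * \<bar>t\<bar> powr (-\<kappa>)"
    if "x \<in> {u..v}" "max T T' \<le> \<bar>t\<bar>" for x t
  proof -
    have "cmod (g (Complex x t)) * cmod (f (Complex x t)) \<le> D * (C * \<bar>t\<bar> powr (-\<kappa>))"
      using that C(1) D(1) by (intro mult_mono C D) auto
    thus ?thesis by (simp add: norm_mult mult_ac)
  qed
  thus "\<exists>C T. 0 < C \<and> 0 < T \<and> (\<forall>x\<in>{u..v}. \<forall>t. T \<le> \<bar>t\<bar> \<longrightarrow> cmod (g (Complex x t) * f (Complex x t)) \<le> C * \<bar>t\<bar> powr (-\<kappa>))"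
    using C D by (intro exI[of _ "D * C"] exI[of _ "max T T'"]) auto
qed

lemma strip_decay_mult_exp:
  assumes "strip_decay \<kappa> f"
  shows "strip_decay \<kappa> (\<lambda>s. f s * exp (- s * of_real w))"
proof -
  have "strip_decay \<kappa> (\<lambda>s. exp (- s * of_real w) * f s)"
  proof (rule strip_decay_mult_bounded[OF assms])
    fix u v :: real
    have "cmod (exp (- Complex x t * of_real w)) \<le> exp ((\<bar>u\<bar> + \<bar>v\<bar>) * \<bar>w\<bar>)" if "x \<in> {u..v}" for x t
    proof -
      have "- x * w \<le> \<bar>x\<bar> * \<bar>w\<bar>" using abs_ge_minus_self[of "x * w"] by (simp add: abs_mult)
      also have "\<dots> \<le> (\<bar>u\<bar> + \<bar>v\<bar>) * \<bar>w\<bar>" using that by (intro mult_right_mono) auto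
      finally show ?thesis by simp
    qed
    thus "\<exists>D>0. \<exists>T>0. \<forall>x\<in>{u..v}. \<forall>t. T \<le> \<bar>t\<bar> \<longrightarrow> cmod (exp (- Complex x t * of_real w)) \<le> D"
      by (intro exI[of _ "exp ((\<bar>u\<bar> + \<bar>v\<bar>) * \<bar>w\<bar>)"] conjI exI[of _ 1]) auto
  qed
  thus ?thesis by (simp add: mult.commute)
qed

lemma strip_decay_vanishes:
  assumes "strip_decay \<kappa> f" "\<kappa> > 0"
  shows "vanishes_on_strips f"
  unfolding vanishes_on_strips_def
proof (intro allI impI)
  fix u v e :: real assume e: "e > 0"
  obtain C T where C: "0 < C" "0 < T" "\<And>x t. x \<in> {u..v} \<Longrightarrow> T \<le> \<bar>t\<bar> \<Longrightarrow> cmod (f (Complex x t)) \<le> C * \<bar>t\<bar> powr (-\<kappa>)"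
    using strip_decayE[OF assms(1)] by metis
  have "((\<lambda>R. C * R powr (-\<kappa>)) \<longlongrightarrow> C * 0) at_top"
    using \<open>\<kappa> > 0\<close> by (intro tendsto_mult tendsto_const tendsto_neg_powr filterlim_ident) auto
  hence "\<forall>\<^sub>F R in at_top. C * R powr (-\<kappa>) < e" using e by (intro order_tendstoD(2)) auto
  thus "\<forall>\<^sub>F R in at_top. \<forall>x\<in>{u..v}. cmod (f (Complex x R)) \<le> e \<and> cmod (f (Complex x (-R))) \<le> e"
    using eventually_ge_at_top[of T]
  proof eventually_elim
    case (elim R)
    have "cmod (f (Complex x t)) \<le> e" if "x \<in> {u..v}" "\<bar>t\<bar> = R" for x t
      using C(3)[of x t] that elim by auto
    thus ?case using C(2) elim by auto
  qed
qed

lemma set_integrable_lborel_nonneg: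
  fixes g :: "real \<Rightarrow> real"
  assumes "g integrable_on S" "\<And>x. x \<in> S \<Longrightarrow> 0 \<le> g x" "(\<lambda>x. indicator S x *\<^sub>R g x) \<in> borel_measurable borel"
  shows "set_integrable lborel S g"
proof -
  have "integrable lebesgue (\<lambda>x. indicator S x *\<^sub>R g x)"
    using nonnegative_absolutely_integrable_1[OF assms(1,2)] by (simp add: set_integrable_def)
  thus ?thesis unfolding set_integrable_def using assms(3) by (subst (asm) integrable_completion) auto
qed

lemma set_integrable_powr_at_top:
  fixes a e :: real
  assumes "a > 0" "e < -1"
  shows "set_integrable lborel {a..} (\<lambda>t. t powr e)"
proof (rule set_integrable_lborel_nonneg)
  show "(\<lambda>t. t powr e) integrable_on {a..}"
    using has_integral_powr_to_inf[OF assms(2,1)] by (auto simp: integrable_on_def)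
qed auto

lemma integrable_lborel_powr_decay:
  fixes F :: "real \<Rightarrow> complex"
  assumes cont: "continuous_on UNIV F" and "\<kappa> > 1" "T > 0"
    and bound: "\<And>t. T \<le> \<bar>t\<bar> \<Longrightarrow> cmod (F t) \<le> C * \<bar>t\<bar> powr (-\<kappa>)"
  shows "integrable lborel F"
proof -
  have meas: "F \<in> borel_measurable borel" using cont by (rule borel_measurable_continuous_onI)
  let ?b = "\<lambda>t. C * (indicator {T..} t *\<^sub>R t powr (-\<kappa>))"
  have b: "integrable lborel ?b"
    using set_integrable_powr_at_top[of T "-\<kappa>"] assms by (simp add: set_integrable_def)
  have 1: "set_integrable lborel {T..} F" unfolding set_integrable_def
  proof (rule Bochner_Integration.integrable_bound[OF b _ AE_I2])
    fix t show "norm (indicat_real {T..} t *\<^sub>R F t) \<le> norm (?b t)"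
      using bound[of t] \<open>T > 0\<close> by (auto simp: indicator_def intro!: order_trans[OF _ abs_ge_self])
  qed (use meas in auto)
  have "integrable lborel (\<lambda>t. ?b (0 + (-1) * t))"
    using b by (subst lborel_integrable_real_affine_iff) auto
  hence b': "integrable lborel (\<lambda>t. ?b (-t))" by simp
  have 2: "set_integrable lborel {..-T} F" unfolding set_integrable_def
  proof (rule Bochner_Integration.integrable_bound[OF b' _ AE_I2])
    fix t show "norm (indicat_real {..-T} t *\<^sub>R F t) \<le> norm (?b (-t))"
      using bound[of t] \<open>T > 0\<close> by (auto simp: indicator_def intro!: order_trans[OF _ abs_ge_self])
  qed (use meas in auto)
  have 3: "set_integrable lborel {-T..T} F"
    by (rule borel_integrable_atLeastAtMost') (rule continuous_on_subset[OF cont], simp)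
  have "set_integrable lborel ({..-T} \<union> {-T..T} \<union> {T..}) F"
    by (intro set_integrable_Un 1 2 3) auto
  moreover have "{..-T} \<union> {-T..T} \<union> {T..} = UNIV" by auto
  ultimately show ?thesis by (simp add: set_integrable_def)
qed

lemma integrable_strip_decay_line:
  assumes "strip_decay \<kappa> f" "\<kappa> > 1" "continuous_on {s. Re s = c} f"
  shows "integrable lborel (\<lambda>t. f (Complex c t))"
proof -
  obtain C T where C: "0 < C" "0 < T" "\<And>x t. x \<in> {c..c} \<Longrightarrow> T \<le> \<bar>t\<bar> \<Longrightarrow> cmod (f (Complex x t)) \<le> C * \<bar>t\<bar> powr (-\<kappa>)"
    using strip_decayE[OF assms(1)] by metis
  have "continuous_on UNIV (\<lambda>t. f (Complex c t))"
    by (rule continuous_on_compose2[OF assms(3)]) (auto simp: Complex_eq intro!: continuous_intros)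
  thus ?thesis using integrable_lborel_powr_decay[of _ \<kappa> T C] C assms(2) by simp
qed

lemma is_pole_Gamma_affine_iff:
  assumes "c \<noteq> 0"
  shows "is_pole (\<lambda>w. Gamma (a + w * c :: complex)) s \<longleftrightarrow> a + s * c \<in> \<int>\<^sub>\<le>\<^sub>0"
proof
  assume pole: "is_pole (\<lambda>w. Gamma (a + w * c)) s"
  show "a + s * c \<in> \<int>\<^sub>\<le>\<^sub>0"
  proof (rule ccontr)
    assume "a + s * c \<notin> \<int>\<^sub>\<le>\<^sub>0"
    hence "(\<lambda>w. Gamma (a + w * c)) field_differentiable (at s)"
      unfolding field_differentiable_def by (auto intro!: derivative_eq_intros)
    hence "isCont (\<lambda>w. Gamma (a + w * c)) s" by (rule field_differentiable_imp_continuous_at)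
    hence "(\<lambda>w. Gamma (a + w * c)) \<midarrow>s\<rightarrow> Gamma (a + s * c)" by (simp add: isCont_def)
    thus False using pole not_tendsto_and_filterlim_at_infinity[of "at s"] unfolding is_pole_def by auto
  qed
next
  assume "a + s * c \<in> \<int>\<^sub>\<le>\<^sub>0"
  then obtain n where n: "a + s * c = - of_nat n" by (elim nonpos_Ints_cases')
  have "filterlim (\<lambda>w. a + w * c) (at (a + s * c)) (at s)"
  proof (rule filterlim_atI)
    show "(\<lambda>w. a + w * c) \<midarrow>s\<rightarrow> a + s * c" by (intro tendsto_intros)
    show "\<forall>\<^sub>F w in at s. a + w * c \<noteq> a + s * c"
      using assms by (auto simp: eventually_at intro!: exI[of _ 1])
  qed
  hence "filterlim (\<lambda>w. a + w * c) (at (- of_nat n)) (at s)" by (simp only: n)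
  from filterlim_compose[OF Gamma_poles this]
  show "is_pole (\<lambda>w. Gamma (a + w * c)) s" by (simp add: is_pole_def)
qed

lemma Fox_H_left_poles_eq:
  assumes "\<forall>j\<in>{1..m}. \<beta> j > 0"
  shows "Fox_H_left_poles m b \<beta> = (\<Union>j\<in>{1..m}. {s. b j + s * of_real (\<beta> j) \<in> \<int>\<^sub>\<le>\<^sub>0})"
  unfolding Fox_H_left_poles_def
  by (intro SUP_cong refl Collect_cong is_pole_Gamma_affine_iff) (use assms in force)

lemma Fox_H_right_poles_eq:
  assumes "\<forall>i\<in>{1..n}. \<alpha> i > 0"
  shows "Fox_H_right_poles n a \<alpha> = (\<Union>i\<in>{1..n}. {s. 1 - a i - s * of_real (\<alpha> i) \<in> \<int>\<^sub>\<le>\<^sub>0})"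
proof -
  have "is_pole (\<lambda>w. Gamma (1 - a i - w * of_real (\<alpha> i))) s \<longleftrightarrow> 1 - a i - s * of_real (\<alpha> i) \<in> \<int>\<^sub>\<le>\<^sub>0"
    if "i \<in> {1..n}" for i s
    using is_pole_Gamma_affine_iff[of "- of_real (\<alpha> i)" "1 - a i" s] bspec[OF assms that] by simp
  thus ?thesis unfolding Fox_H_right_poles_def by (intro SUP_cong refl Collect_cong) 
qed

lemma closed_affine_nonpos_Ints: "closed {s :: complex. a + s * c \<in> \<int>\<^sub>\<le>\<^sub>0}"
  using continuous_closed_vimage[OF closed_nonpos_Ints, of "\<lambda>s. a + s * c"] by (simp add: vimage_def)

lemma Fox_H_kernel_holomorphic:
  assumes "\<forall>j\<in>{1..m}. \<beta> j > 0" "\<forall>i\<in>{1..n}. \<alpha> i > 0"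
  shows "Fox_H_kernel m n p q a \<alpha> b \<beta> holomorphic_on - (Fox_H_left_poles m b \<beta> \<union> Fox_H_right_poles n a \<alpha>)"
proof -
  have "Fox_H_kernel m n p q a \<alpha> b \<beta> = (\<lambda>s.
     ((\<Prod>j\<in>{1..m}. Gamma (b j + s * of_real (\<beta> j))) *
      (\<Prod>i\<in>{1..n}. Gamma (1 - a i - s * of_real (\<alpha> i)))) *
     ((\<Prod>i\<in>{n+1..p}. rGamma (a i + s * of_real (\<alpha> i))) *
      (\<Prod>j\<in>{m+1..q}. rGamma (1 - b j - s * of_real (\<beta> j)))))"
    by (simp add: fun_eq_iff Fox_H_kernel_def rGamma_inverse_Gamma divide_inverse prod_inversef[unfolded o_def])
  moreover have "\<dots> holomorphic_on - (Fox_H_left_poles m b \<beta> \<union> Fox_H_right_poles n a \<alpha>)"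
    unfolding Fox_H_left_poles_eq[OF assms(1)] Fox_H_right_poles_eq[OF assms(2)]
    by (intro holomorphic_intros) auto
  ultimately show ?thesis by simp
qed

lemma affine_nonpos_IntsD:
  assumes "of_real b + s * of_real c \<in> (\<int>\<^sub>\<le>\<^sub>0 :: complex set)" "c \<noteq> 0"
  shows "Im s = 0" "b + Re s * c \<le> 0"
  using assms by (auto elim!: nonpos_Ints_cases simp: complex_eq_iff)

definition separates_Fox_H_poles ::
  "nat \<Rightarrow> nat \<Rightarrow> (nat \<Rightarrow> real) \<Rightarrow> (nat \<Rightarrow> real) \<Rightarrow> (nat \<Rightarrow> real) \<Rightarrow> (nat \<Rightarrow> real) \<Rightarrow> real \<Rightarrow> bool" where
  "separates_Fox_H_poles m n a \<alpha> b \<beta> c \<longleftrightarrow>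
     (\<forall>j\<in>{1..m}. \<beta> j > 0 \<and> b j + c * \<beta> j > 0) \<and> (\<forall>i\<in>{1..n}. \<alpha> i > 0 \<and> 1 - a i - c * \<alpha> i > 0)"

context
  fixes m n p q :: nat and a \<alpha> b \<beta> :: "nat \<Rightarrow> real" and c \<kappa> :: real
  assumes sep: "separates_Fox_H_poles m n a \<alpha> b \<beta> c"
begin

lemma Fox_H_left_poles_Re_less:
  assumes "s \<in> Fox_H_left_poles m (\<lambda>j. of_real (b j)) \<beta>" shows "Im s = 0 \<and> Re s < c"
proof -
  have pos: "\<forall>j\<in>{1..m}. \<beta> j > 0" using sep by (simp add: separates_Fox_H_poles_def)
  obtain j where j: "j \<in> {1..m}" "of_real (b j) + s * of_real (\<beta> j) \<in> \<int>\<^sub>\<le>\<^sub>0"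
    using assms unfolding Fox_H_left_poles_eq[OF pos] by auto
  have bj: "\<beta> j > 0" "b j + c * \<beta> j > 0" using sep j(1) by (auto simp: separates_Fox_H_poles_def)
  have "Im s = 0" "b j + Re s * \<beta> j \<le> 0" using affine_nonpos_IntsD[OF j(2)] bj by auto
  moreover from this have "Re s * \<beta> j < c * \<beta> j" using bj by linarith
  ultimately show ?thesis using bj by simp
qed

lemma Fox_H_right_poles_Re_greater:
  assumes "s \<in> Fox_H_right_poles n (\<lambda>i. of_real (a i)) \<alpha>" shows "Im s = 0 \<and> Re s > c"
proof -
  have pos: "\<forall>i\<in>{1..n}. \<alpha> i > 0" using sep by (simp add: separates_Fox_H_poles_def)
  obtain i where i: "i \<in> {1..n}" "1 - of_real (a i) - s * of_real (\<alpha> i) \<in> \<int>\<^sub>\<le>\<^sub>0"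
    using assms unfolding Fox_H_right_poles_eq[OF pos] by auto
  have bi: "\<alpha> i > 0" "1 - a i - c * \<alpha> i > 0" using sep i(1) by (auto simp: separates_Fox_H_poles_def)
  have "of_real (1 - a i) + s * of_real (- \<alpha> i) \<in> (\<int>\<^sub>\<le>\<^sub>0 :: complex set)" using i(2) by simp
  from affine_nonpos_IntsD[OF this] have "Im s = 0" "1 - a i + Re s * - \<alpha> i \<le> 0" using bi by auto
  moreover from this have "c * \<alpha> i < Re s * \<alpha> i" using bi by linarith
  ultimately show ?thesis using bi by simp
qed

abbreviation (input) "H_kernel \<equiv> Fox_H_kernel m n p q (\<lambda>i. of_real (a i)) \<alpha> (\<lambda>j. of_real (b j)) \<beta>"

lemma continuous_on_Fox_H_kernel_line: "continuous_on {s. Re s = c} H_kernel"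
proof (rule continuous_on_subset[OF holomorphic_on_imp_continuous_on[OF Fox_H_kernel_holomorphic]])
  show "{s. Re s = c} \<subseteq> - (Fox_H_left_poles m (\<lambda>j. of_real (b j)) \<beta> \<union> Fox_H_right_poles n (\<lambda>i. of_real (a i)) \<alpha>)"
    using Fox_H_left_poles_Re_less Fox_H_right_poles_Re_greater by fastforce
qed (use sep in \<open>auto simp: separates_Fox_H_poles_def\<close>)

text \<open>
  The definite description in the definition of the Fox H-function is justified by this lemma: the
  line itself is a separating contour, which gives existence, and every other separating
  contour gives the same value.
\<close>

theorem Fox_H_eq_vertical_line:
  assumes decay: "strip_decay \<kappa> H_kernel" "\<kappa> > 1" and x: "x > 0"
  shows "Fox_H m n p q (\<lambda>i. of_real (a i)) \<alpha> (\<lambda>j. of_real (b j)) \<beta> (of_real x) =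
           (LBINT t. H_kernel (Complex c t) * exp (- Complex c t * of_real (ln x))) / (2 * of_real pi)"
proof -
  let ?P = "Fox_H_left_poles m (\<lambda>j. of_real (b j)) \<beta>" and ?Q = "Fox_H_right_poles n (\<lambda>i. of_real (a i)) \<alpha>"
  let ?f = "\<lambda>s. H_kernel s * exp (- s * of_real (ln x))"
  have pos: "\<forall>j\<in>{1..m}. \<beta> j > 0" "\<forall>i\<in>{1..n}. \<alpha> i > 0"
    using sep by (auto simp: separates_Fox_H_poles_def)
  have cl: "closed ?P" unfolding Fox_H_left_poles_eq[OF pos(1)]
    by (intro closed_UN) (auto intro: closed_affine_nonpos_Ints)
  have cl': "closed ?Q" unfolding Fox_H_right_poles_eq[OF pos(2)]
  proof (intro closed_UN ballI)
    fix i
    show "closed {s. 1 - of_real (a i) - s * of_real (\<alpha> i) \<in> (\<int>\<^sub>\<le>\<^sub>0 :: complex set)}"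
      using closed_affine_nonpos_Ints[of "1 - of_real (a i)" "- of_real (\<alpha> i)"] by simp
  qed auto
  have dec: "strip_decay \<kappa> ?f" by (rule strip_decay_mult_exp[OF decay(1)])
  have "has_Fox_H m n p q (\<lambda>i. of_real (a i)) \<alpha> (\<lambda>j. of_real (b j)) \<beta> (of_real x) v \<longleftrightarrow>
          v = (LBINT t. ?f (Complex c t)) / (2 * of_real pi)" for v
  proof -
    have "(\<exists>\<gamma> T g I. separating_MB_contour ?P ?Q \<gamma> T g \<and> has_MB_integral ?f I \<gamma> T g \<and> v = I / (2 * of_real pi * \<i>))
          \<longleftrightarrow> v = (LBINT t. ?f (Complex c t)) / (2 * of_real pi)"
    proof (rule MB_integral_eq_vertical_line[OF Fox_H_left_poles_Re_less Fox_H_right_poles_Re_greater cl cl'])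
      show "?f holomorphic_on - (?P \<union> ?Q)"
        by (intro holomorphic_intros Fox_H_kernel_holomorphic) (use pos in auto)
      show "vanishes_on_strips ?f" using strip_decay_vanishes[OF dec] decay(2) by simp
      show "integrable lborel (\<lambda>t. ?f (Complex c t))"
        using continuous_on_Fox_H_kernel_line
        by (intro integrable_strip_decay_line[OF dec decay(2)] continuous_intros)
    qed
    thus ?thesis using x unfolding has_Fox_H_def by (simp add: Arg_of_real)
  qed
  thus ?thesis unfolding Fox_H_def by (intro the_equality) blast+
qed

end

section \<open>Decay of quotients of Gamma functions\<close>

lemma prod_uniform_bound:
  fixes F G :: "'i \<Rightarrow> 'b \<Rightarrow> real"
  assumes "finite A" and "\<And>j. j \<in> A \<Longrightarrow> \<exists>C>0. \<forall>z\<in>D. 0 \<le> F j z \<and> F j z \<le> C * G j z"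
  shows "\<exists>C>0. \<forall>z\<in>D. (\<Prod>j\<in>A. F j z) \<le> C * (\<Prod>j\<in>A. G j z)"
proof -
  obtain C where C: "\<And>j. j \<in> A \<Longrightarrow> C j > 0" "\<And>j z. j \<in> A \<Longrightarrow> z \<in> D \<Longrightarrow> 0 \<le> F j z \<and> F j z \<le> C j * G j z"
    using assms(2) by metis
  have "(\<Prod>j\<in>A. F j z) \<le> (\<Prod>j\<in>A. C j) * (\<Prod>j\<in>A. G j z)" if "z \<in> D" for z
    unfolding prod.distrib[symmetric] using C(2) that by (intro prod_mono) auto
  moreover have "(\<Prod>j\<in>A. C j) > 0" using C(1) by (intro prod_pos) auto
  ultimately show ?thesis by blast
qed

lemma Gamma_affine_strip_bounds:
  fixes u v b \<beta> :: real
  assumes "\<beta> > 0"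
  defines "D \<equiv> {(x, t). x \<in> {u..v} \<and> 1 \<le> \<beta> * \<bar>t\<bar>}"
  shows "\<exists>C>0. \<forall>z\<in>D. 0 \<le> cmod (Gamma (of_real b + Complex (fst z) (snd z) * of_real \<beta>)) \<and>
            cmod (Gamma (of_real b + Complex (fst z) (snd z) * of_real \<beta>)) \<le> C * Stirling_modulus (b + \<beta> * fst z) (\<beta> * snd z)"
    "\<exists>C>0. \<forall>z\<in>D. 0 \<le> cmod (rGamma (of_real b + Complex (fst z) (snd z) * of_real \<beta>)) \<and>
            cmod (rGamma (of_real b + Complex (fst z) (snd z) * of_real \<beta>)) \<le> C * inverse (Stirling_modulus (b + \<beta> * fst z) (\<beta> * snd z))"
proof -
  obtain c C where cC: "c > 0" "C > 0"
    and lo: "\<And>x y. x \<in> {b + \<beta> * u..b + \<beta> * v} \<Longrightarrow> 1 \<le> \<bar>y\<bar> \<Longrightarrow> c * Stirling_modulus x y \<le> cmod (Gamma (Complex x y))"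
    and up: "\<And>x y. x \<in> {b + \<beta> * u..b + \<beta> * v} \<Longrightarrow> 1 \<le> \<bar>y\<bar> \<Longrightarrow> cmod (Gamma (Complex x y)) \<le> C * Stirling_modulus x y"
    using Gamma_vertical_strip_bounds[of "b + \<beta> * u" "b + \<beta> * v"] by metis
  have eq: "of_real b + Complex x t * of_real \<beta> = Complex (b + \<beta> * x) (\<beta> * t)" for x t
    by (simp add: complex_eq_iff mult.commute)
  have D: "b + \<beta> * x \<in> {b + \<beta> * u..b + \<beta> * v} \<and> 1 \<le> \<bar>\<beta> * t\<bar> \<and> Stirling_modulus (b + \<beta> * x) (\<beta> * t) > 0"
    if "(x, t) \<in> D" for x t
  proof -
    have "1 \<le> \<bar>\<beta> * t\<bar>" using that assms(1) by (auto simp: D_def abs_mult)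
    moreover from this have "\<beta> * t \<noteq> 0" by linarith
    ultimately show ?thesis using that assms(1) by (auto simp: D_def Stirling_modulus_pos)
  qed
  show "\<exists>C>0. \<forall>z\<in>D. 0 \<le> cmod (Gamma (of_real b + Complex (fst z) (snd z) * of_real \<beta>)) \<and>
            cmod (Gamma (of_real b + Complex (fst z) (snd z) * of_real \<beta>)) \<le> C * Stirling_modulus (b + \<beta> * fst z) (\<beta> * snd z)"
    unfolding eq using D up cC by (intro exI[of _ C]) auto
  show "\<exists>C>0. \<forall>z\<in>D. 0 \<le> cmod (rGamma (of_real b + Complex (fst z) (snd z) * of_real \<beta>)) \<and>
            cmod (rGamma (of_real b + Complex (fst z) (snd z) * of_real \<beta>)) \<le> C * inverse (Stirling_modulus (b + \<beta> * fst z) (\<beta> * snd z))"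
  proof (intro exI[of _ "inverse c"] conjI ballI)
    fix z assume "z \<in> D"
    then obtain x t where z: "z = (x, t)" "(x, t) \<in> D" by (metis surj_pair)
    have "inverse (cmod (Gamma (Complex (b + \<beta> * x) (\<beta> * t)))) \<le> inverse (c * Stirling_modulus (b + \<beta> * x) (\<beta> * t))"
      using D[OF z(2)] cC by (intro le_imp_inverse_le lo) auto
    thus "cmod (rGamma (of_real b + Complex (fst z) (snd z) * of_real \<beta>)) \<le> inverse c * inverse (Stirling_modulus (b + \<beta> * fst z) (\<beta> * snd z))"
      unfolding z fst_conv snd_conv eq by (simp add: rGamma_inverse_Gamma norm_inverse)
  qed (use cC in auto)
qed

text \<open>
  Written as an exponential, so that products over the parameters become sums: in the quotient the
  coefficients of \<open>ln \<bar>t\<bar>\<close> add up to \<open>\<mu> + a\<^sup>* x\<close> and those of \<open>\<bar>t\<bar>\<close> to \<open>- \<pi> a\<^sup>* / 2\<close>.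
\<close>

lemma Stirling_modulus_scaled:
  assumes "\<beta> > 0" "t \<noteq> 0"
  shows "Stirling_modulus (b + \<beta> * x) (\<beta> * t) =
     exp ((b - 1/2) * ln \<beta> + (\<beta> * ln \<beta>) * x + ((b - 1/2) + \<beta> * x) * ln \<bar>t\<bar> - \<beta> * (pi * \<bar>t\<bar> / 2))"
  using assms by (simp add: Stirling_modulus_def powr_def abs_mult ln_mult exp_add[symmetric] exp_diff algebra_simps)

lemma ln_le_linear:
  fixes M c y :: real
  assumes "M > 0" "c > 0" "y > 0"
  shows "M * ln y \<le> c * y + M * ln (M / c)"
proof -
  have "ln (y * c / M) \<le> y * c / M - 1" using assms by (intro ln_le_minus_one) auto
  hence "ln (y * c / M) \<le> y * c / M" by simp
  moreover have "ln y = ln (y * c / M) + ln (M / c)" using assms by (simp add: ln_mult_pos[symmetric] flip: ln_mult)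
  ultimately have "M * ln y \<le> M * (y * c / M + ln (M / c))" using assms by (intro mult_left_mono) auto
  thus ?thesis using assms by (simp add: algebra_simps)
qed

locale Fox_H_parameters =
  fixes m p :: nat and a \<alpha> b \<beta> :: "nat \<Rightarrow> real"
  assumes alpha: "\<And>i. i \<in> {1..p} \<Longrightarrow> \<alpha> i > 0 \<and> a i + \<alpha> i > 0"
    and beta: "\<And>j. j \<in> {1..m} \<Longrightarrow> \<beta> j > 0 \<and> b j + \<beta> j > 0"
    and balance: "(\<Sum>j\<in>{1..m}. \<beta> j) - (\<Sum>i\<in>{1..p}. \<alpha> i) > 0 \<or>
      (\<Sum>j\<in>{1..m}. \<beta> j) - (\<Sum>i\<in>{1..p}. \<alpha> i) = 0 \<and>
      (\<Sum>j\<in>{1..m}. b j) - (\<Sum>i\<in>{1..p}. a i) + (real p - real m) / 2 < -1"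
begin

text \<open>
  The kernel; with \<open>rGamma\<close> its value at a pole of a denominator factor is the correct zero.
\<close>

definition h :: "complex \<Rightarrow> complex" where
  "h s = (\<Prod>j\<in>{1..m}. Gamma (of_real (b j) + s * of_real (\<beta> j))) *
         (\<Prod>i\<in>{1..p}. rGamma (of_real (a i) + s * of_real (\<alpha> i)))"

definition "a_star = (\<Sum>j\<in>{1..m}. \<beta> j) - (\<Sum>i\<in>{1..p}. \<alpha> i)"
definition "\<mu> = (\<Sum>j\<in>{1..m}. b j) - (\<Sum>i\<in>{1..p}. a i) + (real p - real m) / 2"

definition "\<kappa> = (if a_star > 0 then 2 else - \<mu>)"

lemma kappa_gt_1: "\<kappa> > 1"
  using balance by (auto simp: \<kappa>_def a_star_def \<mu>_def)

text \<open>
  \<open>T\<close> is chosen so large that the imaginary parts \<open>\<beta>\<^sub>j t\<close> and \<open>\<alpha>\<^sub>i t\<close> all have modulus at least one. The factors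
  \<open>exp (A + B x)\<close> that come from the scales \<open>\<beta>\<^sub>j\<close>, \<open>\<alpha>\<^sub>i\<close> are bounded on the strip.
\<close>

lemma norm_h_bound:
  obtains C T where "C > 0" "T \<ge> 1" "\<And>x t. x \<in> {u..v} \<Longrightarrow> T \<le> \<bar>t\<bar> \<Longrightarrow>
    cmod (h (Complex x t)) \<le> C * exp ((\<mu> + a_star * x) * ln \<bar>t\<bar> - a_star * (pi * \<bar>t\<bar> / 2))"
proof -
  \<comment> \<open>A sum is used as a convenient upper bound for the maximum.\<close>
  define T where "T = 1 + (\<Sum>j\<in>{1..m}. 1 / \<beta> j) + (\<Sum>i\<in>{1..p}. 1 / \<alpha> i)"
  have s0: "0 \<le> (\<Sum>j\<in>{1..m}. 1 / \<beta> j)" "0 \<le> (\<Sum>i\<in>{1..p}. 1 / \<alpha> i)"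
    using alpha beta by (fastforce intro!: sum_nonneg)+
  hence T1: "T \<ge> 1" by (simp add: T_def)
  have Tb: "1 \<le> \<beta> j * \<bar>t\<bar>" if "j \<in> {1..m}" "T \<le> \<bar>t\<bar>" for j t
  proof -
    have "1 / \<beta> j \<le> (\<Sum>j\<in>{1..m}. 1 / \<beta> j)"
      by (rule member_le_sum) (use that beta in \<open>auto intro: less_imp_le\<close>)
    hence "1 / \<beta> j \<le> \<bar>t\<bar>" using that s0 by (simp add: T_def)
    thus ?thesis using beta[OF that(1)] by (simp add: field_simps)
  qed
  have Ta: "1 \<le> \<alpha> i * \<bar>t\<bar>" if "i \<in> {1..p}" "T \<le> \<bar>t\<bar>" for i t
  proof -
    have "1 / \<alpha> i \<le> (\<Sum>i\<in>{1..p}. 1 / \<alpha> i)"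
      by (rule member_le_sum) (use that alpha in \<open>auto intro: less_imp_le\<close>)
    hence "1 / \<alpha> i \<le> \<bar>t\<bar>" using that s0 by (simp add: T_def)
    thus ?thesis using alpha[OF that(1)] by (simp add: field_simps)
  qed
  define D where "D = {(x, t). x \<in> {u..v} \<and> T \<le> \<bar>t\<bar>}"
  have "\<exists>C>0. \<forall>z\<in>D. (\<Prod>j\<in>{1..m}. cmod (Gamma (of_real (b j) + Complex (fst z) (snd z) * of_real (\<beta> j))))
          \<le> C * (\<Prod>j\<in>{1..m}. Stirling_modulus (b j + \<beta> j * fst z) (\<beta> j * snd z))"
  proof (rule prod_uniform_bound)
    fix j assume j: "j \<in> {1..m}"
    have sub: "D \<subseteq> {(x, t). x \<in> {u..v} \<and> 1 \<le> \<beta> j * \<bar>t\<bar>}" using Tb[OF j] by (auto simp: D_def)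
    show "\<exists>C>0. \<forall>z\<in>D. 0 \<le> cmod (Gamma (of_real (b j) + Complex (fst z) (snd z) * of_real (\<beta> j))) \<and>
          cmod (Gamma (of_real (b j) + Complex (fst z) (snd z) * of_real (\<beta> j)))
          \<le> C * Stirling_modulus (b j + \<beta> j * fst z) (\<beta> j * snd z)"
      using Gamma_affine_strip_bounds(1)[of "\<beta> j" u v "b j"] beta[OF j] sub by (meson subsetD)
  qed simp
  then obtain C1 where C1: "C1 > 0" "\<And>z. z \<in> D \<Longrightarrow>
      (\<Prod>j\<in>{1..m}. cmod (Gamma (of_real (b j) + Complex (fst z) (snd z) * of_real (\<beta> j))))
          \<le> C1 * (\<Prod>j\<in>{1..m}. Stirling_modulus (b j + \<beta> j * fst z) (\<beta> j * snd z))" by blast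
  have "\<exists>C>0. \<forall>z\<in>D. (\<Prod>i\<in>{1..p}. cmod (rGamma (of_real (a i) + Complex (fst z) (snd z) * of_real (\<alpha> i))))
          \<le> C * (\<Prod>i\<in>{1..p}. inverse (Stirling_modulus (a i + \<alpha> i * fst z) (\<alpha> i * snd z)))"
  proof (rule prod_uniform_bound)
    fix i assume i: "i \<in> {1..p}"
    have sub: "D \<subseteq> {(x, t). x \<in> {u..v} \<and> 1 \<le> \<alpha> i * \<bar>t\<bar>}" using Ta[OF i] by (auto simp: D_def)
    show "\<exists>C>0. \<forall>z\<in>D. 0 \<le> cmod (rGamma (of_real (a i) + Complex (fst z) (snd z) * of_real (\<alpha> i))) \<and>
          cmod (rGamma (of_real (a i) + Complex (fst z) (snd z) * of_real (\<alpha> i)))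
          \<le> C * inverse (Stirling_modulus (a i + \<alpha> i * fst z) (\<alpha> i * snd z))"
      using Gamma_affine_strip_bounds(2)[of "\<alpha> i" u v "a i"] alpha[OF i] sub by (meson subsetD)
  qed simp
  then obtain C2 where C2: "C2 > 0" "\<And>z. z \<in> D \<Longrightarrow>
      (\<Prod>i\<in>{1..p}. cmod (rGamma (of_real (a i) + Complex (fst z) (snd z) * of_real (\<alpha> i))))
          \<le> C2 * (\<Prod>i\<in>{1..p}. inverse (Stirling_modulus (a i + \<alpha> i * fst z) (\<alpha> i * snd z)))" by blast
  define A where "A = (\<Sum>j\<in>{1..m}. (b j - 1/2) * ln (\<beta> j)) - (\<Sum>i\<in>{1..p}. (a i - 1/2) * ln (\<alpha> i))"
  define B where "B = (\<Sum>j\<in>{1..m}. \<beta> j * ln (\<beta> j)) - (\<Sum>i\<in>{1..p}. \<alpha> i * ln (\<alpha> i))"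
  define C where "C = C1 * C2 * exp (\<bar>A\<bar> + \<bar>B\<bar> * (\<bar>u\<bar> + \<bar>v\<bar>))"
  have "cmod (h (Complex x t)) \<le> C * exp ((\<mu> + a_star * x) * ln \<bar>t\<bar> - a_star * (pi * \<bar>t\<bar> / 2))"
    if x: "x \<in> {u..v}" and t: "T \<le> \<bar>t\<bar>" for x t
  proof -
    have t0: "t \<noteq> 0" using t T1 by auto
    have "(x, t) \<in> D" using x t by (simp add: D_def)
    note b = C1(2)[OF this, unfolded fst_conv snd_conv] C2(2)[OF this, unfolded fst_conv snd_conv]
    let ?L = "ln \<bar>t\<bar>" and ?p = "pi * \<bar>t\<bar> / 2"
    have mu: "\<mu> = (\<Sum>j\<in>{1..m}. (b j - 1/2)) - (\<Sum>i\<in>{1..p}. (a i - 1/2))"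
      unfolding sum_subtractf \<mu>_def by (simp add: algebra_simps diff_divide_distrib)
    have e1: "(\<Prod>j\<in>{1..m}. Stirling_modulus (b j + \<beta> j * x) (\<beta> j * t)) =
       exp (\<Sum>j\<in>{1..m}. (b j - 1/2) * ln (\<beta> j) + (\<beta> j * ln (\<beta> j)) * x + ((b j - 1/2) + \<beta> j * x) * ?L - \<beta> j * ?p)"
      unfolding exp_sum[OF finite_atLeastAtMost] using beta t0
      by (intro prod.cong refl Stirling_modulus_scaled) auto
    have e2: "(\<Prod>i\<in>{1..p}. inverse (Stirling_modulus (a i + \<alpha> i * x) (\<alpha> i * t))) =
       exp (- (\<Sum>i\<in>{1..p}. (a i - 1/2) * ln (\<alpha> i) + (\<alpha> i * ln (\<alpha> i)) * x + ((a i - 1/2) + \<alpha> i * x) * ?L - \<alpha> i * ?p))"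
      unfolding exp_minus prod_inversef[unfolded o_def] exp_sum[OF finite_atLeastAtMost] using alpha t0
      by (intro arg_cong[where f = inverse] prod.cong refl Stirling_modulus_scaled) auto
    have "cmod (h (Complex x t)) =
        (\<Prod>j\<in>{1..m}. cmod (Gamma (of_real (b j) + Complex x t * of_real (\<beta> j)))) *
        (\<Prod>i\<in>{1..p}. cmod (rGamma (of_real (a i) + Complex x t * of_real (\<alpha> i))))"
      by (simp add: h_def norm_mult prod_norm)
    also have "\<dots> \<le> (C1 * (\<Prod>j\<in>{1..m}. Stirling_modulus (b j + \<beta> j * x) (\<beta> j * t))) *
        (C2 * (\<Prod>i\<in>{1..p}. inverse (Stirling_modulus (a i + \<alpha> i * x) (\<alpha> i * t))))"
      using b C1(1) by (intro mult_mono) (auto intro!: prod_nonneg mult_nonneg_nonneg simp: Stirling_modulus_def)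
    also have "\<dots> = C1 * C2 * exp (A + B * x + ((\<mu> + a_star * x) * ?L - a_star * ?p))"
      unfolding e1 e2 A_def B_def mu a_star_def
      by (simp add: sum.distrib sum_subtractf sum_distrib_right sum_distrib_left sum_divide_distrib algebra_simps
          flip: exp_add)
    also have "\<dots> \<le> C1 * C2 * exp (\<bar>A\<bar> + \<bar>B\<bar> * (\<bar>u\<bar> + \<bar>v\<bar>) + ((\<mu> + a_star * x) * ?L - a_star * ?p))"
    proof -
      have "B * x \<le> \<bar>B\<bar> * \<bar>x\<bar>" using abs_ge_self[of "B * x"] by (simp add: abs_mult)
      also have "\<dots> \<le> \<bar>B\<bar> * (\<bar>u\<bar> + \<bar>v\<bar>)" using x by (intro mult_left_mono) auto
      finally show ?thesis using C1 C2 by (intro mult_left_mono) auto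
    qed
    also have "\<dots> = C * exp ((\<mu> + a_star * x) * ?L - a_star * ?p)"
      unfolding C_def exp_add by (simp only: mult.assoc)
    finally show ?thesis .
  qed
  moreover have "C > 0" using C1 C2 by (simp add: C_def)
  ultimately show ?thesis using that T1 by blast
qed

text \<open>
  If \<open>a\<^sup>* = 0\<close> the bound is \<open>\<bar>t\<bar>\<close> to the power \<open>\<mu> < -1\<close>. If \<open>a\<^sup>* > 0\<close> the exponential beats every power, and the exponent \<open>-2\<close> is
  an arbitrary choice below \<open>-1\<close>.
\<close>

lemma strip_decay_h: "strip_decay \<kappa> h"
  unfolding strip_decay_def
proof (intro allI)
  fix u v
  obtain C T where C: "C > 0" "T \<ge> 1" "\<And>x t. x \<in> {u..v} \<Longrightarrow> T \<le> \<bar>t\<bar> \<Longrightarrow>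
    cmod (h (Complex x t)) \<le> C * exp ((\<mu> + a_star * x) * ln \<bar>t\<bar> - a_star * (pi * \<bar>t\<bar> / 2))"
    using norm_h_bound[of u v] by metis
  have "\<exists>E. \<forall>x\<in>{u..v}. \<forall>t. T \<le> \<bar>t\<bar> \<longrightarrow>
     (\<mu> + a_star * x) * ln \<bar>t\<bar> - a_star * (pi * \<bar>t\<bar> / 2) \<le> E + (-\<kappa>) * ln \<bar>t\<bar>"
  proof (cases "a_star > 0")
    case False
    hence "a_star = 0" using balance by (auto simp: a_star_def)
    thus ?thesis by (auto simp: \<kappa>_def)
  next
    case True
    \<comment> \<open>\<open>M - 2\<close> bounds the exponent of \<open>\<bar>t\<bar>\<close> on the strip; the \<open>2\<close> is \<open>\<kappa>\<close>.\<close>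
    define M where "M = \<bar>\<mu>\<bar> + a_star * (\<bar>u\<bar> + \<bar>v\<bar>) + 2"
    have M: "M > 0" using True by (simp add: M_def add_nonneg_pos)
    define c where "c = a_star * (pi / 2)"
    have c: "c > 0" using True by (simp add: c_def)
    have "(\<mu> + a_star * x) * ln \<bar>t\<bar> - a_star * (pi * \<bar>t\<bar> / 2) \<le> M * ln (M / c) + (-\<kappa>) * ln \<bar>t\<bar>"
      if x: "x \<in> {u..v}" and t: "T \<le> \<bar>t\<bar>" for x t
    proof -
      have "a_star * x \<le> a_star * (\<bar>u\<bar> + \<bar>v\<bar>)" using x True by (intro mult_left_mono) auto
      hence "\<mu> + a_star * x + 2 \<le> M" by (simp add: M_def)
      moreover have "ln \<bar>t\<bar> \<ge> 0" using t C(2) by simp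
      ultimately have "(\<mu> + a_star * x + 2) * ln \<bar>t\<bar> \<le> M * ln \<bar>t\<bar>" by (intro mult_right_mono)
      also have "\<dots> \<le> c * \<bar>t\<bar> + M * ln (M / c)" using t C(2) by (intro ln_le_linear M c) auto
      finally show ?thesis using True by (simp add: \<kappa>_def c_def algebra_simps)
    qed
    thus ?thesis by blast
  qed
  then obtain E where E: "\<And>x t. x \<in> {u..v} \<Longrightarrow> T \<le> \<bar>t\<bar> \<Longrightarrow>
     (\<mu> + a_star * x) * ln \<bar>t\<bar> - a_star * (pi * \<bar>t\<bar> / 2) \<le> E + (-\<kappa>) * ln \<bar>t\<bar>" by blast
  have "cmod (h (Complex x t)) \<le> (C * exp E) * \<bar>t\<bar> powr (-\<kappa>)" if x: "x \<in> {u..v}" and t: "T \<le> \<bar>t\<bar>" for x t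
  proof -
    have "cmod (h (Complex x t)) \<le> C * exp (E + (-\<kappa>) * ln \<bar>t\<bar>)"
      using E[OF x t] C(1) by (intro order_trans[OF C(3)[OF x t]] mult_left_mono) auto
    moreover have "exp (E + (-\<kappa>) * ln \<bar>t\<bar>) = exp E * \<bar>t\<bar> powr (-\<kappa>)"
      using t C(2) by (auto simp: powr_def exp_add[symmetric])
    ultimately show ?thesis by (simp only: mult.assoc)
  qed
  thus "\<exists>C T. 0 < C \<and> 0 < T \<and> (\<forall>x\<in>{u..v}. \<forall>t. T \<le> \<bar>t\<bar> \<longrightarrow> cmod (h (Complex x t)) \<le> C * \<bar>t\<bar> powr (-\<kappa>))"
    using C by (intro exI[of _ "C * exp E"] exI[of _ T]) auto
qed

end

section \<open>Moments\<close>

lemma tendsto_symmetric_integral: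
  assumes "integrable lborel (F :: real \<Rightarrow> complex)"
  shows "((\<lambda>R. integral {-R..R} F) \<longlongrightarrow> (LBINT t. F t)) at_top"
  using has_integral_symmetric_limit[OF has_integral_integral_lborel[OF assms]] by simp

text \<open>
  Cauchy's integral formula for rectangles of growing height. Both signs are positive because the
  denominator is reversed on the left-hand line, which is traversed downwards.
\<close>

theorem Cauchy_formula_vertical_strip:
  fixes f :: "complex \<Rightarrow> complex"
  assumes hol: "f holomorphic_on {s. \<sigma> < Re s}"
    and cont: "\<And>R. R > 0 \<Longrightarrow> continuous_on {s. Im s = R} f \<and> continuous_on {s. Im s = -R} f"
    and decay: "strip_decay \<kappa> f" "\<kappa> > 1"
    and w: "Im w = 0" and c: "\<sigma> < c1" "c1 < Re w" "Re w < c2"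
  shows "(LBINT t. f (Complex c1 t) / (w - Complex c1 t)) + (LBINT t. f (Complex c2 t) / (Complex c2 t - w)) = 2 * pi * f w"
proof -
  define G where "G = (\<lambda>s. f s / (s - w))"
  have G_decay: "strip_decay \<kappa> G"
  proof -
    have "strip_decay \<kappa> (\<lambda>s. inverse (s - w) * f s)"
    proof (rule strip_decay_mult_bounded[OF decay(1)])
      fix u v :: real
      have "cmod (inverse (Complex x t - w)) \<le> 1" if "1 \<le> \<bar>t\<bar>" for x t
      proof -
        have "1 \<le> cmod (Complex x t - w)" using abs_Im_le_cmod[of "Complex x t - w"] that w by simp
        thus ?thesis by (simp add: norm_inverse inverse_le_1_iff)
      qed
      thus "\<exists>D>0. \<exists>T>0. \<forall>x\<in>{u..v}. \<forall>t. T \<le> \<bar>t\<bar> \<longrightarrow> cmod (inverse (Complex x t - w)) \<le> D"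
        by (intro exI[of _ 1] conjI) auto
    qed
    thus ?thesis by (simp add: G_def field_simps)
  qed
  have contf: "continuous_on {s. \<sigma> < Re s} f" using hol by (rule holomorphic_on_imp_continuous_on)
  have G_cont: "continuous_on {s. Re s = c} G" if "\<sigma> < c" "c \<noteq> Re w" for c
    unfolding G_def using that by (intro continuous_intros continuous_on_subset[OF contf]) auto
  have G_int: "integrable lborel (\<lambda>t. G (Complex c t))" if "\<sigma> < c" "c \<noteq> Re w" for c
    by (rule integrable_strip_decay_line[OF G_decay decay(2) G_cont[OF that]])
  have G_hor: "continuous_on {s. Im s = R} G \<and> continuous_on {s. Im s = -R} G" if "R > 0" for R
    unfolding G_def using cont[OF that] w that by (auto intro!: continuous_intros)
  have van: "vanishes_on_strips G" using strip_decay_vanishes[OF G_decay] decay(2) by simp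
  have rect: "\<i> * integral {-R..R} (\<lambda>t. G (Complex c2 t)) - \<i> * integral {-R..R} (\<lambda>t. G (Complex c1 t)) +
     contour_integral (linepath (Complex c1 (-R)) (Complex c2 (-R))) G +
     contour_integral (linepath (Complex c2 R) (Complex c1 R)) G = 2 * pi * \<i> * f w" if R: "R > 0" for R
  proof -
    let ?r = "rectpath (Complex c1 (-R)) (Complex c2 R)"
    have box: "w \<in> box (Complex c1 (-R)) (Complex c2 R)"
      using w c R by (auto simp: in_box_complex_iff)
    have wr: "w \<notin> path_image ?r"
      using box path_image_rectpath_cbox_minus_box[of "Complex c1 (-R)" "Complex c2 R"] c R by auto
    have sub: "path_image ?r \<subseteq> {s. \<sigma> < Re s}"
      using path_image_rectpath_subset_cbox[of "Complex c1 (-R)" "Complex c2 R"] c R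
      by (auto simp: in_cbox_complex_iff)
    have open_hp: "open {s. \<sigma> < Re s}" using open_halfspace_Re_gt[of \<sigma>] by simp
    have "((\<lambda>s. f s / (s - w)) has_contour_integral 2 * pi * \<i> * winding_number ?r w * f w) ?r"
    proof (rule Cauchy_integral_formula_convex_simple[OF _ hol])
      \<comment> \<open>The open half-plane serves as the convex domain for all heights \<open>R\<close> at once.\<close>
      show "w \<in> interior {s. \<sigma> < Re s}" using open_hp c by (simp add: interior_open)
    qed (use sub wr convex_halfspace_Re_gt[of \<sigma>] in auto)
    hence 1: "(G has_contour_integral 2 * pi * \<i> * f w) ?r"
      using winding_number_rectpath[OF box] by (simp add: G_def)
    have S: "closed_segment (Complex c1 (-R)) (Complex c2 (-R)) \<subseteq> {s. Im s = -R}"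
       "closed_segment (Complex c2 (-R)) (Complex c2 R) \<subseteq> {s. Re s = c2}"
       "closed_segment (Complex c2 R) (Complex c1 R) \<subseteq> {s. Im s = R}"
       "closed_segment (Complex c1 R) (Complex c1 (-R)) \<subseteq> {s. Re s = c1}"
      using closed_segment_same_Im_subset[of c1 "-R" c2] closed_segment_same_Re_subset[of c2 "-R" R]
        closed_segment_same_Im_subset[of c2 R c1] closed_segment_same_Re_subset[of c1 R "-R"] by auto
    have C: "continuous_on (closed_segment (Complex c1 (-R)) (Complex c2 (-R))) G"
       "continuous_on (closed_segment (Complex c2 (-R)) (Complex c2 R)) G"
       "continuous_on (closed_segment (Complex c2 R) (Complex c1 R)) G"
       "continuous_on (closed_segment (Complex c1 R) (Complex c1 (-R))) G"
      using G_hor[OF R] G_cont[of c1] G_cont[of c2] c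
      by (auto intro: continuous_on_subset[OF _ S(1)] continuous_on_subset[OF _ S(2)]
           continuous_on_subset[OF _ S(3)] continuous_on_subset[OF _ S(4)])
    have "(G has_contour_integral (contour_integral (linepath (Complex c1 (-R)) (Complex c2 (-R))) G +
       (contour_integral (linepath (Complex c2 (-R)) (Complex c2 R)) G +
       (contour_integral (linepath (Complex c2 R) (Complex c1 R)) G +
        contour_integral (linepath (Complex c1 R) (Complex c1 (-R))) G)))) ?r"
      unfolding rectpath_def Let_def complex.sel
      by (intro has_contour_integral_join has_contour_integral_integral contour_integrable_continuous_linepath C
           valid_path_join valid_path_linepath) auto
    from has_contour_integral_unique[OF this 1]
    have "contour_integral (linepath (Complex c1 (-R)) (Complex c2 (-R))) G +
       (contour_integral (linepath (Complex c2 (-R)) (Complex c2 R)) G +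
       (contour_integral (linepath (Complex c2 R) (Complex c1 R)) G +
        contour_integral (linepath (Complex c1 R) (Complex c1 (-R))) G)) = 2 * pi * \<i> * f w" .
    moreover have "contour_integral (linepath (Complex c1 R) (Complex c1 (-R))) G = - (\<i> * integral {-R..R} (\<lambda>t. G (Complex c1 t)))"
      using contour_integral_linepath_same_Re[of "Complex c1 (-R)" c1 "Complex c1 R" "-R" R G] R
        contour_integral_reverse_linepath[OF C(4)] by simp
    moreover have "contour_integral (linepath (Complex c2 (-R)) (Complex c2 R)) G = \<i> * integral {-R..R} (\<lambda>t. G (Complex c2 t))"
      by (rule contour_integral_linepath_same_Re) (use R in auto)
    ultimately show ?thesis by (simp add: algebra_simps)
  qed
  have "((\<lambda>R. \<i> * integral {-R..R} (\<lambda>t. G (Complex c2 t)) - \<i> * integral {-R..R} (\<lambda>t. G (Complex c1 t)) +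
     contour_integral (linepath (Complex c1 (-R)) (Complex c2 (-R))) G +
     contour_integral (linepath (Complex c2 R) (Complex c1 R)) G) \<longlongrightarrow>
     \<i> * (LBINT t. G (Complex c2 t)) - \<i> * (LBINT t. G (Complex c1 t)) + 0 + 0) at_top"
    using c by (intro tendsto_intros tendsto_symmetric_integral G_int contour_integral_horizontal_tendsto_0[OF van G_hor]) auto
  moreover have "((\<lambda>R. \<i> * integral {-R..R} (\<lambda>t. G (Complex c2 t)) - \<i> * integral {-R..R} (\<lambda>t. G (Complex c1 t)) +
     contour_integral (linepath (Complex c1 (-R)) (Complex c2 (-R))) G +
     contour_integral (linepath (Complex c2 R) (Complex c1 R)) G) \<longlongrightarrow> 2 * pi * \<i> * f w) at_top"
    by (rule tendsto_eventually) (use rect in \<open>auto intro: eventually_mono[OF eventually_gt_at_top[of 0]]\<close>)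
  ultimately have "\<i> * (LBINT t. G (Complex c2 t)) - \<i> * (LBINT t. G (Complex c1 t)) + 0 + 0 = 2 * pi * \<i> * f w"
    using tendsto_unique trivial_limit_at_top_linorder by blast
  hence "\<i> * ((LBINT t. G (Complex c2 t)) - (LBINT t. G (Complex c1 t))) = \<i> * (2 * pi * f w)"
    by (simp add: algebra_simps)
  hence "(LBINT t. G (Complex c2 t)) - (LBINT t. G (Complex c1 t)) = 2 * pi * f w"
    by (simp only: mult_cancel_left) simp
  moreover have "f (Complex c1 t) / (w - Complex c1 t) = - G (Complex c1 t)" for t
    unfolding G_def by (metis minus_diff_eq minus_divide_right)
  ultimately show ?thesis by (simp add: G_def)
qed

lemma complex_power_integral:
  fixes z :: complex
  shows "Re z > -1 \<Longrightarrow> (LBINT x:{0<..<1}. exp (z * of_real (ln x))) = 1 / (z + 1)"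
    and "Re z < -1 \<Longrightarrow> (LBINT x:{1<..}. exp (z * of_real (ln x))) = - 1 / (z + 1)"
proof -
  let ?f = "\<lambda>x. exp (z * of_real (ln x))" and ?F = "\<lambda>x. exp ((z + 1) * of_real (ln x)) / (z + 1)"
  have cont: "continuous_on {0<..} ?f" by (intro continuous_intros) auto
  have meas: "(\<lambda>x. indicator S x *\<^sub>R ?f x) \<in> borel_measurable lborel" if "S \<in> sets borel" "S \<subseteq> {0<..}" for S :: "real set"
  proof -
    have "(\<lambda>x. indicator S x *\<^sub>R ?f x) \<in> borel_measurable borel"
      using that by (intro borel_measurable_continuous_on_indicator continuous_on_subset[OF cont]) auto
    thus ?thesis by simp
  qed
  have nrm: "cmod (?f x) = x powr Re z" if "x > 0" for x using that by (simp add: powr_def)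
  have int: "set_integrable lborel S ?f" if "S \<in> sets borel" "S \<subseteq> {0<..}" "set_integrable lborel S (\<lambda>x. x powr Re z)" for S
    unfolding set_integrable_def
  proof (rule Bochner_Integration.integrable_bound[OF that(3)[unfolded set_integrable_def] meas[OF that(1,2)] AE_I2])
    fix x show "norm (indicat_real S x *\<^sub>R ?f x) \<le> norm (indicat_real S x *\<^sub>R x powr Re z)"
      using nrm[of x] that(2) by (auto simp: indicator_def)
  qed
  have der: "(?F has_vector_derivative ?f x) (at x)" if "x > 0" "z + 1 \<noteq> 0" for x
  proof -
    have "((\<lambda>x. of_real (ln x) :: complex) has_vector_derivative of_real (1 / x)) (at x)"
      using that by (intro has_vector_derivative_of_real) (auto intro!: derivative_eq_intros simp: has_real_derivative_iff_has_vector_derivative[symmetric])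
    moreover have "((\<lambda>w. exp ((z + 1) * w) / (z + 1)) has_field_derivative exp ((z + 1) * of_real (ln x))) (at (of_real (ln x)))"
      using that by (auto intro!: derivative_eq_intros)
    ultimately have "(((\<lambda>w. exp ((z + 1) * w) / (z + 1)) \<circ> (\<lambda>x. of_real (ln x))) has_vector_derivative
        of_real (1 / x) * exp ((z + 1) * of_real (ln x))) (at x)"
      by (rule field_vector_diff_chain_at)
    moreover have "of_real (1 / x) * exp ((z + 1) * of_real (ln x)) = ?f x"
    proof -
      have "exp (of_real (ln x) :: complex) = of_real (exp (ln x))" by (rule exp_of_real)
      hence "exp (of_real (ln x) :: complex) = of_real x" using that by simp
      thus ?thesis using that by (simp add: ring_distribs exp_add)
    qed
    ultimately show ?thesis by (simp add: o_def)
  qed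
  have Fn: "cmod (?F x) = x powr (Re z + 1) / cmod (z + 1)" if "x > 0" for x
    using that by (simp add: norm_divide powr_def)
  have F1: "?F 1 = 1 / (z + 1)" by simp
  have isC: "isCont ?f x" if "x > 0" for x using that by (intro continuous_intros) auto
  have contF1: "isCont ?F 1" if "z + 1 \<noteq> 0" using that by (intro continuous_intros) auto
  {
    assume z: "Re z > -1"
    hence z1: "z + 1 \<noteq> 0" by (auto simp: complex_eq_iff)
    have "(\<lambda>x. x powr Re z) integrable_on {0..1}" using z by (intro integrable_on_powr_from_0) auto
    hence "(\<lambda>x. x powr Re z) integrable_on {0<..<1}" 
      by (rule integrable_spike_set) (auto intro: negligible_subset[of "{0,1}"])
    hence "set_integrable lborel {0<..<1} (\<lambda>x. x powr Re z)"
      by (rule set_integrable_lborel_nonneg) auto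
    hence i: "set_integrable lborel {0<..<1} ?f" by (intro int) auto
    have "(LBINT x=ereal 0..ereal 1. ?f x) = 1 / (z + 1) - 0"
    proof (rule interval_integral_FTC_integrable[where F = ?F])
      show "set_integrable lborel (einterval (ereal 0) (ereal 1)) ?f" using i by simp
      have "((\<lambda>x. x powr (Re z + 1) / cmod (z + 1)) \<longlongrightarrow> 0 powr (Re z + 1) / cmod (z + 1)) (at_right 0)"
        using z1 z by (intro tendsto_intros tendsto_powr') (auto intro: eventually_at_right_less eventually_mono)
      hence "((\<lambda>x. x powr (Re z + 1) / cmod (z + 1)) \<longlongrightarrow> 0) (at_right 0)" by simp
      hence "(?F \<longlongrightarrow> 0) (at_right 0)"
        by (rule Lim_null_comparison[rotated]) (use Fn in \<open>auto intro!: eventually_mono[OF eventually_at_right_less]\<close>)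
      thus "((?F \<circ> real_of_ereal) \<longlongrightarrow> 0) (at_right (ereal 0))" unfolding ereal_tendsto_simps1 .
      have "(?F \<longlongrightarrow> 1 / (z + 1)) (at_left 1)"
        using contF1[OF z1] unfolding isCont_def F1 by (rule tendsto_mono[rotated]) (simp add: at_le)
      thus "((?F \<circ> real_of_ereal) \<longlongrightarrow> 1 / (z + 1)) (at_left (ereal 1))" unfolding ereal_tendsto_simps1 .
    qed (use der isC z1 in auto)
    thus "(LBINT x:{0<..<1}. ?f x) = 1 / (z + 1)"
      by (subst (asm) interval_lebesgue_integral_le_eq) auto
  }
  {
    assume z: "Re z < -1"
    hence z1: "z + 1 \<noteq> 0" by (auto simp: complex_eq_iff)
    have "set_integrable lborel {1<..} (\<lambda>x. x powr Re z)"
      by (rule set_integrable_subset[OF set_integrable_powr_at_top[of 1 "Re z"]]) (use z in auto)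
    hence i: "set_integrable lborel {1<..} ?f" by (intro int) auto
    have "(LBINT x=ereal 1..\<infinity>. ?f x) = 0 - 1 / (z + 1)"
    proof (rule interval_integral_FTC_integrable[where F = ?F])
      show "set_integrable lborel (einterval (ereal 1) \<infinity>) ?f" using i by simp
      have "((\<lambda>x. x powr (Re z + 1) / cmod (z + 1)) \<longlongrightarrow> 0 / cmod (z + 1)) at_top"
        using z1 z by (intro tendsto_intros tendsto_neg_powr filterlim_ident) auto
      hence "(?F \<longlongrightarrow> 0) at_top"
        by (intro Lim_null_comparison[of ?F]) (use Fn in \<open>auto intro!: eventually_mono[OF eventually_gt_at_top[of 0]]\<close>)
      thus "((?F \<circ> real_of_ereal) \<longlongrightarrow> 0) (at_left \<infinity>)" unfolding ereal_tendsto_simps1 .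
      have "(?F \<longlongrightarrow> 1 / (z + 1)) (at_right 1)"
        using contF1[OF z1] unfolding isCont_def F1 by (rule tendsto_mono[rotated]) (simp add: at_le)
      thus "((?F \<circ> real_of_ereal) \<longlongrightarrow> 1 / (z + 1)) (at_right (ereal 1))" unfolding ereal_tendsto_simps1 .
    qed (use der isC z1 in auto)
    thus "(LBINT x:{1<..}. ?f x) = - 1 / (z + 1)"
      by (subst (asm) interval_lebesgue_integral_le_eq) auto
  }
qed

context Fox_H_parameters
begin

lemma Fox_H_kernel_eq_h: "Fox_H_kernel m 0 p m (\<lambda>i. of_real (a i)) \<alpha> (\<lambda>j. of_real (b j)) \<beta> = h"
  by (simp add: fun_eq_iff Fox_H_kernel_def h_def rGamma_inverse_Gamma divide_inverse prod_inversef[unfolded o_def])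

definition right_of_poles :: "real \<Rightarrow> bool" where
  "right_of_poles c \<longleftrightarrow> (\<forall>j\<in>{1..m}. b j + c * \<beta> j > 0)"

lemma separates_iff_right_of_poles: "separates_Fox_H_poles m 0 a \<alpha> b \<beta> c \<longleftrightarrow> right_of_poles c"
  using beta by (auto simp: separates_Fox_H_poles_def right_of_poles_def)

lemma right_of_poles_mono: "right_of_poles c \<Longrightarrow> c \<le> c' \<Longrightarrow> right_of_poles c'"
  unfolding right_of_poles_def using beta
  by (meson add_le_cancel_left less_le_trans less_imp_le mult_right_mono)

text \<open>
  The number \<open>1\<close> lies to the right of all poles, with room to spare as there are finitely many factors. The room
  matters: the integral over \<open>(0, 1)\<close> and Euler's integral both need a line with \<open>c < 1\<close>.
\<close>

lemma obtain_right_of_poles: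
  obtains \<sigma> where "\<sigma> < 1" "right_of_poles \<sigma>"
proof -
  have "\<forall>\<^sub>F c in at_left (1::real). \<forall>j\<in>{1..m}. b j + c * \<beta> j > 0"
  proof (rule eventually_ball_finite)
    show "\<forall>j\<in>{1..m}. \<forall>\<^sub>F c in at_left 1. b j + c * \<beta> j > 0"
    proof
      fix j assume "j \<in> {1..m}"
      hence "0 < b j + 1 * \<beta> j" using beta by simp
      moreover have "((\<lambda>c. b j + c * \<beta> j) \<longlongrightarrow> b j + 1 * \<beta> j) (at_left 1)" by (intro tendsto_intros)
      ultimately show "\<forall>\<^sub>F c in at_left 1. b j + c * \<beta> j > 0" by (intro order_tendstoD(1))
    qed
  qed simp
  moreover have "\<forall>\<^sub>F c in at_left (1::real). c < 1" by (simp add: eventually_at_filter)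
  ultimately have "\<forall>\<^sub>F c in at_left (1::real). c < 1 \<and> right_of_poles c"
    by eventually_elim (simp add: right_of_poles_def)
  then obtain c where "c < 1 \<and> right_of_poles c"
    using eventually_happens[of _ "at_left (1::real)"] by auto
  thus ?thesis using that by blast
qed

lemma h_holomorphic_right: "right_of_poles \<sigma> \<Longrightarrow> h holomorphic_on {s. \<sigma> < Re s}"
  and h_continuous_line: "right_of_poles c \<Longrightarrow> continuous_on {s. Re s = c} h"
  and h_continuous_horizontal: "R > 0 \<Longrightarrow> continuous_on {s. Im s = R} h \<and> continuous_on {s. Im s = -R} h"
proof -
  have pos: "\<forall>j\<in>{1..m}. \<beta> j > 0" using beta by auto
  have hol: "h holomorphic_on - Fox_H_left_poles m (\<lambda>j. of_real (b j)) \<beta>"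
    using Fox_H_kernel_holomorphic[of m \<beta> 0 \<alpha> p m "\<lambda>i. of_real (a i)" "\<lambda>j. of_real (b j)"] pos
    unfolding Fox_H_kernel_eq_h by (simp add: Fox_H_right_poles_def)
  have P: "Im s = 0 \<and> Re s < c" if "right_of_poles c" "s \<in> Fox_H_left_poles m (\<lambda>j. of_real (b j)) \<beta>" for c s
    using Fox_H_left_poles_Re_less that separates_iff_right_of_poles by blast
  obtain c0 where c0: "right_of_poles c0" using obtain_right_of_poles by blast
  have cont: "continuous_on S h" if "S \<inter> Fox_H_left_poles m (\<lambda>j. of_real (b j)) \<beta> = {}" for S
    by (rule continuous_on_subset[OF holomorphic_on_imp_continuous_on[OF hol]]) (use that in auto)
  show "h holomorphic_on {s. \<sigma> < Re s}" if "right_of_poles \<sigma>"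
    by (rule holomorphic_on_subset[OF hol]) (use P[OF that] in fastforce)
  show "continuous_on {s. Re s = c} h" if "right_of_poles c"
    by (rule cont) (use P[OF that] in fastforce)
  show "continuous_on {s. Im s = R} h \<and> continuous_on {s. Im s = -R} h" if "R > 0"
    by (intro conjI cont) (use P[OF c0] that in fastforce)+
qed

lemma integrable_h_line: "right_of_poles c \<Longrightarrow> integrable lborel (\<lambda>t. h (Complex c t))"
  by (rule integrable_strip_decay_line[OF strip_decay_h kappa_gt_1 h_continuous_line])

definition H_real :: "real \<Rightarrow> complex" where
  "H_real x = Fox_H m 0 p m (\<lambda>i. of_real (a i)) \<alpha> (\<lambda>j. of_real (b j)) \<beta> (of_real x)"

lemma H_real_eq_vertical_line:
  assumes "right_of_poles c" "x > 0"
  shows "H_real x = (LBINT t. h (Complex c t) * exp (- Complex c t * of_real (ln x))) / (2 * of_real pi)"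
proof -
  have sep: "separates_Fox_H_poles m 0 a \<alpha> b \<beta> c" using assms separates_iff_right_of_poles by simp
  show ?thesis
    using Fox_H_eq_vertical_line[OF sep, where p = p and q = m and x = x and \<kappa> = \<kappa>, unfolded Fox_H_kernel_eq_h,
        OF strip_decay_h kappa_gt_1 assms(2)] unfolding H_real_def .
qed

text \<open>
  The modulus of \<open>w(x) h(c + \<i>t) x\<^sup>-\<^sup>c\<^sup>-\<^sup>\<i>\<^sup>t\<close> is a product of a function of \<open>x\<close> and one of \<open>t\<close>, so the double integral
  converges absolutely. Each integral transform of \<open>H\<close> below is an instance of this lemma.
\<close>

lemma H_real_Fubini:
  fixes w :: "real \<Rightarrow> complex"
  assumes c: "right_of_poles c" and S: "S \<in> sets borel" "S \<subseteq> {0<..}"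
    and w: "w \<in> borel_measurable borel" "set_integrable lborel S (\<lambda>x. cmod (w x) * x powr (-c))"
  shows "set_integrable lborel S (\<lambda>x. w x * H_real x)"
    and "(LBINT x:S. w x * H_real x) =
       (LBINT t. h (Complex c t) * (LBINT x:S. w x * exp (- Complex c t * of_real (ln x)))) / (2 * of_real pi)"
proof -
  let ?e = "\<lambda>x t. exp (- Complex c t * of_real (ln x)) :: complex"
  define f where "f = (\<lambda>x t. (indicator S x *\<^sub>R w x) * (h (Complex c t) * ?e x t))"
  have ih: "integrable lborel (\<lambda>t. h (Complex c t))" by (rule integrable_h_line[OF c])
  have [measurable]: "(\<lambda>t. h (Complex c t)) \<in> borel_measurable borel" using ih by auto
  have [measurable]: "(\<lambda>t. Complex c t) \<in> borel_measurable borel"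
    by (intro borel_measurable_continuous_onI) (auto simp: Complex_eq intro!: continuous_intros)
  have [measurable]: "w \<in> borel_measurable borel" "S \<in> sets borel" by fact+
  have meas: "case_prod f \<in> borel_measurable (lborel \<Otimes>\<^sub>M lborel)"
    unfolding f_def by measurable
  have ne: "cmod (?e x t) = x powr (-c)" if "x > 0" for x t
    using that by (simp add: powr_def)
  have nf: "cmod (f x t) = (indicator S x *\<^sub>R (cmod (w x) * x powr (-c))) * cmod (h (Complex c t))" for x t
    using ne[of x t] S(2) by (cases "x \<in> S") (auto simp: f_def norm_mult)
  have int: "integrable (lborel \<Otimes>\<^sub>M lborel) (case_prod f)"
  proof (rule lborel_pair.Fubini_integrable[OF meas])
    show "integrable lborel (\<lambda>x. LBINT t. norm (case_prod f (x, t)))"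
      using w(2) by (simp add: nf set_integrable_def)
    show "AE x in lborel. integrable lborel (\<lambda>t. case_prod f (x, t))"
    proof (rule AE_I2)
      fix x :: real
      have "(\<lambda>t. f x t) \<in> borel_measurable lborel" using meas by measurable
      moreover have "integrable lborel (\<lambda>t. norm (f x t))" unfolding nf using ih by (intro integrable_mult_right) auto
      ultimately show "integrable lborel (\<lambda>t. case_prod f (x, t))" by (simp add: integrable_norm_iff)
    qed
  qed
  have inner: "(LBINT t. f x t) = (2 * of_real pi) * (indicator S x *\<^sub>R (w x * H_real x))" for x
  proof (cases "x \<in> S")
    case True
    hence "x > 0" using S(2) by auto
    thus ?thesis using True H_real_eq_vertical_line[OF c, of x] by (simp add: f_def)
  qed (simp add: f_def)
  have "integrable lborel (\<lambda>x. LBINT t. f x t)"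
    using lborel_pair.integrable_fst'[OF int] by simp
  hence "integrable lborel (\<lambda>x. (LBINT t. f x t) / (2 * of_real pi))"
    by (rule integrable_divide)
  moreover have "(LBINT t. f x t) / (2 * of_real pi) = indicator S x *\<^sub>R (w x * H_real x)" for x
    unfolding inner by (simp add: scaleR_conv_of_real)
  ultimately have "integrable lborel (\<lambda>x. indicator S x *\<^sub>R (w x * H_real x))" by simp
  thus "set_integrable lborel S (\<lambda>x. w x * H_real x)"
    unfolding set_integrable_def .
  have "(2 * of_real pi) * (LBINT x:S. w x * H_real x) = (LBINT x. LBINT t. f x t)"
    unfolding inner set_lebesgue_integral_def by (simp only: integral_mult_right_zero)
  also have "\<dots> = (LBINT t. LBINT x. f x t)"
    by (rule lborel_pair.Fubini_integral[OF int, symmetric])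
  also have "\<dots> = (LBINT t. h (Complex c t) * (LBINT x:S. w x * ?e x t))"
  proof (rule Bochner_Integration.integral_cong[OF refl])
    fix t
    have "(LBINT x. f x t) = (LBINT x. h (Complex c t) * (indicator S x *\<^sub>R (w x * ?e x t)))"
      by (intro Bochner_Integration.integral_cong refl) (simp add: f_def scaleR_conv_of_real mult_ac)
    thus "(LBINT x. f x t) = h (Complex c t) * (LBINT x:S. w x * ?e x t)"
      by (simp only: set_lebesgue_integral_def integral_mult_right_zero)
  qed
  finally show "(LBINT x:S. w x * H_real x) =
       (LBINT t. h (Complex c t) * (LBINT x:S. w x * ?e x t)) / (2 * of_real pi)"
    by (simp add: field_simps)
qed

text \<open>
  No single line works on all of \<open>(0, \<infinity>)\<close>: convergence of \<open>\<integral> x\<^sup>l\<^sup>-\<^sup>c dx\<close> at \<open>0\<close> requires \<open>c < l + 1\<close> and at \<open>\<infinity>\<close> requires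
  \<open>c > l + 1\<close>. With one line for each part, the inner integrals are \<open>1 / (l + 1 - s)\<close> and \<open>1 / (s - (l + 1))\<close>, and the sum is
  a Cauchy integral over the boundary of the strip.
\<close>

theorem H_real_moment:
  shows "set_integrable lborel {0<..} (\<lambda>x. of_real (x ^ l) * H_real x)"
    and "(LBINT x:{0<..}. of_real (x ^ l) * H_real x) = h (of_nat l + 1)"
proof -
  obtain \<sigma> where \<sigma>: "\<sigma> < 1" "right_of_poles \<sigma>" by (rule obtain_right_of_poles)
  \<comment> \<open>The line \<open>c1\<close> works for every \<open>l\<close>; it lies strictly to the right of \<open>\<sigma>\<close> because the
    Cauchy formula needs an open half-plane.\<close>
  define c1 where "c1 = (\<sigma> + 1) / 2"
  define c2 where "c2 = real l + 2"
  have c: "\<sigma> < c1" "c1 < 1" "1 < c2" "c1 < real l + 1" "real l + 1 < c2"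
    using \<sigma> by (auto simp: c1_def c2_def field_simps)
  have rc: "right_of_poles c1" "right_of_poles c2" using right_of_poles_mono[OF \<sigma>(2)] c by auto
  let ?w = "\<lambda>x::real. of_real (x ^ l) :: complex"
  have pw: "cmod (?w x) * x powr (-c) = x powr (real l - c)" if "x > 0" for x c
    using that by (simp add: norm_power powr_realpow[symmetric] powr_add[symmetric])
  have ex: "?w x * exp (- s * of_real (ln x)) = exp ((of_nat l - s) * of_real (ln x))" if "x > 0" for x s
  proof -
    have "?w x = exp (of_nat l * of_real (ln x))"
      using that by (simp add: exp_of_nat_mult exp_of_real)
    thus ?thesis by (simp add: exp_add[symmetric] algebra_simps)
  qed
  have meas: "?w \<in> borel_measurable borel" by (intro borel_measurable_continuous_onI continuous_intros)
  have i1: "set_integrable lborel {0<..<1} (\<lambda>x. cmod (?w x) * x powr (-c1))"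
  proof -
    have "(\<lambda>x. x powr (real l - c1)) integrable_on {0..1}" using c by (intro integrable_on_powr_from_0) auto
    hence "(\<lambda>x. x powr (real l - c1)) integrable_on {0<..<1}"
      by (rule integrable_spike_set) (auto intro: negligible_subset[of "{0,1}"])
    hence "set_integrable lborel {0<..<1} (\<lambda>x. x powr (real l - c1))"
      by (rule set_integrable_lborel_nonneg) auto
    thus ?thesis by (rule set_integrable_cong[THEN iffD1, rotated 3]) (use pw in auto)
  qed
  have i2: "set_integrable lborel {1..} (\<lambda>x. cmod (?w x) * x powr (-c2))"
  proof -
    have "set_integrable lborel {1..} (\<lambda>x. x powr (real l - c2))"
      by (rule set_integrable_powr_at_top) (auto simp: c2_def)
    thus ?thesis by (rule set_integrable_cong[THEN iffD1, rotated 3]) (use pw in auto)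
  qed
  have i3: "set_integrable lborel {1<..} (\<lambda>x. cmod (?w x) * x powr (-c2))"
    by (rule set_integrable_subset[OF i2]) auto
  have S: "{0<..<1::real} \<in> sets borel" "{0<..<1} \<subseteq> {0::real<..}" "{1::real..} \<in> sets borel" "{1..} \<subseteq> {0::real<..}"
    "{1::real<..} \<in> sets borel" "{1<..} \<subseteq> {0::real<..}" by auto
  note F1 = H_real_Fubini[OF rc(1) S(1,2) meas i1]
  note F2 = H_real_Fubini[OF rc(2) S(3,4) meas i2]
  note F3 = H_real_Fubini[OF rc(2) S(5,6) meas i3]
  have "set_integrable lborel ({0<..<1} \<union> {1..}) (\<lambda>x. ?w x * H_real x)"
    by (intro set_integrable_Un F1(1) F2(1)) auto
  also have "{0<..<1} \<union> {1..} = {0::real<..}" by auto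
  finally show int: "set_integrable lborel {0<..} (\<lambda>x. ?w x * H_real x)" .
  have s1: "(LBINT x:{0<..<1}. ?w x * exp (- s * of_real (ln x))) = 1 / ((of_nat l + 1) - s)" if "Re s = c1" for s
  proof -
    have "(LBINT x:{0<..<1}. ?w x * exp (- s * of_real (ln x))) = (LBINT x:{0<..<1}. exp ((of_nat l - s) * of_real (ln x)))"
      by (intro set_lebesgue_integral_cong) (use ex in auto)
    also have "\<dots> = 1 / (of_nat l - s + 1)" by (rule complex_power_integral(1)) (use that c in auto)
    finally show ?thesis by (simp add: algebra_simps)
  qed
  have s2: "(LBINT x:{1<..}. ?w x * exp (- s * of_real (ln x))) = 1 / (s - (of_nat l + 1))" if "Re s = c2" for s
  proof -
    have "(LBINT x:{1<..}. ?w x * exp (- s * of_real (ln x))) = (LBINT x:{1<..}. exp ((of_nat l - s) * of_real (ln x)))"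
      by (intro set_lebesgue_integral_cong) (use ex in auto)
    also have "\<dots> = - 1 / (of_nat l - s + 1)" by (rule complex_power_integral(2)) (use that in \<open>auto simp: c2_def\<close>)
    also have "\<dots> = 1 / (s - (of_nat l + 1))"
      by (metis (no_types, opaque_lifting) add.commute add_diff_eq minus_diff_eq minus_divide_left minus_divide_right)
    finally show ?thesis .
  qed
  have "(LBINT x:{0<..}. ?w x * H_real x) = (LBINT x=0..\<infinity>. ?w x * H_real x)"
    by (subst interval_lebesgue_integral_le_eq) (auto simp: zero_ereal_def)
  also have "\<dots> = (LBINT x=0..1. ?w x * H_real x) + (LBINT x=1..\<infinity>. ?w x * H_real x)"
    by (rule interval_integral_sum[symmetric])
       (use int in \<open>auto simp: interval_lebesgue_integrable_def zero_ereal_def\<close>)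
  also have "(LBINT x=0..1. ?w x * H_real x) = (LBINT x:{0<..<1}. ?w x * H_real x)"
    by (subst interval_lebesgue_integral_le_eq) (auto simp: zero_ereal_def one_ereal_def)
  also have "(LBINT x=1..\<infinity>. ?w x * H_real x) = (LBINT x:{1<..}. ?w x * H_real x)"
    by (subst interval_lebesgue_integral_le_eq) (auto simp: one_ereal_def)
  also have "(LBINT x:{0<..<1}. ?w x * H_real x) =
      (LBINT t. h (Complex c1 t) / ((of_nat l + 1) - Complex c1 t)) / (2 * of_real pi)"
    by (simp only: F1(2) s1 complex.sel times_divide_eq_right mult_1_right)
  also have "(LBINT x:{1<..}. ?w x * H_real x) =
      (LBINT t. h (Complex c2 t) / (Complex c2 t - (of_nat l + 1))) / (2 * of_real pi)"
    by (simp only: F3(2) s2 complex.sel times_divide_eq_right mult_1_right)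
  also have "(LBINT t. h (Complex c1 t) / ((of_nat l + 1) - Complex c1 t)) / (2 * of_real pi) +
      (LBINT t. h (Complex c2 t) / (Complex c2 t - (of_nat l + 1))) / (2 * of_real pi) =
      ((LBINT t. h (Complex c1 t) / ((of_nat l + 1) - Complex c1 t)) +
      (LBINT t. h (Complex c2 t) / (Complex c2 t - (of_nat l + 1)))) / (2 * of_real pi)"
    by (simp add: add_divide_distrib)
  also have "(LBINT t. h (Complex c1 t) / ((of_nat l + 1) - Complex c1 t)) +
      (LBINT t. h (Complex c2 t) / (Complex c2 t - (of_nat l + 1))) = 2 * pi * h (of_nat l + 1)"
    by (rule Cauchy_formula_vertical_strip[OF h_holomorphic_right[OF \<sigma>(2)] h_continuous_horizontal strip_decay_h kappa_gt_1])
       (use c in auto)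
  finally show "(LBINT x:{0<..}. ?w x * H_real x) = h (of_nat l + 1)" by simp
qed

end

section \<open>The Laplace transform\<close>

lemma Gamma_integral_scaled:
  assumes s: "s > 0" and z: "Re z > 0"
  shows "(LBINT x:{0<..}. of_real (exp (- s * x)) * exp ((z - 1) * of_real (ln x))) = Gamma z * exp (- z * of_real (ln s))"
proof -
  \<comment> \<open>The integrand for \<open>s = 1\<close>; the general case is the substitution \<open>y = s x\<close>.\<close>
  define g where "g = (\<lambda>y::real. indicator {0<..} y *\<^sub>R (of_real (exp (- y)) * exp ((z - 1) * of_real (ln y))))"
  have eq: "of_real y powr (z - 1) / of_real (exp y) = of_real (exp (-y)) * exp ((z - 1) * of_real (ln y))"
    if "y > 0" for y :: real
    using that by (simp add: powr_def Ln_of_real exp_minus field_simps)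
  have abs: "(\<lambda>y::real. of_real (exp (- y)) * exp ((z - 1) * of_real (ln y))) absolutely_integrable_on {0<..}"
    by (rule set_integrable_cong[THEN iffD1, OF refl refl _ absolutely_integrable_Gamma_integral'[OF z]]) (use eq in auto)
  have meas: "g \<in> borel_measurable borel" unfolding g_def
    by (intro borel_measurable_continuous_on_indicator continuous_intros) auto
  have "integrable lborel g"
    using abs meas unfolding set_integrable_def g_def[symmetric] by (simp add: integrable_completion)
  hence int: "set_integrable lborel {0<..} (\<lambda>y::real. of_real (exp (- y)) * exp ((z - 1) * of_real (ln y)))"
    by (simp add: set_integrable_def g_def)
  have "((\<lambda>y::real. of_real (exp (- y)) * exp ((z - 1) * of_real (ln y))) has_integral Gamma z) {0<..}"
    using Gamma_integral_complex'[OF z] by (rule has_integral_eq[rotated]) (use eq in auto)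
  hence "integral {0<..} (\<lambda>y::real. of_real (exp (- y)) * exp ((z - 1) * of_real (ln y))) = Gamma z"
    by (rule integral_unique)
  hence "(LBINT y. g y) = Gamma z"
    using set_borel_integral_eq_integral(2)[OF int] unfolding g_def set_lebesgue_integral_def by simp
  hence "Gamma z = \<bar>s\<bar> *\<^sub>R (LBINT x. g (0 + s * x))"
    using lborel_integral_real_affine[of s g 0] s by simp
  also have "(\<lambda>x. g (0 + s * x)) = (\<lambda>x. exp ((z - 1) * of_real (ln s)) *
      (indicator {0<..} x *\<^sub>R (of_real (exp (- s * x)) * exp ((z - 1) * of_real (ln x)))))"
  proof
    fix x :: real
    show "g (0 + s * x) = exp ((z - 1) * of_real (ln s)) *
      (indicator {0<..} x *\<^sub>R (of_real (exp (- s * x)) * exp ((z - 1) * of_real (ln x))))"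
    proof (cases "x > 0")
      case True
      hence "exp ((z - 1) * of_real (ln (s * x))) = exp ((z - 1) * of_real (ln s)) * exp ((z - 1) * of_real (ln x))"
        using s by (simp add: ln_mult_pos exp_add[symmetric] algebra_simps)
      thus ?thesis using True s by (simp add: g_def)
    next
      case False
      thus ?thesis using s by (auto simp: g_def indicator_def zero_less_mult_iff)
    qed
  qed
  also have "(LBINT x. exp ((z - 1) * of_real (ln s)) * (indicator {0<..} x *\<^sub>R (of_real (exp (- s * x)) * exp ((z - 1) * of_real (ln x)))))
      = exp ((z - 1) * of_real (ln s)) * (LBINT x:{0<..}. of_real (exp (- s * x)) * exp ((z - 1) * of_real (ln x)))"
    unfolding set_lebesgue_integral_def by (rule integral_mult_right_zero)
  finally have G: "Gamma z = of_real s * exp ((z - 1) * of_real (ln s)) *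
      (LBINT x:{0<..}. of_real (exp (- s * x)) * exp ((z - 1) * of_real (ln x)))"
    using s by (simp add: scaleR_conv_of_real)
  have "of_real s = exp (of_real (ln s) :: complex)" using s by (metis exp_ln exp_of_real)
  hence "of_real s * exp ((z - 1) * of_real (ln s)) = exp (z * of_real (ln s))"
    by (simp add: exp_add[symmetric] algebra_simps)
  hence "Gamma z * exp (- z * of_real (ln s)) = (LBINT x:{0<..}. of_real (exp (- s * x)) * exp ((z - 1) * of_real (ln x))) *
      (exp (z * of_real (ln s)) * exp (- z * of_real (ln s)))" using G by (simp add: mult_ac)
  also have "exp (z * of_real (ln s)) * exp (- z * of_real (ln s)) = 1"
    by (simp add: exp_add[symmetric])
  finally show ?thesis by simp
qed

lemma set_integrable_exp_powr:
  fixes s c :: real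
  assumes "s > 0" "c < 1"
  shows "set_integrable lborel {0<..} (\<lambda>x. exp (- s * x) * x powr (- c))"
proof -
  have "(\<lambda>t. complex_of_real t powr (of_real (1 - c) - 1) / of_real (exp (s * t))) absolutely_integrable_on {0<..}"
    by (rule absolutely_integrable_Gamma_integral) (use assms in auto)
  hence "(\<lambda>t. norm (complex_of_real t powr (of_real (1 - c) - 1) / of_real (exp (s * t)))) absolutely_integrable_on {0<..}"
    by (rule absolutely_integrable_norm[unfolded o_def])
  hence "(\<lambda>t. norm (complex_of_real t powr (of_real (1 - c) - 1) / of_real (exp (s * t)))) integrable_on {0<..}"
    by (rule set_lebesgue_integral_eq_integral(1))
  hence "(\<lambda>x. exp (- s * x) * x powr (- c)) integrable_on {0<..}"
    by (rule integrable_eq) (auto simp: norm_divide norm_powr_real_powr exp_minus field_simps)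
  thus ?thesis by (rule set_integrable_lborel_nonneg) auto
qed

lemma strip_decay_reflect:
  assumes "strip_decay \<kappa> f" shows "strip_decay \<kappa> (\<lambda>s. f (1 - s))"
  unfolding strip_decay_def
proof (intro allI)
  fix u v
  obtain C T where C: "0 < C" "0 < T" "\<And>x t. x \<in> {1-v..1-u} \<Longrightarrow> T \<le> \<bar>t\<bar> \<Longrightarrow> cmod (f (Complex x t)) \<le> C * \<bar>t\<bar> powr (-\<kappa>)"
    using strip_decayE[OF assms] by metis
  have "1 - Complex x t = Complex (1 - x) (- t)" for x t by (simp add: complex_eq_iff)
  thus "\<exists>C T. 0 < C \<and> 0 < T \<and> (\<forall>x\<in>{u..v}. \<forall>t. T \<le> \<bar>t\<bar> \<longrightarrow> cmod (f (1 - Complex x t)) \<le> C * \<bar>t\<bar> powr (-\<kappa>))"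
    using C(1,2) C(3)[of "1 - _" "- _"] by (intro exI[of _ C] exI[of _ T]) auto
qed

lemma Gamma_bounded_on_strips: "\<exists>D>0. \<exists>T>0. \<forall>x\<in>{u..v}. \<forall>t. T \<le> \<bar>t\<bar> \<longrightarrow> cmod (Gamma (Complex x t)) \<le> D"
proof -
  obtain c C where cC: "c > 0" "C > 0"
    and "\<And>x y. x \<in> {u..v} \<Longrightarrow> 1 \<le> \<bar>y\<bar> \<Longrightarrow> c * Stirling_modulus x y \<le> cmod (Gamma (Complex x y))"
    and up: "\<And>x y. x \<in> {u..v} \<Longrightarrow> 1 \<le> \<bar>y\<bar> \<Longrightarrow> cmod (Gamma (Complex x y)) \<le> C * Stirling_modulus x y"
    using Gamma_vertical_strip_bounds[of u v] by metis
  define M where "M = \<bar>u\<bar> + \<bar>v\<bar> + 1"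
  have M: "M > 0" by (simp add: M_def)
  have "cmod (Gamma (Complex x t)) \<le> C * exp (M * ln (M / (pi / 2)))" if x: "x \<in> {u..v}" and t: "1 \<le> \<bar>t\<bar>" for x t
  proof -
    have "(x - 1/2) * ln \<bar>t\<bar> \<le> M * ln \<bar>t\<bar>" using x t by (intro mult_right_mono) (auto simp: M_def)
    also have "\<dots> \<le> (pi / 2) * \<bar>t\<bar> + M * ln (M / (pi / 2))" using t M by (intro ln_le_linear) auto
    finally have "Stirling_modulus x t \<le> exp (M * ln (M / (pi / 2)))"
      using t by (auto simp: Stirling_modulus_def powr_def exp_add[symmetric])
    hence "C * Stirling_modulus x t \<le> C * exp (M * ln (M / (pi / 2)))" using cC by (intro mult_left_mono) auto
    thus ?thesis using up[OF x t] by linarith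
  qed
  thus ?thesis using cC by (intro exI[of _ "C * exp (M * ln (M / (pi / 2)))"] conjI exI[of _ 1]) auto
qed

context Fox_H_parameters
begin

text \<open>
  Dual in the sense that its kernel is \<open>\<Gamma>(w) h(1 - w)\<close>.
\<close>

definition H_dual :: "real \<Rightarrow> complex" where
  "H_dual s = Fox_H 1 m m (p + 1)
                (\<lambda>j. of_real (1 - b j - \<beta> j)) \<beta>
                (\<lambda>i. if i = 1 then 0 else of_real (1 - a (i - 1) - \<alpha> (i - 1)))
                (\<lambda>i. if i = 1 then 1 else \<alpha> (i - 1)) (of_real s)"

text \<open>
  The Gamma factor of the second kernel comes from Euler's integral \<open>\<integral> exp(- s x) x\<^sup>-\<^sup>u dx = \<Gamma>(1 - u) s\<^sup>u\<^sup>-\<^sup>1\<close>, and the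
  substitution \<open>w = 1 - u\<close>, which is \<open>t \<mapsto> -t\<close> on the line, exchanges left and right poles.
\<close>

theorem Laplace_H_real_eq_H_dual:
  assumes s: "s > 0"
  shows "(LBINT x:{0<..}. of_real (exp (- s * x)) * H_real x) = H_dual s"
proof -
  obtain c where c: "c < 1" "right_of_poles c" by (rule obtain_right_of_poles)
  define b' where "b' = (\<lambda>i. if i = 1 then 0 else 1 - a (i - 1) - \<alpha> (i - 1) :: real)"
  define \<beta>' where "\<beta>' = (\<lambda>i. if i = 1 then 1 else \<alpha> (i - 1) :: real)"
  have b'_eq: "(\<lambda>i. if i = 1 then 0 else of_real (1 - a (i - 1) - \<alpha> (i - 1))) = (\<lambda>i. of_real (b' i) :: complex)"
    by (auto simp: b'_def)
  have ker: "Fox_H_kernel 1 m m (p + 1) (\<lambda>j. of_real (1 - b j - \<beta> j)) \<beta> (\<lambda>i. of_real (b' i)) \<beta>' =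
     (\<lambda>w. Gamma w * h (1 - w))"
  proof
    fix w :: complex
    have "(\<Prod>j\<in>{1+1..p+1}. Gamma (1 - of_real (b' j) - w * of_real (\<beta>' j))) =
       (\<Prod>i\<in>{1..p}. Gamma (1 - of_real (b' (Suc i)) - w * of_real (\<beta>' (Suc i))))"
      using prod.shift_bounds_cl_Suc_ivl[of "\<lambda>j. Gamma (1 - of_real (b' j) - w * of_real (\<beta>' j))" 1 p] by simp
    also have "\<dots> = (\<Prod>i\<in>{1..p}. Gamma (of_real (a i) + (1 - w) * of_real (\<alpha> i)))"
      by (intro prod.cong refl) (simp add: b'_def \<beta>'_def algebra_simps)
    finally have 1: "(\<Prod>j\<in>{1+1..p+1}. Gamma (1 - of_real (b' j) - w * of_real (\<beta>' j))) =
      (\<Prod>i\<in>{1..p}. Gamma (of_real (a i) + (1 - w) * of_real (\<alpha> i)))" .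
    have 2: "(\<Prod>i\<in>{1..m}. Gamma (1 - of_real (1 - b i - \<beta> i) - w * of_real (\<beta> i))) =
       (\<Prod>i\<in>{1..m}. Gamma (of_real (b i) + (1 - w) * of_real (\<beta> i)))"
      by (intro prod.cong refl) (simp add: algebra_simps)
    show "Fox_H_kernel 1 m m (p + 1) (\<lambda>j. of_real (1 - b j - \<beta> j)) \<beta> (\<lambda>i. of_real (b' i)) \<beta>' w = Gamma w * h (1 - w)"
      unfolding Fox_H_kernel_def 1 2
      by (simp add: h_def b'_def \<beta>'_def rGamma_inverse_Gamma divide_inverse prod_inversef[unfolded o_def])
  qed
  have sep: "separates_Fox_H_poles 1 m (\<lambda>j. 1 - b j - \<beta> j) \<beta> b' \<beta>' (1 - c)"
    using c beta by (auto simp: separates_Fox_H_poles_def b'_def \<beta>'_def right_of_poles_def algebra_simps)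
  have dec: "strip_decay \<kappa> (\<lambda>w. Gamma w * h (1 - w))"
    by (rule strip_decay_mult_bounded[OF strip_decay_reflect[OF strip_decay_h] Gamma_bounded_on_strips])
  let ?g = "\<lambda>t. Gamma (Complex (1 - c) t) * h (1 - Complex (1 - c) t) * exp (- Complex (1 - c) t * of_real (ln s))"
  have "H_dual s = (LBINT t. ?g t) / (2 * of_real pi)"
    unfolding H_dual_def b'_eq \<beta>'_def[symmetric]
    by (rule Fox_H_eq_vertical_line[OF sep, where p = m and q = "p + 1" and x = s and \<kappa> = \<kappa>, unfolded ker,
          OF dec kappa_gt_1 s])
  also have "(LBINT t. ?g t) = \<bar>-1\<bar> *\<^sub>R (LBINT t. ?g (0 + (-1) * t))"
    by (rule lborel_integral_real_affine) simp
  also have "(\<lambda>t. ?g (0 + (-1) * t)) = (\<lambda>t. h (Complex c t) *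
       (LBINT x:{0<..}. of_real (exp (- s * x)) * exp (- Complex c t * of_real (ln x))))"
  proof
    fix t
    let ?z = "Complex (1 - c) (- t)"
    have z1: "1 - ?z = Complex c t" and z2: "?z - 1 = - Complex c t" by (auto simp: complex_eq_iff)
    have "(LBINT x:{0<..}. of_real (exp (- s * x)) * exp (- Complex c t * of_real (ln x))) = Gamma ?z * exp (- ?z * of_real (ln s))"
      using Gamma_integral_scaled[OF s, of ?z] c unfolding z2 by simp
    thus "?g (0 + (-1) * t) = h (Complex c t) *
       (LBINT x:{0<..}. of_real (exp (- s * x)) * exp (- Complex c t * of_real (ln x)))"
      using z1 by (simp add: mult_ac)
  qed
  also have "\<bar>-1\<bar> *\<^sub>R (LBINT t. h (Complex c t) *
       (LBINT x:{0<..}. of_real (exp (- s * x)) * exp (- Complex c t * of_real (ln x)))) / (2 * of_real pi) =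
       (LBINT x:{0<..}. of_real (exp (- s * x)) * H_real x)"
  proof -
    have "set_integrable lborel {0<..} (\<lambda>x. cmod (of_real (exp (- s * x))) * x powr (-c))"
      using set_integrable_exp_powr[OF s c(1)] by (simp only: norm_of_real abs_exp_cancel)
    from H_real_Fubini(2)[OF c(2) _ _ _ this] show ?thesis by simp
  qed
  finally show ?thesis by simp
qed

section \<open>The exponential generating function of the moments\<close>

definition moment :: "nat \<Rightarrow> real" where
  "moment k = (\<Prod>j\<in>{1..m}. Gamma (b j + \<beta> j + \<beta> j * real k)) / (\<Prod>i\<in>{1..p}. Gamma (a i + \<alpha> i + \<alpha> i * real k))"

lemma Gamma_args_pos:
  "j \<in> {1..m} \<Longrightarrow> b j + \<beta> j + \<beta> j * real k > 0" "i \<in> {1..p} \<Longrightarrow> a i + \<alpha> i + \<alpha> i * real k > 0"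
  using beta[of j] alpha[of i] by (auto intro!: add_pos_nonneg)

lemma moment_pos: "moment k > 0"
  unfolding moment_def using Gamma_args_pos by (intro divide_pos_pos prod_pos) (auto intro: Gamma_real_pos)

lemma h_eq_moment: "h (of_nat k + 1) = of_real (moment k)"
proof -
  have 1: "of_real b' + (of_nat k + 1) * of_real \<beta>' = (of_real (b' + \<beta>' + \<beta>' * real k) :: complex)" for b' \<beta>'
    by (simp add: algebra_simps)
  show ?thesis unfolding h_def moment_def 1 Gamma_complex_of_real rGamma_inverse_Gamma
    by (simp add: divide_inverse prod_inversef[unfolded o_def])
qed

text \<open>
  By log-convexity, \<open>\<Gamma>(x + \<beta>) / \<Gamma>(x)\<close> lies between \<open>(x - 1)\<^sup>\<beta>\<close> and \<open>(x + \<beta>)\<^sup>\<beta>\<close>. Here \<open>x\<close> grows linearly in \<open>k\<close>, and for large \<open>k\<close>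
  the constants \<open>2\<beta>\<^sub>j\<close> and \<open>\<alpha>\<^sub>i / 2\<close> absorb the lower-order terms.
\<close>

lemma moment_ratio_bound:
  obtains C where "C > 0" "\<forall>\<^sub>F k in sequentially. moment (Suc k) \<le> C * real k powr a_star * moment k"
proof -
  have num: "\<forall>\<^sub>F k in sequentially. \<forall>j\<in>{1..m}.
      Gamma (b j + \<beta> j + \<beta> j * real (Suc k)) \<le> (2 * \<beta> j) powr \<beta> j * real k powr \<beta> j * Gamma (b j + \<beta> j + \<beta> j * real k)"
  proof (intro eventually_ball_finite ballI)
    fix j assume j: "j \<in> {1..m}"
    have bj: "\<beta> j > 0" using beta[OF j] by simp
    have "\<forall>\<^sub>F k in sequentially. real k \<ge> (\<bar>b j\<bar> + 2 * \<beta> j + 2) / \<beta> j"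
      by real_asymp
    thus "\<forall>\<^sub>F k in sequentially.
      Gamma (b j + \<beta> j + \<beta> j * real (Suc k)) \<le> (2 * \<beta> j) powr \<beta> j * real k powr \<beta> j * Gamma (b j + \<beta> j + \<beta> j * real k)"
      using eventually_gt_at_top[of 0]
    proof eventually_elim
      case (elim k)
      define x where "x = b j + \<beta> j + \<beta> j * real k"
      have k: "\<beta> j * real k \<ge> \<bar>b j\<bar> + 2 * \<beta> j + 2" using elim bj by (simp add: field_simps)
      have x: "x > 1" using k bj by (simp add: x_def)
      have "ln (Gamma (x + \<beta> j)) - ln (Gamma x) \<le> \<beta> j * ln (x + \<beta> j)"
        by (rule ln_Gamma_real_shift_bounds(2)) (use x bj in auto)
      also have "\<dots> \<le> \<beta> j * ln (2 * \<beta> j * real k)"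
      proof (rule mult_left_mono)
        have "x + \<beta> j \<le> 2 * (\<beta> j * real k)" unfolding x_def using k abs_ge_self[of "b j"] by linarith
        hence "x + \<beta> j \<le> 2 * \<beta> j * real k" by simp
        thus "ln (x + \<beta> j) \<le> ln (2 * \<beta> j * real k)" using x bj elim(2) by (subst ln_le_cancel_iff) auto
      qed (use bj in simp)
      finally have "ln (Gamma (x + \<beta> j)) \<le> \<beta> j * ln (2 * \<beta> j * real k) + ln (Gamma x)" by simp
      moreover have "Gamma (x + \<beta> j) > 0" "Gamma x > 0" using x bj by (auto intro!: Gamma_real_pos)
      ultimately have "Gamma (x + \<beta> j) \<le> exp (\<beta> j * ln (2 * \<beta> j * real k)) * Gamma x"
        by (metis exp_add exp_le_cancel_iff exp_ln)
      also have "exp (\<beta> j * ln (2 * \<beta> j * real k)) = (2 * \<beta> j) powr \<beta> j * real k powr \<beta> j"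
        using bj elim(2) by (subst powr_mult[symmetric]) (auto simp: powr_def)
      finally show ?case by (simp add: x_def algebra_simps)
    qed
  qed simp
  have den: "\<forall>\<^sub>F k in sequentially. \<forall>i\<in>{1..p}.
      inverse (Gamma (a i + \<alpha> i + \<alpha> i * real (Suc k))) \<le> (\<alpha> i / 2) powr (- \<alpha> i) * real k powr (- \<alpha> i) * inverse (Gamma (a i + \<alpha> i + \<alpha> i * real k))"
  proof (intro eventually_ball_finite ballI)
    fix i assume i: "i \<in> {1..p}"
    have ai: "\<alpha> i > 0" "a i + \<alpha> i > 0" using alpha[OF i] by auto
    have "\<forall>\<^sub>F k in sequentially. real k \<ge> 4 / \<alpha> i" by real_asymp
    thus "\<forall>\<^sub>F k in sequentially.
      inverse (Gamma (a i + \<alpha> i + \<alpha> i * real (Suc k))) \<le> (\<alpha> i / 2) powr (- \<alpha> i) * real k powr (- \<alpha> i) * inverse (Gamma (a i + \<alpha> i + \<alpha> i * real k))"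
      using eventually_gt_at_top[of 0]
    proof eventually_elim
      case (elim k)
      define x where "x = a i + \<alpha> i + \<alpha> i * real k"
      have k: "\<alpha> i * real k \<ge> 4" using elim ai by (simp add: field_simps)
      have "x > 1" using k ai by (simp add: x_def)
      moreover have "\<alpha> i / 2 * real k \<le> x - 1" using k ai by (simp add: x_def field_simps)
      ultimately have x: "x > 1" "\<alpha> i / 2 * real k \<le> x - 1" by auto
      have "\<alpha> i * ln (\<alpha> i / 2 * real k) \<le> \<alpha> i * ln (x - 1)"
        using ai x elim by (intro mult_left_mono) auto
      also have "\<dots> \<le> ln (Gamma (x + \<alpha> i)) - ln (Gamma x)"
        by (rule ln_Gamma_real_shift_bounds(1)) (use x ai in auto)
      finally have "- ln (Gamma (x + \<alpha> i)) \<le> (- \<alpha> i) * ln (\<alpha> i / 2 * real k) + - ln (Gamma x)" by simp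
      hence "exp (- ln (Gamma (x + \<alpha> i))) \<le> exp ((- \<alpha> i) * ln (\<alpha> i / 2 * real k)) * exp (- ln (Gamma x))"
        by (simp only: exp_add[symmetric] exp_le_cancel_iff)
      moreover have "Gamma (x + \<alpha> i) > 0" "Gamma x > 0" using x ai by (auto intro!: Gamma_real_pos)
      ultimately have "inverse (Gamma (x + \<alpha> i)) \<le> exp ((- \<alpha> i) * ln (\<alpha> i / 2 * real k)) * inverse (Gamma x)"
        by (simp add: exp_minus)
      also have "exp ((- \<alpha> i) * ln (\<alpha> i / 2 * real k)) = (\<alpha> i / 2) powr (- \<alpha> i) * real k powr (- \<alpha> i)"
        using ai elim(2) by (subst powr_mult[symmetric]) (auto simp: powr_def)
      finally show ?case by (simp add: x_def algebra_simps)
    qed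
  qed simp
  define C where "C = (\<Prod>j\<in>{1..m}. (2 * \<beta> j) powr \<beta> j) * (\<Prod>i\<in>{1..p}. (\<alpha> i / 2) powr (- \<alpha> i))"
  have "\<forall>\<^sub>F k in sequentially. moment (Suc k) \<le> C * real k powr a_star * moment k"
    using num den eventually_gt_at_top[of 0]
  proof eventually_elim
    case (elim k)
    have "(\<Prod>j\<in>{1..m}. Gamma (b j + \<beta> j + \<beta> j * real (Suc k))) \<le>
        (\<Prod>j\<in>{1..m}. (2 * \<beta> j) powr \<beta> j * real k powr \<beta> j * Gamma (b j + \<beta> j + \<beta> j * real k))"
      using elim(1) Gamma_args_pos(1)[of _ "Suc k"] by (intro prod_mono) (auto intro!: less_imp_le[OF Gamma_real_pos])
    moreover have "(\<Prod>i\<in>{1..p}. inverse (Gamma (a i + \<alpha> i + \<alpha> i * real (Suc k)))) \<le>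
        (\<Prod>i\<in>{1..p}. (\<alpha> i / 2) powr (- \<alpha> i) * real k powr (- \<alpha> i) * inverse (Gamma (a i + \<alpha> i + \<alpha> i * real k)))"
      using elim(2) Gamma_args_pos(2)[of _ "Suc k"] by (intro prod_mono) (auto intro!: less_imp_le[OF Gamma_real_pos])
    ultimately have "moment (Suc k) \<le>
        (\<Prod>j\<in>{1..m}. (2 * \<beta> j) powr \<beta> j * real k powr \<beta> j * Gamma (b j + \<beta> j + \<beta> j * real k)) *
        (\<Prod>i\<in>{1..p}. (\<alpha> i / 2) powr (- \<alpha> i) * real k powr (- \<alpha> i) * inverse (Gamma (a i + \<alpha> i + \<alpha> i * real k)))"
      unfolding moment_def divide_inverse prod_inversef[unfolded o_def, symmetric]
      using Gamma_args_pos[of _ "Suc k"] Gamma_args_pos[of _ k]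
      by (intro mult_mono) (auto intro!: prod_nonneg mult_nonneg_nonneg less_imp_le[OF Gamma_real_pos])
    also have "\<dots> = C * ((\<Prod>j\<in>{1..m}. real k powr \<beta> j) * (\<Prod>i\<in>{1..p}. real k powr (- \<alpha> i))) * moment k"
      unfolding C_def moment_def divide_inverse prod_inversef[unfolded o_def, symmetric] prod.distrib by (simp add: mult_ac)
    also have "(\<Prod>j\<in>{1..m}. real k powr \<beta> j) * (\<Prod>i\<in>{1..p}. real k powr (- \<alpha> i)) = real k powr a_star"
      using elim(3) by (simp add: powr_sum[symmetric] powr_add[symmetric] a_star_def sum_negf)
    finally show ?case .
  qed
  moreover have "C > 0" unfolding C_def using alpha beta by (intro mult_pos_pos prod_pos) fastforce+
  ultimately show ?thesis using that by blast
qed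

lemma summable_moment_series:
  assumes "a_star < 1"
  shows "summable (\<lambda>k. moment k / fact k * r ^ k)"
proof -
  obtain C where C: "C > 0" "\<forall>\<^sub>F k in sequentially. moment (Suc k) \<le> C * real k powr a_star * moment k"
    by (rule moment_ratio_bound)
  have "(\<lambda>k. \<bar>r\<bar> * C * real k powr (a_star - 1)) \<longlonglongrightarrow> \<bar>r\<bar> * C * 0"
    using assms by (intro tendsto_intros tendsto_neg_powr filterlim_real_sequentially) auto
  hence "\<forall>\<^sub>F k in sequentially. \<bar>r\<bar> * C * real k powr (a_star - 1) < 1/2" by (intro order_tendstoD(2)) auto
  with C(2) have "\<forall>\<^sub>F k in sequentially. norm (moment (Suc k) / fact (Suc k) * r ^ Suc k) \<le> 1/2 * norm (moment k / fact k * r ^ k)"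
    using eventually_gt_at_top[of 0]
  proof eventually_elim
    case (elim k)
    have "norm (moment (Suc k) / fact (Suc k) * r ^ Suc k) = moment (Suc k) * (\<bar>r\<bar> / real (Suc k)) * (\<bar>r\<bar> ^ k / fact k)"
      using moment_pos[of "Suc k"] by (simp add: abs_mult power_abs)
    also have "\<dots> \<le> (C * real k powr a_star * moment k) * (\<bar>r\<bar> / real k) * (\<bar>r\<bar> ^ k / fact k)"
      using elim moment_pos[of k] moment_pos[of "Suc k"] C(1) by (intro mult_mono mult_right_mono frac_le) auto
    also have "\<dots> = (\<bar>r\<bar> * C * real k powr (a_star - 1)) * (moment k * \<bar>r\<bar> ^ k / fact k)"
      using elim by (simp add: powr_diff)
    also have "\<dots> \<le> 1/2 * (moment k * \<bar>r\<bar> ^ k / fact k)"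
      using elim moment_pos[of k] by (intro mult_right_mono) auto
    also have "moment k * \<bar>r\<bar> ^ k / fact k = norm (moment k / fact k * r ^ k)"
      using moment_pos[of k] by (simp add: abs_mult power_abs)
    finally show ?case .
  qed
  then obtain N where "\<And>k. k \<ge> N \<Longrightarrow> norm (moment (Suc k) / fact (Suc k) * r ^ Suc k) \<le> 1/2 * norm (moment k / fact k * r ^ k)"
    unfolding eventually_sequentially by blast
  thus ?thesis by (intro summable_ratio_test[of "1/2" N]) auto
qed

lemma Re_H_real_moment:
  shows "set_integrable lborel {0<..} (\<lambda>x. x ^ l * Re (H_real x))"
    and "(LBINT x:{0<..}. x ^ l * Re (H_real x)) = moment l"
proof -
  have eq: "Re (indicator {0<..} x *\<^sub>R (of_real (x ^ l) * H_real x)) = indicator {0<..} x *\<^sub>R (x ^ l * Re (H_real x))" for x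
    by (simp add: Re_power_real flip: of_real_power)
  note i = H_real_moment(1)[of l, unfolded set_integrable_def]
  show "set_integrable lborel {0<..} (\<lambda>x. x ^ l * Re (H_real x))"
    using integrable_Re[OF i] unfolding eq set_integrable_def .
  have "(LBINT x:{0<..}. x ^ l * Re (H_real x)) = Re (LBINT x:{0<..}. of_real (x ^ l) * H_real x)"
    using integral_Re[OF i] unfolding eq set_lebesgue_integral_def .
  thus "(LBINT x:{0<..}. x ^ l * Re (H_real x)) = moment l"
    unfolding H_real_moment(2) h_eq_moment by simp
qed

text \<open>
  Positivity enters here: the integral of \<open>\<bar>(- s x)\<^sup>k / k! H(x)\<bar>\<close> is a multiple of a moment, so the
  convergent moment series at \<open>s\<close> justifies integrating the exponential series term by term.
\<close>

lemma Laplace_H_real_series: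
  assumes nonneg: "\<And>x. x > 0 \<Longrightarrow> Re (H_real x) \<ge> 0" and a: "a_star < 1" and s: "s \<ge> 0"
  shows "set_integrable lborel {0<..} (\<lambda>x. exp (- s * x) * Re (H_real x))"
    and "(\<lambda>k. moment k / fact k * (- s) ^ k) sums (LBINT x:{0<..}. exp (- s * x) * Re (H_real x))"
proof -
  define u where "u = (\<lambda>k x. indicator {0<..} x *\<^sub>R ((- s * x) ^ k / fact k * Re (H_real x)))"
  have u_eq: "u k x = ((- s) ^ k / fact k) * (indicator {0<..} x *\<^sub>R (x ^ k * Re (H_real x)))" for k x
    by (simp add: u_def power_mult_distrib[of "-s" x, simplified])
  have nu: "norm (u k x) = (s ^ k / fact k) * (indicator {0<..} x *\<^sub>R (x ^ k * Re (H_real x)))" for k x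
    unfolding u_eq using nonneg[of x] s by (auto simp: indicator_def abs_mult power_abs)
  have int: "integrable lborel (u k)" for k
    unfolding u_eq using Re_H_real_moment(1)[of k] by (auto simp: set_integrable_def)
  have iu: "(LBINT x. u k x) = moment k / fact k * (- s) ^ k" for k
    unfolding u_eq using Re_H_real_moment(2)[of k] by (simp add: set_lebesgue_integral_def)
  have niu: "(LBINT x. norm (u k x)) = moment k / fact k * s ^ k" for k
    unfolding nu using Re_H_real_moment(2)[of k] by (simp add: set_lebesgue_integral_def)
  have sums_u: "(\<lambda>k. u k x) sums (indicator {0<..} x *\<^sub>R (exp (- s * x) * Re (H_real x)))" for x
  proof -
    have "(\<lambda>k. (- s * x) ^ k /\<^sub>R fact k) sums exp (- s * x)" by (rule exp_converges)
    hence "(\<lambda>k. ((- s * x) ^ k /\<^sub>R fact k) * (indicator {0<..} x * Re (H_real x))) sums (exp (- s * x) * (indicator {0<..} x * Re (H_real x)))"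
      by (rule sums_mult2)
    thus ?thesis by (simp add: u_def mult_ac divide_inverse)
  qed
  have sm: "AE x in lborel. summable (\<lambda>k. norm (u k x))"
  proof (rule AE_I2)
    fix x :: real
    have "summable (\<lambda>k. (inverse (fact k) * (s * x) ^ k) * (indicator {0<..} x * Re (H_real x)))"
      by (intro summable_mult2 summable_exp)
    thus "summable (\<lambda>k. norm (u k x))"
      unfolding nu by (rule summable_cong[THEN iffD1, rotated]) (simp add: power_mult_distrib divide_inverse mult_ac)
  qed
  have sI: "summable (\<lambda>k. LBINT x. norm (u k x))"
    unfolding niu by (rule summable_moment_series[OF a])
  have su: "(\<Sum>k. u k x) = indicator {0<..} x *\<^sub>R (exp (- s * x) * Re (H_real x))" for x
    using sums_u[of x] by (rule sums_unique[symmetric])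
  show "set_integrable lborel {0<..} (\<lambda>x. exp (- s * x) * Re (H_real x))"
    using integrable_suminf[OF int sm sI] unfolding su set_integrable_def .
  show "(\<lambda>k. moment k / fact k * (- s) ^ k) sums (LBINT x:{0<..}. exp (- s * x) * Re (H_real x))"
    using sums_integral[OF int sm sI] unfolding su set_lebesgue_integral_def iu .
qed

lemma Wright_term_eq_moment:
  "Wright_term m p (\<lambda>j. of_real (b j + \<beta> j)) \<beta> (\<lambda>i. of_real (a i + \<alpha> i)) \<alpha> z k = of_real (moment k / fact k) * z ^ k"
proof -
  have 1: "of_real (b' + \<beta>') + of_real \<beta>' * of_nat k = (of_real (b' + \<beta>' + \<beta>' * real k) :: complex)" for b' \<beta>' by simp
  show ?thesis unfolding Wright_term_def moment_def 1 Gamma_complex_of_real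
    by simp
qed

lemma moment_series_holomorphic:
  assumes "a_star < 1"
  shows "(\<lambda>z. \<Sum>k. of_real (moment k / fact k) * z ^ k :: complex) holomorphic_on UNIV"
proof -
  have sm: "summable (\<lambda>k. of_real (moment k / fact k) * z ^ k :: complex)" for z
  proof (rule summable_norm_cancel)
    show "summable (\<lambda>k. norm (of_real (moment k / fact k) * z ^ k :: complex))"
      using summable_moment_series[OF assms, of "cmod z"] moment_pos
      by (simp add: norm_mult norm_power norm_divide abs_of_pos)
  qed
  have "((\<lambda>z. \<Sum>k. of_real (moment k / fact k) * z ^ k :: complex) has_field_derivative
      (\<Sum>k. diffs (\<lambda>k. of_real (moment k / fact k)) k * z ^ k)) (at z)" for z
    by (rule termdiffs_strong_converges_everywhere[OF sm])
  thus ?thesis by (auto simp: holomorphic_on_def field_differentiable_def)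
qed

end

section \<open>The Fox H-density\<close>

theorem lemma5:
  fixes m p :: nat and a \<alpha> b \<beta> :: "nat \<Rightarrow> real"
    and a_star \<mu> K :: real and H H' \<Psi> :: "complex \<Rightarrow> complex" and \<rho> \<phi> :: "real \<Rightarrow> real"
  defines "a_star \<equiv> (\<Sum>j\<in>{1..m}. \<beta> j) - (\<Sum>i\<in>{1..p}. \<alpha> i)"
    and "\<mu> \<equiv> (\<Sum>j\<in>{1..m}. b j) - (\<Sum>i\<in>{1..p}. a i) + (real p - real m) / 2"
    and "H \<equiv> Fox_H m 0 p m (\<lambda>i. of_real (a i)) \<alpha> (\<lambda>j. of_real (b j)) \<beta>"
    and "K \<equiv> (\<Prod>j\<in>{1..m}. Gamma (b j + \<beta> j)) / (\<Prod>i\<in>{1..p}. Gamma (a i + \<alpha> i))"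
    and "\<rho> \<equiv> (\<lambda>x. Re (H (of_real x)) / K)"
    and "\<phi> \<equiv> (\<lambda>s. LBINT x:{0<..}. exp (- s * x) * \<rho> x)"
    and "H' \<equiv> Fox_H 1 m m (p + 1)
                (\<lambda>j. of_real (1 - b j - \<beta> j)) \<beta>
                (\<lambda>i. if i = 1 then 0 else of_real (1 - a (i - 1) - \<alpha> (i - 1)))
                (\<lambda>i. if i = 1 then 1 else \<alpha> (i - 1))"
    and "\<Psi> \<equiv> Wright_Psi m p (\<lambda>j. of_real (b j + \<beta> j)) \<beta> (\<lambda>i. of_real (a i + \<alpha> i)) \<alpha>"
  assumes "\<And>i. i \<in> {1..p} \<Longrightarrow> \<alpha> i > 0 \<and> a i + \<alpha> i > 0"
    and "\<And>j. j \<in> {1..m} \<Longrightarrow> \<beta> j > 0 \<and> b j + \<beta> j > 0"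
    and "a_star > 0 \<or> a_star = 0 \<and> \<mu> < -1"
    and "\<And>x. x > 0 \<Longrightarrow> H (of_real x) \<in> \<real>\<^sub>\<ge>\<^sub>0"
  shows "of_real K = Fox_H_kernel m 0 p m (\<lambda>i. of_real (a i)) \<alpha> (\<lambda>j. of_real (b j)) \<beta> 1 \<and>
    (\<forall>x>0. \<rho> x \<ge> 0) \<and> (LBINT x:{0<..}. \<rho> x) = 1 \<and>
    (\<forall>l::nat. set_integrable lborel {0<..} (\<lambda>x. x ^ l * \<rho> x) \<and>
       of_real (LBINT x:{0<..}. x ^ l * \<rho> x) =
         1 / of_real K * Mellin (\<lambda>x. H (of_real x)) (of_nat l + 1)) \<and>
    ((\<Sum>i\<in>{1..p}. \<alpha> i) - (\<Sum>j\<in>{1..m}. \<beta> j) > -1 \<longrightarrow>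
       (\<forall>s\<ge>0. set_integrable lborel {0<..} (\<lambda>x. exp (- s * x) * \<rho> x)) \<and>
       (\<forall>s>0. of_real (\<phi> s) = 1 / of_real K * H' (of_real s)) \<and>
       ((\<lambda>s. 1 / of_real K * H' (of_real s)) \<longlongrightarrow> of_real (\<phi> 0)) (at_right (0::real)) \<and>
       (\<forall>s\<ge>0. summable (Wright_term m p (\<lambda>j. of_real (b j + \<beta> j)) \<beta>
                           (\<lambda>i. of_real (a i + \<alpha> i)) \<alpha> (- of_real s)) \<and>
              of_real (\<phi> s) = 1 / of_real K * \<Psi> (- of_real s)) \<and>
       (\<exists>\<Phi>. \<Phi> holomorphic_on UNIV \<and> (\<forall>s\<ge>0. \<Phi> (of_real s) = of_real (\<phi> s))))"
proof -
  interpret P: Fox_H_parameters m p a \<alpha> b \<beta>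
    by unfold_locales (use assms(9-11) in \<open>auto simp: a_star_def \<mu>_def\<close>)
  have H: "H (of_real x) = P.H_real x" for x by (simp add: H_def P.H_real_def)
  have H': "H' (of_real s) = P.H_dual s" for s by (simp add: H'_def P.H_dual_def)
  have K: "K = P.moment 0" by (simp add: K_def P.moment_def)
  have K0: "K > 0" using P.moment_pos[of 0] by (simp add: K)
  have rho: "\<rho> = (\<lambda>x. Re (P.H_real x) / K)" by (simp add: \<rho>_def H)
  have nn: "Re (P.H_real x) \<ge> 0" and real: "P.H_real x = of_real (Re (P.H_real x))" if "x > 0" for x
    using assms(12)[OF that] unfolding H by (auto simp: complex_nonneg_Reals_iff complex_eq_iff)
  have scale: "(LBINT x:{0<..}. f x * \<rho> x) = (LBINT x:{0<..}. f x * Re (P.H_real x)) / K" for f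
    unfolding rho times_divide_eq_right by (rule set_integral_divide_zero)
  have scale_int: "set_integrable lborel {0<..} (\<lambda>x. f x * \<rho> x)"
    if "set_integrable lborel {0<..} (\<lambda>x. f x * Re (P.H_real x))" for f
    unfolding rho times_divide_eq_right using that by (intro set_integrable_divide) auto
  have moment: "(LBINT x:{0<..}. x ^ l * \<rho> x) = P.moment l / K" for l
    unfolding scale P.Re_H_real_moment(2) ..
  have mellin: "Mellin (\<lambda>x. H (of_real x)) (of_nat l + 1) = of_real (P.moment l)" for l
  proof -
    have "Mellin (\<lambda>x. H (of_real x)) (of_nat l + 1) = (LBINT x:{0<..}. of_real (x ^ l) * P.H_real x)"
      unfolding Mellin_def H
      by (intro set_lebesgue_integral_cong) (auto simp: powr_nat)
    thus ?thesis using P.H_real_moment(2) P.h_eq_moment by simp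
  qed
  have A: "of_real K = Fox_H_kernel m 0 p m (\<lambda>i. of_real (a i)) \<alpha> (\<lambda>j. of_real (b j)) \<beta> 1"
    using P.h_eq_moment[of 0] by (simp add: K P.Fox_H_kernel_eq_h)
  have B: "\<forall>x>0. \<rho> x \<ge> 0" using nn K0 by (simp add: rho)
  have C: "(LBINT x:{0<..}. \<rho> x) = 1" using moment[of 0] K0 by (simp add: K)
  have D: "\<forall>l::nat. set_integrable lborel {0<..} (\<lambda>x. x ^ l * \<rho> x) \<and>
       of_real (LBINT x:{0<..}. x ^ l * \<rho> x) = 1 / of_real K * Mellin (\<lambda>x. H (of_real x)) (of_nat l + 1)"
    using scale_int[OF P.Re_H_real_moment(1)] by (simp add: moment mellin)
  have E: "(\<forall>s\<ge>0. set_integrable lborel {0<..} (\<lambda>x. exp (- s * x) * \<rho> x)) \<and>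
       (\<forall>s>0. of_real (\<phi> s) = 1 / of_real K * H' (of_real s)) \<and>
       ((\<lambda>s. 1 / of_real K * H' (of_real s)) \<longlongrightarrow> of_real (\<phi> 0)) (at_right (0::real)) \<and>
       (\<forall>s\<ge>0. summable (Wright_term m p (\<lambda>j. of_real (b j + \<beta> j)) \<beta>
                           (\<lambda>i. of_real (a i + \<alpha> i)) \<alpha> (- of_real s)) \<and>
              of_real (\<phi> s) = 1 / of_real K * \<Psi> (- of_real s)) \<and>
       (\<exists>\<Phi>. \<Phi> holomorphic_on UNIV \<and> (\<forall>s\<ge>0. \<Phi> (of_real s) = of_real (\<phi> s)))"
    if "(\<Sum>i\<in>{1..p}. \<alpha> i) - (\<Sum>j\<in>{1..m}. \<beta> j) > -1"
  proof -
    have a1: "P.a_star < 1" using that by (simp add: P.a_star_def)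
    note L = P.Laplace_H_real_series[OF nn a1]
    let ?W = "\<lambda>z k. Wright_term m p (\<lambda>j. of_real (b j + \<beta> j)) \<beta> (\<lambda>i. of_real (a i + \<alpha> i)) \<alpha> z k"
    have phi: "\<phi> s = (LBINT x:{0<..}. exp (- s * x) * Re (P.H_real x)) / K" for s
      unfolding \<phi>_def by (rule scale)
    have 1: "set_integrable lborel {0<..} (\<lambda>x. exp (- s * x) * \<rho> x)" if "s \<ge> 0" for s
      by (rule scale_int) (rule L(1)[OF _ that])
    have 2: "of_real (\<phi> s) = 1 / of_real K * H' (of_real s)" if s: "s > 0" for s
    proof -
      have "of_real (LBINT x:{0<..}. exp (- s * x) * Re (P.H_real x)) = (LBINT x:{0<..}. of_real (exp (- s * x) * Re (P.H_real x)) :: complex)"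
        by (rule set_integral_complex_of_real[symmetric])
      also have "\<dots> = (LBINT x:{0<..}. of_real (exp (- s * x)) * P.H_real x)"
        by (intro set_lebesgue_integral_cong) (use real in auto)
      also have "\<dots> = H' (of_real s)" using P.Laplace_H_real_eq_H_dual[OF s] by (simp add: H')
      finally show ?thesis by (simp add: phi)
    qed
    have W: "?W (- of_real s) sums of_real (K * \<phi> s)" if s: "s \<ge> 0" for s
    proof -
      have "(\<lambda>k. of_real (P.moment k / fact k * (- s) ^ k) :: complex) sums of_real (LBINT x:{0<..}. exp (- s * x) * Re (P.H_real x))"
        using L(2)[OF _ s] by (intro sums_of_real) auto
      moreover have "of_real (P.moment k / fact k * (- s) ^ k) = ?W (- of_real s) k" for k
        unfolding P.Wright_term_eq_moment by simp
      ultimately show ?thesis using K0 by (simp add: phi)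
    qed
    have 3: "summable (?W (- of_real s)) \<and> of_real (\<phi> s) = 1 / of_real K * \<Psi> (- of_real s)" if s: "s \<ge> 0" for s
    proof -
      have "\<Psi> (- of_real s) = of_real (K * \<phi> s)"
        unfolding \<Psi>_def Wright_Psi_def using W[OF s] by (rule sums_unique[symmetric])
      thus ?thesis using W[OF s] K0 by (simp add: sums_iff)
    qed
    \<comment> \<open>The Wright series at \<open>- z\<close> divided by \<open>K\<close>; it converges everywhere.\<close>
    define \<Phi> where "\<Phi> = (\<lambda>z. (\<Sum>k. of_real (P.moment k / fact k) * (- z) ^ k :: complex) / of_real K)"
    have hol: "\<Phi> holomorphic_on UNIV"
    proof -
      have "(\<lambda>z. \<Sum>k. of_real (P.moment k / fact k) * z ^ k :: complex) \<circ> uminus holomorphic_on UNIV"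
        by (rule holomorphic_on_compose_gen[OF _ P.moment_series_holomorphic[OF a1]]) (auto intro: holomorphic_intros)
      thus ?thesis unfolding \<Phi>_def o_def using K0 by (intro holomorphic_intros) auto
    qed
    have Phi: "\<Phi> (of_real s) = of_real (\<phi> s)" if s: "s \<ge> 0" for s
    proof -
      have "\<Phi> (of_real s) = (\<Sum>k. ?W (- of_real s) k) / of_real K"
        unfolding \<Phi>_def P.Wright_term_eq_moment ..
      thus ?thesis using sums_unique[OF W[OF s], symmetric] K0 by simp
    qed
    have "isCont \<Phi> (of_real 0)"
      using hol by (metis UNIV_I holomorphic_on_imp_continuous_on continuous_on_eq_continuous_at open_UNIV)
    hence "((\<lambda>s. \<Phi> (of_real s)) \<longlongrightarrow> \<Phi> (of_real 0)) (at_right 0)"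
      by (rule isCont_tendsto_compose) (intro tendsto_of_real tendsto_ident_at)
    hence "((\<lambda>s. \<Phi> (of_real s)) \<longlongrightarrow> of_real (\<phi> 0)) (at_right 0)" using Phi[of 0] by simp
    hence 4: "((\<lambda>s. 1 / of_real K * H' (of_real s)) \<longlongrightarrow> of_real (\<phi> 0)) (at_right (0::real))"
      by (rule Lim_transform_eventually)
         (use Phi 2 in \<open>auto intro!: eventually_mono[OF eventually_at_right_less] less_imp_le\<close>)
    show ?thesis using 1 2 3 4 hol Phi by blast
  qed
  show ?thesis using A B C D E by blast
qed

end
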